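(* Let $p\in(1,\infty]$ (robustness is measured in the $\ell_p$ norm), let $r>0$ and $\rho>20$. Then the following hold. (1) For every learning algorithm $A$, and any $n>0$, there exists $\mathcal D\in\mathcal F_{r,\rho}$ such that the expected robust loss when $A$ is trained on a sample of size $n$ from $\mathcal D$ is at least $\Omega(\frac dn)$. Formally, there exists a constant $c>0$ such that $$\mathbb E_{S\sim\mathcal D^n}[\mathcal L_r(A_S,\mathcal D)]\ \ge\ \frac{c\,d}{n}.$$ (2) In contrast, for any $\mathcal D\in\mathcal F_{r,\rho}$, the max margin algorithm $M$ has expected standard loss $O(\frac{\rho^2}{n})$ when trained on a sample of size $n$ from $\mathcal D$. Formally, there exists a constant $c'>0$ such that $$\mathbb E_{S\sim\mathcal D^n}[\mathcal L(M_S,\mathcal D)]\ \le\ \frac{c'\rho^2}{n}.$$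
   Context: Binary classification over $\mathbb R^d\times\{\pm1\}$. $B_p(x,r)$ is the closed $\ell_p$ ball with center $x$ and radius $r$. A classifier is a map $f:\mathbb R^d\to\{\pm1\}$. Standard loss: $\mathcal L(f,\mathcal D)=P_{(x,y)\sim\mathcal D}[f(x)\ne y]$. Robust loss: $\mathcal L_r(f,\mathcal D)=P_{(x,y)\sim\mathcal D}[\exists x'\in B_p(x,r)\text{ s.t. } f(x')\neq y]$. For a learning algorithm $A$ and training data $S$, $A_S$ is the classifier learned by $A$ from $S$. Linear classifier: $f_{w,b}(x)=+1$ if $\langle w,x\rangle\ge b$ and $-1$ if $\langle w,x\rangle<b$; its decision boundary is $H_{w,b}=\{x:\langle w,x\rangle=b\}$. $\mathcal D$ is linearly $r$-separable ($r$-separated) if $\mathcal L_r(f_{w,b},\mathcal D)=0$ for some linear classifier $f_{w,b}$. For linearly separable $\mathcal D$ (some linear classifier has zero standard loss), let $S^+,S^-\subset\mathbb R^d$ be the positively and negatively labeled parts of the support. The margin $\gamma(\mathcal D)$ is the largest real $\gamma$ for which some linear classifier $f_{w,b}$ has $\mathcal L(f_{w,b},\mathcal D)=0$ and every $x\in S^+\cup S^-$ is at $\ell_2$ distance at least $\gamma$ from $H_{w,b}$. The aspect ratio is $\rho(\mathcal D)=\mathrm{diam}_2(S^+\cup S^-)/\gamma(\mathcal D)$, where $\mathrm{diam}_2$ is the $\ell_2$ diameter. $\mathcal F_{r,\rho}$ is the set of all distributions $\mathcal D$ over $\mathbb R^d\times\{\pm1\}$ that are $r$-separated (with respect to $\ell_p$)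 and have aspect ratio at most $\rho$. The max margin algorithm $M$ is the hard margin SVM algorithm, which returns the linear classifier separating the two classes of the sample with the largest $\ell_2$ margin.
   Formalization: The lower bound in (1) is proved as c·min(1, d/n) with an absolute constant c, since c·d/n for every n > 0 fails when n < c·d (the loss is at most 1); for n ≥ d it is exactly c·d/n. *)

theory Defs
  imports "HOL-Probability.Probability"
begin

text \<open>The constants in the theorem must not depend on the dimension, so \<open>d\<close> is an ordinary
  natural number and \<open>\<real>\<^sup>d\<close> is the space of functions on \<open>{..<d}\<close> (extensional outside), with
  its product Borel structure.\<close>

definition Rvec :: "nat \<Rightarrow> (nat \<Rightarrow> real) measure" where
  "Rvec d = (\<Pi>\<^sub>M i\<in>{..<d}. borel)"

definition labelled :: "nat \<Rightarrow> ((nat \<Rightarrow> real) \<times> int) measure" where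
  "labelled d = Rvec d \<Otimes>\<^sub>M count_space {-1, 1}"

definition distribution :: "nat \<Rightarrow> ((nat \<Rightarrow> real) \<times> int) measure \<Rightarrow> bool" where
  "distribution d D \<longleftrightarrow> prob_space D \<and> sets D = sets (labelled d)"

definition inner_prod :: "nat \<Rightarrow> (nat \<Rightarrow> real) \<Rightarrow> (nat \<Rightarrow> real) \<Rightarrow> real" where
  "inner_prod d w x = (\<Sum>i<d. w i * x i)"

definition lp_norm :: "nat \<Rightarrow> ereal \<Rightarrow> (nat \<Rightarrow> real) \<Rightarrow> real" where
  "lp_norm d p v =
     (if p = \<infinity> then Max ((\<lambda>i. \<bar>v i\<bar>) ` {..<d})
      else (\<Sum>i<d. \<bar>v i\<bar> powr real_of_ereal p) powr (1 / real_of_ereal p))"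

definition lp_cball :: "nat \<Rightarrow> ereal \<Rightarrow> (nat \<Rightarrow> real) \<Rightarrow> real \<Rightarrow> (nat \<Rightarrow> real) set" where
  "lp_cball d p x r = {x' \<in> space (Rvec d). lp_norm d p (\<lambda>i. x' i - x i) \<le> r}"

definition l2_dist :: "nat \<Rightarrow> (nat \<Rightarrow> real) \<Rightarrow> (nat \<Rightarrow> real) \<Rightarrow> real" where
  "l2_dist d x x' = L2_set (\<lambda>i. x i - x' i) {..<d}"

text \<open>The distance to the empty set is \<open>\<infinity>\<close>.\<close>

definition l2_setdist :: "nat \<Rightarrow> (nat \<Rightarrow> real) \<Rightarrow> (nat \<Rightarrow> real) set \<Rightarrow> ereal" where
  "l2_setdist d x H = (INF x'\<in>H. ereal (l2_dist d x x'))"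

definition l2_diam :: "nat \<Rightarrow> (nat \<Rightarrow> real) set \<Rightarrow> ereal" where
  "l2_diam d X = (SUP x\<in>X. SUP x'\<in>X. ereal (l2_dist d x x'))"

text \<open>The losses are taken with respect to the completion, because the robust error set of a Borel
  classifier is in general only analytic.\<close>

definition std_loss ::
    "((nat \<Rightarrow> real) \<Rightarrow> int) \<Rightarrow> ((nat \<Rightarrow> real) \<times> int) measure \<Rightarrow> real" where
  "std_loss f D = measure (completion D) {(x, y) \<in> space D. f x \<noteq> y}"

definition robust_loss ::
    "nat \<Rightarrow> ereal \<Rightarrow> real \<Rightarrow> ((nat \<Rightarrow> real) \<Rightarrow> int) \<Rightarrow> ((nat \<Rightarrow> real) \<times> int) measure \<Rightarrow> real" where
  "robust_loss d p r f D =
     measure (completion D) {(x, y) \<in> space D. \<exists>x'\<in>lp_cball d p x r. f x' \<noteq> y}"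

definition linear_classifier :: "nat \<Rightarrow> (nat \<Rightarrow> real) \<Rightarrow> real \<Rightarrow> (nat \<Rightarrow> real) \<Rightarrow> int" where
  "linear_classifier d w b x = (if inner_prod d w x \<ge> b then 1 else -1)"

definition decision_boundary :: "nat \<Rightarrow> (nat \<Rightarrow> real) \<Rightarrow> real \<Rightarrow> (nat \<Rightarrow> real) set" where
  "decision_boundary d w b = {x \<in> space (Rvec d). inner_prod d w x = b}"

definition r_separated ::
    "nat \<Rightarrow> ereal \<Rightarrow> real \<Rightarrow> ((nat \<Rightarrow> real) \<times> int) measure \<Rightarrow> bool" where
  "r_separated d p r D \<longleftrightarrow> (\<exists>w b. robust_loss d p r (linear_classifier d w b) D = 0)"

definition support_part ::
    "nat \<Rightarrow> ((nat \<Rightarrow> real) \<times> int) measure \<Rightarrow> int \<Rightarrow> (nat \<Rightarrow> real) set" where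
  "support_part d D y =
     {x \<in> space (Rvec d). \<forall>\<epsilon>>0. measure D {(x', y') \<in> space D. l2_dist d x x' < \<epsilon> \<and> y' = y} > 0}"

definition separates_with_margin ::
    "nat \<Rightarrow> ((nat \<Rightarrow> real) \<times> int) measure \<Rightarrow> real \<Rightarrow> bool" where
  "separates_with_margin d D \<gamma> \<longleftrightarrow>
     (\<exists>w b. std_loss (linear_classifier d w b) D = 0 \<and>
        (\<forall>x \<in> support_part d D 1 \<union> support_part d D (-1).
           ereal \<gamma> \<le> l2_setdist d x (decision_boundary d w b)))"

text \<open>There is no such \<open>\<gamma>\<close> if only one label occurs: then a constant classifier
  (\<open>w = 0\<close>, \<open>b \<noteq> 0\<close>) has an empty decision boundary.\<close>

definition is_margin :: "nat \<Rightarrow> ((nat \<Rightarrow> real) \<times> int) measure \<Rightarrow> real \<Rightarrow> bool" where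
  "is_margin d D \<gamma> \<longleftrightarrow>
     separates_with_margin d D \<gamma> \<and> (\<forall>\<gamma>'. separates_with_margin d D \<gamma>' \<longrightarrow> \<gamma>' \<le> \<gamma>)"

definition aspect_ratio_le :: "nat \<Rightarrow> ((nat \<Rightarrow> real) \<times> int) measure \<Rightarrow> real \<Rightarrow> bool" where
  "aspect_ratio_le d D \<rho> \<longleftrightarrow>
     (\<exists>\<gamma>>0. is_margin d D \<gamma> \<and>
        l2_diam d (support_part d D 1 \<union> support_part d D (-1)) / ereal \<gamma> \<le> ereal \<rho>)"

definition sep_class ::
    "nat \<Rightarrow> ereal \<Rightarrow> real \<Rightarrow> real \<Rightarrow> ((nat \<Rightarrow> real) \<times> int) measure set" where
  "sep_class d p r \<rho> = {D. distribution d D \<and> r_separated d p r D \<and> aspect_ratio_le d D \<rho>}"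

text \<open>Learning algorithms map finite samples to classifiers; no measurability is imposed.\<close>

definition learning_algorithms ::
    "nat \<Rightarrow> (((nat \<Rightarrow> real) \<times> int) list \<Rightarrow> (nat \<Rightarrow> real) \<Rightarrow> int) set" where
  "learning_algorithms d = lists (space (labelled d)) \<rightarrow> (space (Rvec d) \<rightarrow> {-1, 1})"

definition iid_samples ::
    "nat \<Rightarrow> ((nat \<Rightarrow> real) \<times> int) measure \<Rightarrow> (nat \<Rightarrow> (nat \<Rightarrow> real) \<times> int) measure" where
  "iid_samples n D = completion (\<Pi>\<^sub>M i\<in>{..<n}. D)"

definition sample_list :: "nat \<Rightarrow> (nat \<Rightarrow> 'a) \<Rightarrow> 'a list" where
  "sample_list n S = map S [0..<n]"

definition separates_sample ::
    "nat \<Rightarrow> ((nat \<Rightarrow> real) \<times> int) list \<Rightarrow> (nat \<Rightarrow> real) \<Rightarrow> real \<Rightarrow> bool" where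
  "separates_sample d S w b \<longleftrightarrow> (\<forall>(x, y) \<in> set S. linear_classifier d w b x = y)"

definition sample_margin ::
    "nat \<Rightarrow> ((nat \<Rightarrow> real) \<times> int) list \<Rightarrow> (nat \<Rightarrow> real) \<Rightarrow> real \<Rightarrow> ereal" where
  "sample_margin d S w b = (INF (x, y)\<in>set S. l2_setdist d x (decision_boundary d w b))"

definition is_max_margin ::
    "nat \<Rightarrow> ((nat \<Rightarrow> real) \<times> int) list \<Rightarrow> (nat \<Rightarrow> real) \<Rightarrow> real \<Rightarrow> bool" where
  "is_max_margin d S w b \<longleftrightarrow>
     separates_sample d S w b \<and>
     (\<forall>w' b'. separates_sample d S w' b' \<longrightarrow> sample_margin d S w' b' \<le> sample_margin d S w b)"

text \<open>For a separable sample with both labels the maximizer is unique up to positive scaling.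
  On a nonempty sample with a single label the maximizers are exactly the \<open>w = 0\<close>, \<open>b \<noteq> 0\<close> with
  margin \<open>\<infinity>\<close> and the right sign of \<open>b\<close> (on the coordinates below \<open>d\<close>), so the constant
  classifier with that label is returned. The value on a nonseparable sample is irrelevant.\<close>

definition max_margin ::
    "nat \<Rightarrow> ((nat \<Rightarrow> real) \<times> int) list \<Rightarrow> (nat \<Rightarrow> real) \<Rightarrow> int" where
  "max_margin d S = (case (SOME (w, b). is_max_margin d S w b) of (w, b) \<Rightarrow> linear_classifier d w b)"

end

theory Submission
  imports Defs
begin

text \<open>Part 1. There are \<open>d\<close> pairs of points such that, for every choice of one point (with its label)
  from each pair, the \<open>\<ell>\<^sub>p\<close> balls around the chosen points are linearly separated, although the balls around
  the two points of a pair meet: the separating hyperplane is tilted slightly towards every sign pattern.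
  A learner that has not seen pair \<open>i\<close> labels the common point of the two balls wrongly for half of
  the choices, so mass \<open>\<Theta>(1 / max n d)\<close> on each pair gives the lower bound by averaging over all choices.

  Part 2. The expected loss is the expected number of leave-one-out mistakes on \<open>n + 1\<close> points,
  divided by \<open>n + 1\<close>. The hard margin classifier is determined by the nearest points of the
  convex hulls of the two classes. If leaving out a point leads to a mistake on it, then its convex
  weight in the nearest pair is at least \<open>\<gamma>\<^sup>2 / R\<^sup>2\<close>, where \<open>R\<close> is the diameter. The weights sum up to \<open>2\<close>, so
  there are at most \<open>2 R\<^sup>2 / \<gamma>\<^sup>2\<close> mistakes.\<close>

section \<open>Nearest points of two convex hulls\<close>

text \<open>The balls of a pair touch, so a tilt of the normal vector has to gain more on every pair
  than it adds to the dual norm, which measures the reach of the balls. For finite \<open>p\<close>,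
  tilting a coordinate functional by a small \<open>\<epsilon>\<close> costs less than it gains. For
  \<open>p = \<infinity>\<close> the dual norm is l_1, every tilted coordinate counts in full, and
  the gain is lost in high dimension; hence a second design. All points have norm at most 10 times
  the margin \<open>\<gamma>\<close>, so the diameter is at most \<open>20 * \<gamma>\<close>: this
  is where \<open>20 < \<rho>\<close> enters. Finite support makes every set measurable in the
  completion, so no learner is excluded.

  For the upper bound there is an obstacle besides geometry: \<open>max_margin\<close> is chosen by
  \<open>SOME\<close>, and measurability of its loss is not evident. The quadratic program behind it
  is stable, in that almost optimal pairs are close to the optimum. The prediction can therefore be
  read off from rational feasible pairs, and the loss agrees almost everywhere with a measurable
  function.\<close>

lemma inner_prod_commute: "inner_prod d a b = inner_prod d b a"
  by (simp add: inner_prod_def mult.commute)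

lemma inner_prod_add_left: "inner_prod d (\<lambda>j. a j + b j) c = inner_prod d a c + inner_prod d b c"
  and inner_prod_diff_left: "inner_prod d (\<lambda>j. a j - b j) c = inner_prod d a c - inner_prod d b c"
  and inner_prod_scale_left: "inner_prod d (\<lambda>j. t * a j) c = t * inner_prod d a c"
  by (simp_all add: inner_prod_def algebra_simps sum.distrib sum_subtractf sum_distrib_left)

lemma inner_prod_sum_left: "inner_prod d (\<lambda>j. \<Sum>k\<in>A. f k j) c = (\<Sum>k\<in>A. inner_prod d (f k) c)"
  unfolding inner_prod_def sum_distrib_right by (rule sum.swap)

lemmas inner_prod_left = inner_prod_add_left inner_prod_diff_left inner_prod_scale_left

lemma inner_prod_add_right: "inner_prod d c (\<lambda>j. a j + b j) = inner_prod d c a + inner_prod d c b"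
  and inner_prod_diff_right: "inner_prod d c (\<lambda>j. a j - b j) = inner_prod d c a - inner_prod d c b"
  and inner_prod_scale_right: "inner_prod d c (\<lambda>j. t * a j) = t * inner_prod d c a"
  by (simp_all add: inner_prod_commute[of d c] inner_prod_left)

lemma inner_prod_sum_right: "inner_prod d c (\<lambda>j. \<Sum>k\<in>A. f k j) = (\<Sum>k\<in>A. inner_prod d c (f k))"
  by (simp add: inner_prod_commute[of d c] inner_prod_sum_left)

lemmas inner_prod_right = inner_prod_add_right inner_prod_diff_right inner_prod_scale_right

lemma inner_prod_self_nonneg [simp]: "0 \<le> inner_prod d v v"
  by (simp add: inner_prod_def sum_nonneg)

lemma inner_prod_self_eq_0: "inner_prod d v v = 0 \<longleftrightarrow> (\<forall>j<d. v j = 0)"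
  by (auto simp: inner_prod_def sum_nonneg_eq_0_iff)

lemma L2_set_eq_sqrt_inner_prod: "L2_set v {..<d} = sqrt (inner_prod d v v)"
  by (simp add: L2_set_def inner_prod_def power2_eq_square)

lemma inner_prod_self_eq: "inner_prod d v v = (L2_set v {..<d})\<^sup>2"
  by (simp add: L2_set_eq_sqrt_inner_prod)

lemma abs_inner_prod_le: "\<bar>inner_prod d a b\<bar> \<le> L2_set a {..<d} * L2_set b {..<d}"
proof -
  have "\<bar>inner_prod d a b\<bar> \<le> (\<Sum>i<d. \<bar>a i\<bar> * \<bar>b i\<bar>)"
    unfolding inner_prod_def by (rule order_trans[OF sum_abs]) (simp add: abs_mult)
  also have "\<dots> \<le> L2_set a {..<d} * L2_set b {..<d}" by (rule L2_set_mult_ineq)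
  finally show ?thesis .
qed

lemma inner_prod_cong: "(\<And>j. j < d \<Longrightarrow> a j = a' j) \<Longrightarrow> (\<And>j. j < d \<Longrightarrow> b j = b' j) \<Longrightarrow> inner_prod d a b = inner_prod d a' b'"
  by (simp add: inner_prod_def)

section \<open>Convex combinations and nearest pairs of weights\<close>

definition convex_weights :: "'i set \<Rightarrow> ('i \<Rightarrow> real) \<Rightarrow> bool" where
  "convex_weights J l \<longleftrightarrow> (\<forall>k\<in>J. 0 \<le> l k) \<and> sum l J = 1"

definition wsum :: "'i set \<Rightarrow> ('i \<Rightarrow> real) \<Rightarrow> ('i \<Rightarrow> nat \<Rightarrow> real) \<Rightarrow> nat \<Rightarrow> real" where
  "wsum J l x = (\<lambda>j. \<Sum>k\<in>J. l k * x k j)"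

text \<open>The minimisation runs over weights instead of hull points, because the mistake bound
  charges every left-out point to its weight.\<close>

definition nearest_weights ::
    "nat \<Rightarrow> ('i \<Rightarrow> nat \<Rightarrow> real) \<Rightarrow> 'i set \<Rightarrow> 'i set \<Rightarrow> ('i \<Rightarrow> real) \<Rightarrow> ('i \<Rightarrow> real) \<Rightarrow> bool" where
  "nearest_weights d x P N l m \<longleftrightarrow> convex_weights P l \<and> convex_weights N m \<and>
     (\<forall>l' m'. convex_weights P l' \<longrightarrow> convex_weights N m' \<longrightarrow>
        l2_dist d (wsum P l x) (wsum N m x) \<le> l2_dist d (wsum P l' x) (wsum N m' x))"

lemma l2_dist_commute: "l2_dist d a b = l2_dist d b a"
  by (simp add: l2_dist_def L2_set_def power2_commute)

lemma l2_dist_nonneg [simp]: "0 \<le> l2_dist d a b"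
  by (simp add: l2_dist_def)

lemma l2_dist_triangle: "l2_dist d a c \<le> l2_dist d a b + l2_dist d b c"
  using L2_set_triangle_ineq[of "\<lambda>j. a j - b j" "\<lambda>j. b j - c j" "{..<d}"]
  by (simp add: l2_dist_def)

lemma l2_dist_power2: "(l2_dist d a b)\<^sup>2 = inner_prod d (\<lambda>j. a j - b j) (\<lambda>j. a j - b j)"
  by (simp add: l2_dist_def inner_prod_self_eq)

lemma nearest_weights_commute: "nearest_weights d x P N l m \<Longrightarrow> nearest_weights d x N P m l"
  unfolding nearest_weights_def l2_dist_commute[of d "wsum N _ x"] by blast

text \<open>A closed subset of a product of compact sets (Tychonoff). Weights are functions on all
  of \<open>'i\<close>, so those outside \<open>J\<close> are pinned to \<open>0\<close>; their
  unconstrained values would destroy compactness.\<close>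

lemma compact_convex_weights:
  fixes J :: "'i set"
  assumes "finite J"
  shows "compact {l::'i \<Rightarrow> real. convex_weights J l \<and> (\<forall>k. k \<notin> J \<longrightarrow> l k = 0)}" (is "compact ?K")
proof -
  let ?X = "\<lambda>k. if k \<in> J then {0..1::real} else {0}"
  let ?C = "PiE UNIV ?X"
  have "compactin (product_topology (\<lambda>k::'i. euclidean) UNIV) ?C"
    by (subst compactin_PiE) auto
  then have c: "compact ?C"
    by (simp add: euclidean_product_topology)
  have "closed {l::'i \<Rightarrow> real. sum l J = 1}"
    by (intro closed_Collect_eq continuous_intros) (simp_all add: continuous_on_sum)
  moreover have "?K = ?C \<inter> {l. sum l J = 1}"
  proof (intro set_eqI iffI)
    fix l assume l: "l \<in> ?K"
    then have "l k \<le> 1" if "k \<in> J" for k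
      using member_le_sum[of k J l] that assms by (auto simp: convex_weights_def)
    with l show "l \<in> ?C \<inter> {l. sum l J = 1}" by (auto simp: convex_weights_def)
  next
    fix l assume l: "l \<in> ?C \<inter> {l. sum l J = 1}"
    then have "l k \<in> ?X k" for k by (auto simp: PiE_def Pi_def)
    note h = this
    have "0 \<le> l k" if "k \<in> J" for k using h[of k] that by simp
    moreover have "l k = 0" if "k \<notin> J" for k using h[of k] that by simp
    ultimately show "l \<in> ?K" using l by (auto simp: convex_weights_def)
  qed
  ultimately show ?thesis using compact_Int_closed[OF c] by simp
qed

lemma convex_weights_cong:
  "(\<And>k. k \<in> J \<Longrightarrow> l k = l' k) \<Longrightarrow> convex_weights J l = convex_weights J l'"
  by (auto simp: convex_weights_def cong: sum.cong)

lemma wsum_cong: "(\<And>k. k \<in> J \<Longrightarrow> l k = l' k) \<Longrightarrow> wsum J l x = wsum J l' x"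
  by (auto simp: wsum_def)

lemma convex_weights_unit: "finite J \<Longrightarrow> p \<in> J \<Longrightarrow> convex_weights J (\<lambda>k. of_bool (k = p))"
  by (auto simp: convex_weights_def of_bool_def)

lemma wsum_unit: "finite J \<Longrightarrow> p \<in> J \<Longrightarrow> wsum J (\<lambda>k. of_bool (k = p)) x = x p"
  by (simp add: wsum_def Int_absorb1)

lemma nearest_weights_exist:
  fixes P N :: "'i set"
  assumes fin: "finite P" "finite N" and ne: "P \<noteq> {}" "N \<noteq> {}"
  obtains l m where "nearest_weights d x P N l m"
proof -
  let ?K = "\<lambda>J. {l::'i \<Rightarrow> real. convex_weights J l \<and> (\<forall>k. k \<notin> J \<longrightarrow> l k = 0)}"
  let ?f = "\<lambda>(l, m). l2_dist d (wsum P l x) (wsum N m x)"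
  \<comment> \<open>\<open>?r\<close> moves arbitrary weights into the compact set
    \<open>?K J\<close> without changing the combination, so a minimum over the compact set is a
    minimum over all weights.\<close>
  let ?r = "\<lambda>J (l::'i \<Rightarrow> real) k. if k \<in> J then l k else 0"
  have r: "?r J l \<in> ?K J" "wsum J (?r J l) x = wsum J l x" if "convex_weights J l" for J l
  proof -
    have "convex_weights J (?r J l)" using that by (subst convex_weights_cong[of J _ l]) auto
    then show "?r J l \<in> ?K J" by simp
    show "wsum J (?r J l) x = wsum J l x" by (rule wsum_cong) simp
  qed
  from ne obtain a b where ab: "a \<in> P" "b \<in> N" by auto
  have "?K P \<times> ?K N \<noteq> {}"
    using r(1)[OF convex_weights_unit[OF fin(1) ab(1)]] r(1)[OF convex_weights_unit[OF fin(2) ab(2)]]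
    by blast
  moreover have "compact (?K P \<times> ?K N)"
    by (intro compact_Times compact_convex_weights fin)
  moreover have "continuous_on (?K P \<times> ?K N) ?f"
  proof -
    have "continuous_on (?K P \<times> ?K N) (\<lambda>z. fst z k)" "continuous_on (?K P \<times> ?K N) (\<lambda>z. snd z k)" for k
      by (rule continuous_on_product_then_coordinatewise, intro continuous_intros)+
    then show ?thesis
      unfolding case_prod_unfold l2_dist_def L2_set_def wsum_def
      by (intro continuous_intros)
  qed
  ultimately have "\<exists>z\<in>?K P \<times> ?K N. \<forall>y\<in>?K P \<times> ?K N. ?f z \<le> ?f y"
    by (intro continuous_attains_inf)
  then obtain z where z: "z \<in> ?K P \<times> ?K N" "\<And>y. y \<in> ?K P \<times> ?K N \<Longrightarrow> ?f z \<le> ?f y"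
    by blast
  obtain l m where lm: "z = (l, m)" by (cases z)
  have "nearest_weights d x P N l m"
    unfolding nearest_weights_def
  proof (intro conjI allI impI)
    show "convex_weights P l" "convex_weights N m" using z(1) lm by auto
    fix l' m' assume c: "convex_weights P l'" "convex_weights N m'"
    show "l2_dist d (wsum P l x) (wsum N m x) \<le> l2_dist d (wsum P l' x) (wsum N m' x)"
      using z(2)[OF SigmaI[OF r(1)[OF c(1)] r(1)[OF c(2)]]] unfolding lm r(2)[OF c(1)] r(2)[OF c(2)] prod.case .
  qed
  then show ?thesis by (rule that)
qed

lemma convex_weights_mix:
  assumes "convex_weights J l" "convex_weights J l'" "0 \<le> t" "t \<le> 1"
  shows "convex_weights J (\<lambda>k. l k + t * (l' k - l k))"
proof -
  have "0 \<le> l k + t * (l' k - l k)" if "k \<in> J" for k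
  proof -
    have "0 \<le> (1 - t) * l k + t * l' k" using assms that by (auto simp: convex_weights_def)
    then show ?thesis by (simp add: algebra_simps)
  qed
  moreover have "(\<Sum>k\<in>J. l k + t * (l' k - l k)) = sum l J + t * (sum l' J - sum l J)"
    by (simp add: sum.distrib sum_subtractf sum_distrib_left algebra_simps)
  ultimately show ?thesis using assms by (auto simp: convex_weights_def)
qed

lemma wsum_mix: "wsum J (\<lambda>k. l k + t * (l' k - l k)) x = (\<lambda>j. wsum J l x j + t * (wsum J l' x j - wsum J l x j))"
  by (simp add: wsum_def sum.distrib sum_subtractf sum_distrib_left algebra_simps)

lemma inner_prod_wsum: "inner_prod d v (wsum J l x) = (\<Sum>k\<in>J. l k * inner_prod d v (x k))"
  unfolding wsum_def by (simp add: inner_prod_sum_right inner_prod_right)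

lemma inner_prod_wsum_le:
  assumes "convex_weights J l" "\<And>k. k \<in> J \<Longrightarrow> inner_prod d v (x k) \<le> c"
  shows "inner_prod d v (wsum J l x) \<le> c"
proof -
  have "(\<Sum>k\<in>J. l k * inner_prod d v (x k)) \<le> (\<Sum>k\<in>J. l k * c)"
    using assms by (intro sum_mono mult_left_mono) (auto simp: convex_weights_def)
  also have "\<dots> = c" using assms(1) by (simp add: convex_weights_def flip: sum_distrib_right)
  finally show ?thesis by (simp add: inner_prod_wsum)
qed

lemma inner_prod_wsum_ge:
  assumes "convex_weights J l" "\<And>k. k \<in> J \<Longrightarrow> c \<le> inner_prod d v (x k)"
  shows "c \<le> inner_prod d v (wsum J l x)"
proof -
  have "(\<Sum>k\<in>J. l k * c) \<le> (\<Sum>k\<in>J. l k * inner_prod d v (x k))"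
    using assms by (intro sum_mono mult_left_mono) (auto simp: convex_weights_def)
  moreover have "(\<Sum>k\<in>J. l k * c) = c" using assms(1) by (simp add: convex_weights_def flip: sum_distrib_right)
  ultimately show ?thesis by (simp add: inner_prod_wsum)
qed

lemma l2_dist_wsum_le:
  assumes "convex_weights J l" "\<And>k. k \<in> J \<Longrightarrow> l2_dist d a (x k) \<le> R"
  shows "l2_dist d a (wsum J l x) \<le> R"
proof -
  have [simp]: "finite J" using assms(1) by (metis convex_weights_def sum.infinite zero_neq_one)
  have "(\<lambda>j. a j - wsum J l x j) = (\<lambda>j. \<Sum>k\<in>J. l k * (a j - x k j))"
    using assms(1) by (simp add: wsum_def convex_weights_def algebra_simps sum_subtractf flip: sum_distrib_left)
  \<comment> \<open>Stated for subsets of \<open>J\<close>, where the weights need not sum to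
    \<open>1\<close>, so that the induction goes through; the normalisation was already used to move
    \<open>a\<close> under the sum.\<close>
  moreover have "L2_set (\<lambda>j. \<Sum>k\<in>B. l k * (a j - x k j)) {..<d} \<le> (\<Sum>k\<in>B. l k * l2_dist d a (x k))"
    if "finite B" "B \<subseteq> J" for B
    using that
  proof induction
    case (insert k B)
    have "L2_set (\<lambda>j. \<Sum>k\<in>insert k B. l k * (a j - x k j)) {..<d} \<le>
      L2_set (\<lambda>j. l k * (a j - x k j)) {..<d} + L2_set (\<lambda>j. \<Sum>k\<in>B. l k * (a j - x k j)) {..<d}"
      using insert by (simp add: L2_set_triangle_ineq)
    also have "\<dots> \<le> l k * l2_dist d a (x k) + (\<Sum>k\<in>B. l k * l2_dist d a (x k))"
      using insert assms(1) by (intro add_mono) (auto simp: convex_weights_def l2_dist_def L2_set_right_distrib)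
    finally show ?case using insert by simp
  qed (simp add: L2_set_def)
  ultimately have "l2_dist d a (wsum J l x) \<le> (\<Sum>k\<in>J. l k * l2_dist d a (x k))"
    by (simp add: l2_dist_def)
  also have "\<dots> \<le> (\<Sum>k\<in>J. l k * R)"
    using assms by (intro sum_mono mult_left_mono) (auto simp: convex_weights_def)
  also have "\<dots> = R" using assms(1) by (simp add: convex_weights_def flip: sum_distrib_right)
  finally show ?thesis .
qed

section \<open>Optimality conditions for the nearest pair\<close>

lemma inner_prod_self_add_scale:
  "inner_prod d (\<lambda>j. v j + t * u j) (\<lambda>j. v j + t * u j) =
     inner_prod d v v + 2 * t * inner_prod d v u + t\<^sup>2 * inner_prod d u u"
  using inner_prod_commute[of d v u]
  by (simp add: inner_prod_left inner_prod_right algebra_simps power2_eq_square)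

lemma nonneg_if_quadratic_nonneg:
  fixes a b :: real
  assumes "\<And>t. 0 < t \<Longrightarrow> t \<le> 1 \<Longrightarrow> 0 \<le> 2 * t * a + t\<^sup>2 * b"
  shows "0 \<le> a"
proof (rule ccontr)
  assume "\<not> 0 \<le> a"
  then have a: "a < 0" by simp
  \<comment> \<open>Small enough that \<open>t * b\<close> is at most \<open>- a\<close>, which
    leaves \<open>2 * a + t * b\<close> negative.\<close>
  define t where "t = min 1 (- a / (\<bar>b\<bar> + 1))"
  have "0 < - a / (\<bar>b\<bar> + 1)" using a by (intro divide_pos_pos) auto
  then have t: "0 < t" "t \<le> 1" by (auto simp: t_def)
  have "t * b \<le> t * (\<bar>b\<bar> + 1)" using t by (intro mult_left_mono) auto
  also have "\<dots> \<le> (- a / (\<bar>b\<bar> + 1)) * (\<bar>b\<bar> + 1)"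
    by (intro mult_right_mono) (auto simp: t_def)
  also have "\<dots> = - a" by simp
  finally have "2 * a + t * b < 0" using a by simp
  then have "t * (2 * a + t * b) < 0" using t by (simp add: mult_pos_neg)
  moreover have "t * (2 * a + t * b) = 2 * t * a + t\<^sup>2 * b" by (simp add: algebra_simps power2_eq_square)
  ultimately show False using assms[OF t] by simp
qed

text \<open>By convexity the segment from \<open>wsum P l x\<close> to \<open>wsum P l' x\<close>
  stays in the hull, so the squared distance to the other nearest point, a quadratic polynomial in
  \<open>t\<close>, cannot drop below its value at \<open>0\<close>.\<close>

lemma nearest_weights_segment:
  assumes near: "nearest_weights d x P N l m" and l': "convex_weights P l'" and t: "0 \<le> t" "t \<le> 1"
  defines "v \<equiv> \<lambda>j. wsum P l x j - wsum N m x j"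
  defines "u \<equiv> \<lambda>j. wsum P l' x j - wsum P l x j"
  shows "0 \<le> 2 * t * inner_prod d v u + t\<^sup>2 * inner_prod d u u"
proof -
  let ?l = "\<lambda>k. l k + t * (l' k - l k)"
  have "l2_dist d (wsum P l x) (wsum N m x) \<le> l2_dist d (wsum P ?l x) (wsum N m x)"
    using near convex_weights_mix[OF _ l' t, of l] unfolding nearest_weights_def by blast
  then have "(l2_dist d (wsum P l x) (wsum N m x))\<^sup>2 \<le> (l2_dist d (wsum P ?l x) (wsum N m x))\<^sup>2"
    by (simp add: power_mono)
  moreover have "(l2_dist d (wsum P ?l x) (wsum N m x))\<^sup>2 = inner_prod d (\<lambda>j. v j + t * u j) (\<lambda>j. v j + t * u j)"
    unfolding l2_dist_power2 wsum_mix v_def u_def by (simp add: algebra_simps)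
  ultimately show ?thesis
    unfolding inner_prod_self_add_scale l2_dist_power2 v_def[symmetric] by simp
qed

text \<open>The obtuse-angle criterion for a projection: the derivative of the squared distance
  along a segment in the hull is nonnegative at its start.\<close>

lemma nearest_weights_first_order:
  assumes near: "nearest_weights d x P N l m" and l': "convex_weights P l'"
  defines "v \<equiv> \<lambda>j. wsum P l x j - wsum N m x j"
  shows "inner_prod d v (wsum P l x) \<le> inner_prod d v (wsum P l' x)"
proof -
  have "0 \<le> inner_prod d v (\<lambda>j. wsum P l' x j - wsum P l x j)"
    unfolding v_def
    by (rule nonneg_if_quadratic_nonneg, rule nearest_weights_segment[OF near l']) simp_all
  then show ?thesis by (simp add: inner_prod_right)
qed

text \<open>Moving the nearest pair without \<open>p\<close> towards
  the misclassified \<open>x p\<close> decreases the squared distance by \<open>V'\<^sup>2 / (4 R\<^sup>2)\<close>, whereas removing \<open>p\<close> from the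
  full nearest pair increases it only by a term quadratic in the weight of \<open>p\<close>.\<close>

lemma leave_one_out_weight:
  assumes near: "nearest_weights d x P N l m" and finP: "finite P" and p: "p \<in> P"
    and near': "nearest_weights d x (P - {p}) N l' m'"
    and R: "\<And>i k. i \<in> P \<union> N \<Longrightarrow> k \<in> P \<union> N \<Longrightarrow> l2_dist d (x i) (x k) \<le> R"
    and wrong: "2 * inner_prod d (\<lambda>j. wsum (P - {p}) l' x j - wsum N m' x j) (x p) \<le>
       inner_prod d (\<lambda>j. wsum (P - {p}) l' x j - wsum N m' x j) (wsum (P - {p}) l' x) +
       inner_prod d (\<lambda>j. wsum (P - {p}) l' x j - wsum N m' x j) (wsum N m' x)"
    and pos: "0 < l2_dist d (wsum P l x) (wsum N m x)"
  shows "(l2_dist d (wsum P l x) (wsum N m x))\<^sup>2 \<le> 4 * R\<^sup>2 * l p"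
proof -
  define cp cm cp' cm' where "cp = wsum P l x" "cm = wsum N m x" "cp' = wsum (P - {p}) l' x" "cm' = wsum N m' x"
  note c_defs = this
  define v where "v = (\<lambda>j. cp j - cm j)"
  define v' where "v' = (\<lambda>j. cp' j - cm' j)"
  define V V' where "V = inner_prod d v v" "V' = inner_prod d v' v'"
  have cw: "convex_weights P l" "convex_weights N m" "convex_weights (P - {p}) l'" "convex_weights N m'"
    using near near' by (auto simp: nearest_weights_def)
  \<comment> \<open>\<open>l0\<close> extends the reduced weights to \<open>P\<close>, so that the
    reduced nearest pair competes with the full one.\<close>
  define l0 where "l0 = (\<lambda>k. if k = p then 0 else l' k)"
  have l0: "convex_weights P l0" "wsum P l0 x = cp'"
  proof -
    have "sum l0 P = sum l' (P - {p})"
      using finP p by (simp add: sum.remove l0_def)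
    then show "convex_weights P l0" using cw(3) by (auto simp: convex_weights_def l0_def)
    show "wsum P l0 x = cp'"
      using finP p by (simp add: wsum_def sum.remove l0_def c_defs)
  qed
  have hull: "\<exists>J k. J \<subseteq> P \<union> N \<and> convex_weights J k \<and> a = wsum J k x"
    if "a \<in> {x p, cp, cp', cm, cm'}" for a
  proof -
    have "x p = wsum {p} (\<lambda>_. 1) x" "convex_weights {p} (\<lambda>_. 1)"
      by (simp_all add: wsum_def convex_weights_def)
    with that cw p show ?thesis
      unfolding c_defs by (auto; blast)
  qed
  \<comment> \<open>All five points lie in hulls of sample points, and the bound on pairwise
    distances carries over to hulls.\<close>
  have R2: "l2_dist d a b \<le> R" if ab: "a \<in> {x p, cp, cp', cm, cm'}" "b \<in> {x p, cp, cp', cm, cm'}" for a b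
  proof -
    from hull[OF ab(1)] obtain J k where a: "J \<subseteq> P \<union> N" "convex_weights J k" "a = wsum J k x" by blast
    from hull[OF ab(2)] obtain J' k' where b: "J' \<subseteq> P \<union> N" "convex_weights J' k'" "b = wsum J' k' x" by blast
    have "l2_dist d (x i) b \<le> R" if "i \<in> J" for i
      unfolding b(3) using that a(1) b(1) by (intro l2_dist_wsum_le[OF b(2)] R) auto
    then have "l2_dist d b a \<le> R"
      unfolding a(3) by (intro l2_dist_wsum_le[OF a(2)]) (simp add: l2_dist_commute)
    then show ?thesis by (simp add: l2_dist_commute)
  qed
  have V: "V = (l2_dist d cp cm)\<^sup>2" "V' = (l2_dist d cp' cm')\<^sup>2"
    unfolding V_V'_def v_def v'_def l2_dist_power2 by simp_all
  have R_pos: "0 < R" using pos R2[of cp cm] by (simp add: c_defs)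
  have VR: "V \<le> R\<^sup>2" "V' \<le> R\<^sup>2" unfolding V by (intro power_mono R2; simp)+
  have V_pos: "0 < V" using pos unfolding V c_defs by simp
  have min: "l2_dist d cp cm \<le> l2_dist d (wsum P k x) cm'" if "convex_weights P k" for k
    using near cw(4) that unfolding nearest_weights_def c_defs by blast
  have min': "l2_dist d cp' cm' \<le> l2_dist d (wsum (P - {p}) k x) cm" if "convex_weights (P - {p}) k" for k
    using near' cw(2) that unfolding nearest_weights_def c_defs by blast
  have VV': "V \<le> V'"
    using min[OF l0(1)] unfolding V l0(2) by (intro power_mono) simp_all
  have A: "V \<le> V' - V'\<^sup>2 / (4 * R\<^sup>2)"
  proof -
    \<comment> \<open>This \<open>t\<close> minimises
      \<open>- t * V' + t\<^sup>2 * R\<^sup>2\<close>; the minimum is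
      \<open>- V'\<^sup>2 / (4 * R\<^sup>2)\<close>.\<close>
    define t where "t = V' / (2 * R\<^sup>2)"
    have t: "0 \<le> t" "t \<le> 1" using VR R_pos VV' V_pos by (auto simp: t_def field_simps)
    let ?u = "\<lambda>j. x p j - cp' j"
    have "convex_weights P (\<lambda>k. l0 k + t * (of_bool (k = p) - l0 k))"
      by (rule convex_weights_mix[OF l0(1) convex_weights_unit[OF finP p] t])
    from min[OF this] have "l2_dist d cp cm \<le> l2_dist d (\<lambda>j. cp' j + t * ?u j) cm'"
      unfolding wsum_mix wsum_unit[OF finP p] l0(2) .
    then have "V \<le> (l2_dist d (\<lambda>j. cp' j + t * ?u j) cm')\<^sup>2"
      unfolding V by (intro power_mono) auto
    also have "\<dots> = inner_prod d (\<lambda>j. v' j + t * ?u j) (\<lambda>j. v' j + t * ?u j)"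
      unfolding l2_dist_power2 v'_def by (simp add: algebra_simps)
    also have "\<dots> = V' + t * (2 * inner_prod d v' ?u) + t\<^sup>2 * (l2_dist d (x p) cp')\<^sup>2"
      unfolding inner_prod_self_add_scale l2_dist_power2 V_V'_def by simp
    also have "\<dots> \<le> V' + t * (- V') + t\<^sup>2 * R\<^sup>2"
    proof (intro add_mono mult_left_mono power_mono R2)
      \<comment> \<open>\<open>V'\<close> is the gap between the levels of \<open>cp'\<close> and
        \<open>cm'\<close>. Not being above the midpoint puts \<open>x p\<close> at least half of
        that gap below \<open>cp'\<close>.\<close>
      have "V' = inner_prod d v' cp' - inner_prod d v' cm'"
        unfolding V_V'_def by (subst (2) v'_def) (simp add: inner_prod_right)
      moreover have "2 * inner_prod d v' (x p) \<le> inner_prod d v' cp' + inner_prod d v' cm'"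
        using wrong unfolding v'_def c_defs .
      ultimately show "2 * inner_prod d v' ?u \<le> - V'"
        by (simp add: inner_prod_right)
    qed (use t in auto)
    also have "\<dots> = V' - V'\<^sup>2 / (4 * R\<^sup>2)"
      using R_pos by (simp add: t_def field_simps power2_eq_square)
    finally show ?thesis .
  qed
  have lp: "0 \<le> l p" using cw(1) p by (auto simp: convex_weights_def)
  have "V \<le> 4 * R\<^sup>2 * l p"
  \<comment> \<open>A weight of at least \<open>1 / 4\<close> satisfies the claim by
    \<open>V \<le> R\<^sup>2\<close>. Below that, \<open>1 - l p\<close> is bounded away from
    \<open>0\<close> and the other weights can be renormalised.\<close>
  proof (cases "1 / 4 \<le> l p")
    case True
    then have "R\<^sup>2 * 1 \<le> R\<^sup>2 * (4 * l p)" by (intro mult_left_mono) auto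
    then show ?thesis using VR by simp
  next
    case False
    \<comment> \<open>Removing \<open>p\<close> and renormalising the other weights adds
      \<open>s\<close> times \<open>cp - x p\<close> to \<open>cp\<close>.\<close>
    define s where "s = l p / (1 - l p)"
    have "l p * (l p * 2) \<le> l p * 1" using lp False by (intro mult_left_mono) auto
    then have s: "0 \<le> s" "s \<le> 2 * l p" using lp False by (auto simp: s_def field_simps)
    have B: "V' \<le> V + s\<^sup>2 * R\<^sup>2"
    proof -
      let ?u = "\<lambda>j. cp j - x p j"
      let ?l = "\<lambda>k. l k / (1 - l p)"
      have sum: "sum l (P - {p}) = 1 - l p"
        using cw(1) finP p by (simp add: convex_weights_def sum_diff1)
      have "convex_weights (P - {p}) ?l"
        using cw(1) False sum by (auto simp: convex_weights_def simp flip: sum_divide_distrib)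
      moreover have "wsum (P - {p}) ?l x = (\<lambda>j. cp j + s * ?u j)"
      proof
        fix j
        have "cp j = l p * x p j + (\<Sum>k\<in>P - {p}. l k * x k j)"
          using finP p by (simp add: c_defs wsum_def sum.remove)
        then have "wsum (P - {p}) ?l x j = (cp j - l p * x p j) / (1 - l p)"
          by (simp add: wsum_def sum_divide_distrib)
        also have "\<dots> = cp j + s * ?u j"
          using False by (simp add: s_def field_simps)
        finally show "wsum (P - {p}) ?l x j = cp j + s * ?u j" .
      qed
      ultimately have "l2_dist d cp' cm' \<le> l2_dist d (\<lambda>j. cp j + s * ?u j) cm"
        using min' by fastforce
      then have "V' \<le> (l2_dist d (\<lambda>j. cp j + s * ?u j) cm)\<^sup>2"
        unfolding V by (intro power_mono) auto
      also have "\<dots> = inner_prod d (\<lambda>j. v j + s * ?u j) (\<lambda>j. v j + s * ?u j)"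
        unfolding l2_dist_power2 v_def by (simp add: algebra_simps)
      also have "\<dots> = V + s * (2 * inner_prod d v ?u) + s\<^sup>2 * (l2_dist d cp (x p))\<^sup>2"
        unfolding inner_prod_self_add_scale l2_dist_power2 V_V'_def by simp
      also have "\<dots> \<le> V + s * 0 + s\<^sup>2 * R\<^sup>2"
      proof (intro add_mono mult_left_mono power_mono R2)
        \<comment> \<open>The linear term has the favourable sign because \<open>cp\<close>
          minimises \<open>inner_prod d v\<close> over the hull; only the term quadratic in
          \<open>s\<close> survives.\<close>
        have "inner_prod d v cp \<le> inner_prod d v (x p)"
          using nearest_weights_first_order[OF near convex_weights_unit[OF finP p]]
          unfolding wsum_unit[OF finP p] v_def c_defs .
        then show "2 * inner_prod d v ?u \<le> 0" by (simp add: inner_prod_right)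
      qed (use s in auto)
      finally show ?thesis by simp
    qed
    \<comment> \<open>Leaving out \<open>p\<close> raises the squared distance by at most
      \<open>s\<^sup>2 * R\<^sup>2\<close>, while putting it back lowers it by at least
      \<open>V'\<^sup>2 / (4 * R\<^sup>2)\<close>.\<close>
    have "V'\<^sup>2 / (4 * R\<^sup>2) \<le> s\<^sup>2 * R\<^sup>2" using A B by simp
    then have "V'\<^sup>2 \<le> (2 * s * R\<^sup>2)\<^sup>2"
      using R_pos by (simp add: field_simps power2_eq_square)
    then have "V' \<le> 2 * s * R\<^sup>2"
      by (rule power2_le_imp_le) (use s in auto)
    also have "\<dots> \<le> 2 * (2 * l p) * R\<^sup>2" using s by (intro mult_right_mono mult_left_mono) auto
    finally show ?thesis using VV' by (simp add: algebra_simps)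
  qed
  then show ?thesis unfolding V c_defs .
qed

section \<open>Hard margin duality\<close>

lemma space_Rvec: "space (Rvec d) = extensional {..<d}"
  by (simp add: Rvec_def space_PiM PiE_def)

lemma linear_classifier_eq_1 [simp]: "linear_classifier d w b x = 1 \<longleftrightarrow> b \<le> inner_prod d w x"
  and linear_classifier_eq_minus_1 [simp]: "linear_classifier d w b x = -1 \<longleftrightarrow> inner_prod d w x < b"
  by (auto simp: linear_classifier_def)

text \<open>The foot of the perpendicular attains the distance, and Cauchy-Schwarz shows that no
  point of the hyperplane is closer.\<close>

lemma l2_setdist_decision_boundary:
  assumes w: "0 < L2_set w {..<d}"
  shows "l2_setdist d x (decision_boundary d w b) = ereal (\<bar>inner_prod d w x - b\<bar> / L2_set w {..<d})"
  unfolding l2_setdist_def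
proof (rule antisym)
  define t where "t = (inner_prod d w x - b) / inner_prod d w w"
  \<comment> \<open>The restriction puts the foot into \<open>space (Rvec d)\<close>, whose elements
    are \<open>undefined\<close> outside \<open>{..<d}\<close>.\<close>
  define x' where "x' = (\<lambda>j\<in>{..<d}. x j - t * w j)"
  have w2: "0 < inner_prod d w w" using w by (simp add: inner_prod_self_eq)
  have "inner_prod d w x' = inner_prod d w (\<lambda>j. x j - t * w j)"
    by (rule inner_prod_cong) (simp_all add: x'_def)
  also have "\<dots> = inner_prod d w x - t * inner_prod d w w" by (simp add: inner_prod_right)
  also have "\<dots> = b" using w2 by (simp add: t_def)
  finally have "x' \<in> decision_boundary d w b"
    by (simp add: decision_boundary_def space_Rvec x'_def)
  moreover have "l2_dist d x x' = \<bar>inner_prod d w x - b\<bar> / L2_set w {..<d}"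
  proof -
    have "l2_dist d x x' = L2_set (\<lambda>j. t * w j) {..<d}"
      unfolding l2_dist_def by (rule L2_set_cong) (simp_all add: x'_def)
    also have "\<dots> = \<bar>t\<bar> * L2_set w {..<d}"
      by (simp add: L2_set_def power_mult_distrib real_sqrt_mult flip: sum_distrib_left)
    also have "\<dots> = \<bar>inner_prod d w x - b\<bar> / L2_set w {..<d}"
      using w by (simp add: t_def abs_divide inner_prod_self_eq power2_eq_square)
    finally show ?thesis .
  qed
  ultimately show "(INF x'\<in>decision_boundary d w b. ereal (l2_dist d x x')) \<le> ereal (\<bar>inner_prod d w x - b\<bar> / L2_set w {..<d})"
    by (intro INF_lower2[of x']) auto
  show "ereal (\<bar>inner_prod d w x - b\<bar> / L2_set w {..<d}) \<le> (INF x'\<in>decision_boundary d w b. ereal (l2_dist d x x'))"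
  proof (rule INF_greatest)
    fix z assume "z \<in> decision_boundary d w b"
    then have "inner_prod d w x - b = inner_prod d w (\<lambda>j. x j - z j)"
      by (simp add: decision_boundary_def inner_prod_right)
    then have "\<bar>inner_prod d w x - b\<bar> \<le> L2_set w {..<d} * l2_dist d x z"
      unfolding l2_dist_def by (simp add: abs_inner_prod_le)
    then show "ereal (\<bar>inner_prod d w x - b\<bar> / L2_set w {..<d}) \<le> ereal (l2_dist d x z)"
      using w by (simp add: field_simps)
  qed
qed

lemma inner_prod_eq_0_if_L2_set_eq_0: "\<not> 0 < L2_set w {..<d} \<Longrightarrow> inner_prod d w x = 0"
  using L2_set_nonneg[of w "{..<d}"] by (simp add: less_le L2_set_eq_0_iff inner_prod_def)

lemma ereal_le_l2_setdist_iff: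
  assumes "0 < L2_set w {..<d}"
  shows "ereal \<gamma> \<le> l2_setdist d x (decision_boundary d w b) \<longleftrightarrow> \<gamma> * L2_set w {..<d} \<le> \<bar>inner_prod d w x - b\<bar>"
  using assms by (simp add: l2_setdist_decision_boundary field_simps)

text \<open>The constraints of the hard margin quadratic program: with the levels scaled to distance
  \<open>1\<close> from \<open>b\<close>, a margin \<open>\<gamma>\<close> turns into a norm of
  \<open>w\<close> of at most \<open>1 / \<gamma>\<close>.\<close>

definition hard_margin_feasible :: "nat \<Rightarrow> ((nat \<Rightarrow> real) \<times> int) set \<Rightarrow> (nat \<Rightarrow> real) \<Rightarrow> real \<Rightarrow> bool" where
  "hard_margin_feasible d Z w b \<longleftrightarrow> (\<forall>(x, y)\<in>Z. 1 \<le> real_of_int y * (inner_prod d w x - b))"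

abbreviation "pos_part Z \<equiv> {z \<in> Z. snd z = (1::int)}"
abbreviation "neg_part Z \<equiv> {z \<in> Z. snd z = (-1::int)}"

definition svm_solution :: "nat \<Rightarrow> ((nat \<Rightarrow> real) \<times> int) set \<Rightarrow> (nat \<Rightarrow> real) \<Rightarrow> real \<Rightarrow> bool" where
  "svm_solution d Z w b \<longleftrightarrow> hard_margin_feasible d Z w b \<and>
     (\<forall>w' b'. hard_margin_feasible d Z w' b' \<longrightarrow> inner_prod d w w \<le> inner_prod d w' w')"

lemma hard_margin_feasible_parts:
  assumes "hard_margin_feasible d Z w b"
  shows "z \<in> pos_part Z \<Longrightarrow> b + 1 \<le> inner_prod d w (fst z)"
    and "z \<in> neg_part Z \<Longrightarrow> inner_prod d w (fst z) \<le> b - 1"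
  using assms by (cases z; force simp: hard_margin_feasible_def)+

lemma hard_margin_feasible_hull:
  assumes "hard_margin_feasible d Z w b" "convex_weights (pos_part Z) l" "convex_weights (neg_part Z) m"
  shows "b + 1 \<le> inner_prod d w (wsum (pos_part Z) l fst)"
    and "inner_prod d w (wsum (neg_part Z) m fst) \<le> b - 1"
   apply (rule inner_prod_wsum_ge[OF assms(2)], erule hard_margin_feasible_parts[OF assms(1)])
  apply (rule inner_prod_wsum_le[OF assms(3)], erule hard_margin_feasible_parts[OF assms(1)])
  done

text \<open>Duality of the quadratic program: the optimal hyperplane perpendicularly bisects the
  segment between the nearest points, and the factor \<open>2 / inner_prod d v v\<close> puts these
  points at the levels \<open>b + 1\<close> and \<open>b - 1\<close>.\<close>

lemma svm_duality:
  assumes fin: "finite Z" and lab: "snd ` Z \<subseteq> {-1, 1}"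
    and near: "nearest_weights d fst (pos_part Z) (neg_part Z) l m"
    and feas: "hard_margin_feasible d Z w0 b0"
    and cp_def: "cp = wsum (pos_part Z) l fst" and cm_def: "cm = wsum (neg_part Z) m fst"
    and v_def: "v = (\<lambda>j. cp j - cm j)"
    and w_def: "w = (\<lambda>j. 2 / inner_prod d v v * v j)"
    and b_def: "b = (inner_prod d v cp + inner_prod d v cm) / inner_prod d v v"
  shows "0 < inner_prod d v v" "svm_solution d Z w b"
    "\<And>w' b'. hard_margin_feasible d Z w' b' \<Longrightarrow> inner_prod d w w \<le> inner_prod d w' w"
    "inner_prod d w cp = b + 1" "inner_prod d w cm = b - 1"
    "inner_prod d w w = 4 / inner_prod d v v"
proof -
  have cw: "convex_weights (pos_part Z) l" "convex_weights (neg_part Z) m"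
    using near by (auto simp: nearest_weights_def)
  \<comment> \<open>Weak duality: feasibility at \<open>cp\<close> and \<open>cm\<close> separates
    their levels by at least \<open>2\<close> for every candidate \<open>w'\<close>; the constructed
    \<open>w\<close> attains equality.\<close>
  have *: "2 \<le> inner_prod d w' v" if "hard_margin_feasible d Z w' b'" for w' b'
    using hard_margin_feasible_hull[OF that cw] by (simp add: v_def inner_prod_right cp_def cm_def)
  have "inner_prod d v v \<noteq> 0"
  proof
    assume "inner_prod d v v = 0"
    then have "inner_prod d w0 v = 0" unfolding inner_prod_self_eq_0 by (simp add: inner_prod_def)
    with *[OF feas] show False by simp
  qed
  then show V: "0 < inner_prod d v v" by (simp add: less_le)
  show ww: "inner_prod d w w = 4 / inner_prod d v v"
    unfolding w_def inner_prod_scale_left inner_prod_scale_right using V by simp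
  show **: "inner_prod d w w \<le> inner_prod d w' w" if "hard_margin_feasible d Z w' b'" for w' b'
    unfolding ww unfolding w_def inner_prod_scale_right using V *[OF that] by (simp add: field_simps)
  have vv: "inner_prod d v v = inner_prod d v cp - inner_prod d v cm"
    unfolding inner_prod_diff_right[symmetric] by (simp add: v_def)
  then have bp: "inner_prod d v cp = ((b + 1) / 2) * inner_prod d v v"
    and bm: "inner_prod d v cm = ((b - 1) / 2) * inner_prod d v v"
  proof -
    have "b * inner_prod d v v = inner_prod d v cp + inner_prod d v cm" using V by (simp add: b_def)
    with vv show "inner_prod d v cp = ((b + 1) / 2) * inner_prod d v v" "inner_prod d v cm = ((b - 1) / 2) * inner_prod d v v"
      by (simp_all add: algebra_simps)
  qed
  then show wb: "inner_prod d w cp = b + 1" "inner_prod d w cm = b - 1"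
    using V unfolding w_def inner_prod_scale_left by (simp_all add: field_simps)
  \<comment> \<open>First-order optimality on both sides places the positive points beyond
    \<open>cp\<close> and the negative points beyond \<open>cm\<close>; after scaling this is
    feasibility.\<close>
  have "inner_prod d v cp \<le> inner_prod d v (fst z)" if "z \<in> pos_part Z" for z
    using nearest_weights_first_order[OF near convex_weights_unit[OF _ that]] fin that
    unfolding v_def cp_def cm_def by (simp add: wsum_unit del: mem_Collect_eq)
  moreover have "inner_prod d (\<lambda>j. cm j - cp j) cm \<le> inner_prod d (\<lambda>j. cm j - cp j) (fst z)" if "z \<in> neg_part Z" for z
    using nearest_weights_first_order[OF nearest_weights_commute[OF near] convex_weights_unit[OF _ that]] fin that
    unfolding v_def cp_def cm_def by (simp add: wsum_unit del: mem_Collect_eq)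
  moreover have "inner_prod d (\<lambda>j. cm j - cp j) c = - inner_prod d v c" for c
    by (simp add: v_def inner_prod_left)
  ultimately have dir: "\<And>z. z \<in> pos_part Z \<Longrightarrow> inner_prod d v cp \<le> inner_prod d v (fst z)"
    "\<And>z. z \<in> neg_part Z \<Longrightarrow> inner_prod d v (fst z) \<le> inner_prod d v cm"
    by auto
  have sides: "\<And>z. z \<in> pos_part Z \<Longrightarrow> inner_prod d w cp \<le> inner_prod d w (fst z)"
    "\<And>z. z \<in> neg_part Z \<Longrightarrow> inner_prod d w (fst z) \<le> inner_prod d w cm"
    unfolding w_def inner_prod_scale_left using V by (intro mult_left_mono dir; simp)+
  have "hard_margin_feasible d Z w b"
    unfolding hard_margin_feasible_def
  proof clarify
    fix x y assume z: "(x, y) \<in> Z"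
    then have "y = 1 \<or> y = -1" using lab by force
    then show "1 \<le> real_of_int y * (inner_prod d w x - b)"
    proof
      assume "y = 1"
      then show ?thesis using sides(1)[of "(x, y)"] z wb by simp
    next
      assume "y = -1"
      then show ?thesis using sides(2)[of "(x, y)"] z wb by simp
    qed
  qed
  moreover have "inner_prod d w w \<le> inner_prod d w' w'" if "hard_margin_feasible d Z w' b'" for w' b'
  proof -
    have "0 \<le> inner_prod d (\<lambda>j. w' j - w j) (\<lambda>j. w' j - w j)" by simp
    then show ?thesis
      using **[OF that] unfolding inner_prod_left inner_prod_right by (simp add: inner_prod_commute[of d w w'])
  qed
  ultimately show "svm_solution d Z w b" by (auto simp: svm_solution_def)
qed

text \<open>Besides existence this records stability: an almost optimal feasible \<open>w'\<close>
  is close to \<open>w\<close>, and then \<open>b'\<close> is close to \<open>b\<close>. Exact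
  optima give uniqueness, approximate ones the limit argument behind measurability.\<close>

lemma svm_solution_exists_unique:
  assumes fin: "finite Z" and lab: "snd ` Z \<subseteq> {-1, 1}"
    and ne: "pos_part Z \<noteq> {}" "neg_part Z \<noteq> {}"
    and feas: "hard_margin_feasible d Z w0 b0"
  obtains w b C where "svm_solution d Z w b" "0 < inner_prod d w w"
    "\<And>w' b'. hard_margin_feasible d Z w' b' \<Longrightarrow>
       inner_prod d (\<lambda>j. w' j - w j) (\<lambda>j. w' j - w j) \<le> inner_prod d w' w' - inner_prod d w w"
    "\<And>w' b'. hard_margin_feasible d Z w' b' \<Longrightarrow> \<bar>b' - b\<bar> \<le> C * L2_set (\<lambda>j. w' j - w j) {..<d}"
proof -
  obtain l m where near: "nearest_weights d fst (pos_part Z) (neg_part Z) l m"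
    using nearest_weights_exist[of "pos_part Z" "neg_part Z" d fst] fin ne by auto
  then have cw: "convex_weights (pos_part Z) l" "convex_weights (neg_part Z) m"
    by (auto simp: nearest_weights_def)
  define cp cm where "cp = wsum (pos_part Z) l fst" "cm = wsum (neg_part Z) m fst"
  note c_defs = this
  define v where "v = (\<lambda>j. cp j - cm j)"
  define w where "w = (\<lambda>j. 2 / inner_prod d v v * v j)"
  define b where "b = (inner_prod d v cp + inner_prod d v cm) / inner_prod d v v"
  note dual = svm_duality[OF fin lab near feas c_defs v_def w_def b_def]
  define C where "C = max (L2_set cp {..<d}) (L2_set cm {..<d})"
  show ?thesis
  proof (rule that[of w b C])
    show "svm_solution d Z w b" by (rule dual(2))
    show "0 < inner_prod d w w" using dual(1) dual(6) by simp
  next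
    fix w' b' assume f: "hard_margin_feasible d Z w' b'"
    show "inner_prod d (\<lambda>j. w' j - w j) (\<lambda>j. w' j - w j) \<le> inner_prod d w' w' - inner_prod d w w"
      using dual(3)[OF f] unfolding inner_prod_left inner_prod_right by (simp add: inner_prod_commute[of d w w'])
    let ?u = "\<lambda>j. w' j - w j"
    \<comment> \<open>The constraints at \<open>cm\<close> and \<open>cp\<close> are tight for
      \<open>(w, b)\<close>, so subtracting them from those for \<open>(w', b')\<close> traps
      \<open>b' - b\<close> between two inner products with \<open>w' - w\<close>.\<close>
    have "inner_prod d ?u cm \<le> b' - b" "b' - b \<le> inner_prod d ?u cp"
      using hard_margin_feasible_hull[OF f cw] dual(4,5) by (simp_all add: inner_prod_left c_defs)
    moreover have "\<bar>inner_prod d ?u c\<bar> \<le> C * L2_set ?u {..<d}" if "c \<in> {cp, cm}" for c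
    proof -
      have "\<bar>inner_prod d ?u c\<bar> \<le> L2_set ?u {..<d} * L2_set c {..<d}" by (rule abs_inner_prod_le)
      also have "\<dots> \<le> L2_set ?u {..<d} * C" using that by (intro mult_left_mono) (auto simp: C_def)
      finally show ?thesis by (simp add: mult.commute)
    qed
    from this[of cp] this[of cm] have "\<bar>inner_prod d ?u cp\<bar> \<le> C * L2_set ?u {..<d}" "\<bar>inner_prod d ?u cm\<bar> \<le> C * L2_set ?u {..<d}"
      by auto
    ultimately show "\<bar>b' - b\<bar> \<le> C * L2_set ?u {..<d}"
      by linarith
  qed
qed

lemma svm_solution_unique:
  assumes "finite Z" "snd ` Z \<subseteq> {-1, 1}" "pos_part Z \<noteq> {}" "neg_part Z \<noteq> {}"
    and sol: "svm_solution d Z w b" and feas: "hard_margin_feasible d Z w' b'"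
    and le: "inner_prod d w' w' \<le> inner_prod d w w"
  shows "(\<forall>j<d. w' j = w j) \<and> b' = b"
proof -
  have f: "hard_margin_feasible d Z w b" using sol by (simp add: svm_solution_def)
  obtain w0 b0 C where w0: "svm_solution d Z w0 b0" and "0 < inner_prod d w0 w0"
    and 1: "\<And>w' b'. hard_margin_feasible d Z w' b' \<Longrightarrow>
       inner_prod d (\<lambda>j. w' j - w0 j) (\<lambda>j. w' j - w0 j) \<le> inner_prod d w' w' - inner_prod d w0 w0"
    and 2: "\<And>w' b'. hard_margin_feasible d Z w' b' \<Longrightarrow> \<bar>b' - b0\<bar> \<le> C * L2_set (\<lambda>j. w' j - w0 j) {..<d}"
    by (rule svm_solution_exists_unique[OF assms(1-4) f]) (rule that)
  have *: "(\<forall>j<d. w' j = w0 j) \<and> b' = b0" if "hard_margin_feasible d Z w' b'" "inner_prod d w' w' \<le> inner_prod d w0 w0" for w' b'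
  proof -
    have "inner_prod d (\<lambda>j. w' j - w0 j) (\<lambda>j. w' j - w0 j) = 0"
      using 1[OF that(1)] that(2) inner_prod_self_nonneg[of d "\<lambda>j. w' j - w0 j"] by linarith
    moreover from this have "\<forall>j<d. w' j = w0 j" unfolding inner_prod_self_eq_0 by simp
    ultimately show ?thesis using 2[OF that(1)] by (simp add: L2_set_eq_sqrt_inner_prod)
  qed
  have "inner_prod d w w = inner_prod d w0 w0"
    using w0 sol f by (intro antisym) (auto simp: svm_solution_def)
  with *[OF f] *[OF feas] le show ?thesis by simp
qed

section \<open>From the quadratic program to \<open>max_margin\<close>\<close>

lemma linear_classifier_scale:
  assumes "0 < c" "\<And>j. j < d \<Longrightarrow> w' j = c * w j" "b' = c * b"
  shows "linear_classifier d w' b' = linear_classifier d w b"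
proof
  fix x
  have "inner_prod d w' x = c * inner_prod d w x"
    unfolding inner_prod_scale_left[symmetric] using assms by (intro inner_prod_cong) auto
  then show "linear_classifier d w' b' x = linear_classifier d w b x"
    using assms by (simp add: linear_classifier_def)
qed

lemma ereal_le_sample_margin_iff:
  assumes "0 < L2_set w {..<d}"
  shows "ereal \<gamma> \<le> sample_margin d S w b \<longleftrightarrow> (\<forall>(x, y)\<in>set S. \<gamma> * L2_set w {..<d} \<le> \<bar>inner_prod d w x - b\<bar>)"
  unfolding sample_margin_def le_INF_iff case_prod_unfold ereal_le_l2_setdist_iff[OF assms] ..

lemma separates_sample_L2_pos:
  assumes "separates_sample d S w b" "pos_part (set S) \<noteq> {}" "neg_part (set S) \<noteq> {}"
  shows "0 < L2_set w {..<d}"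
proof (rule ccontr)
  assume "\<not> ?thesis"
  then have "inner_prod d w x = 0" for x by (rule inner_prod_eq_0_if_L2_set_eq_0)
  moreover obtain x x' where "(x, 1) \<in> set S" "(x', -1) \<in> set S" using assms by force
  then have "linear_classifier d w b x = 1" "linear_classifier d w b x' = -1"
    using assms(1) by (auto simp: separates_sample_def)
  ultimately show False by simp
qed

lemma hard_margin_feasible_if_margin:
  assumes sep: "separates_sample d S w b" and w: "0 < L2_set w {..<d}" and \<gamma>: "0 < \<gamma>"
    and le: "ereal \<gamma> \<le> sample_margin d S w b" and lab: "snd ` set S \<subseteq> {-1, 1}"
  shows "hard_margin_feasible d (set S) (\<lambda>j. 1 / (\<gamma> * L2_set w {..<d}) * w j) (1 / (\<gamma> * L2_set w {..<d}) * b)"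
  unfolding hard_margin_feasible_def
proof clarify
  fix x y assume z: "(x, y) \<in> set S"
  then have "y = 1 \<or> y = -1" using lab by force
  moreover have "linear_classifier d w b x = y" using sep z by (auto simp: separates_sample_def)
  moreover have "\<gamma> * L2_set w {..<d} \<le> \<bar>inner_prod d w x - b\<bar>"
    using le z by (auto simp: ereal_le_sample_margin_iff[OF w])
  ultimately have "\<gamma> * L2_set w {..<d} \<le> real_of_int y * (inner_prod d w x - b)"
    by (auto simp: linear_classifier_def split: if_splits)
  moreover have "0 < \<gamma> * L2_set w {..<d}" using w \<gamma> by simp
  ultimately have "1 \<le> 1 / (\<gamma> * L2_set w {..<d}) * (real_of_int y * (inner_prod d w x - b))"
    by (simp add: field_simps)
  also have "\<dots> = real_of_int y * (inner_prod d (\<lambda>j. 1 / (\<gamma> * L2_set w {..<d}) * w j) x - 1 / (\<gamma> * L2_set w {..<d}) * b)"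
    by (simp only: inner_prod_scale_left) (simp only: algebra_simps)
  finally show "1 \<le> \<dots>" .
qed

lemma margin_if_hard_margin_feasible:
  assumes f: "hard_margin_feasible d (set S) w b" and lab: "snd ` set S \<subseteq> {-1, 1}"
  shows "separates_sample d S w b"
    and "0 < L2_set w {..<d} \<Longrightarrow> ereal (1 / L2_set w {..<d}) \<le> sample_margin d S w b"
proof -
  have *: "1 \<le> real_of_int y * (inner_prod d w x - b)" "y = 1 \<or> y = -1" if "(x, y) \<in> set S" for x y
    using f lab that by (force simp: hard_margin_feasible_def)+
  show "separates_sample d S w b"
    unfolding separates_sample_def
  proof clarify
    fix x y assume "(x, y) \<in> set S"
    from *[OF this] show "linear_classifier d w b x = y" by auto
  qed
  assume w: "0 < L2_set w {..<d}"
  have "1 \<le> \<bar>inner_prod d w x - b\<bar>" if "(x, y) \<in> set S" for x y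
    using *[OF that] by auto
  then show "ereal (1 / L2_set w {..<d}) \<le> sample_margin d S w b"
    using w by (auto simp: ereal_le_sample_margin_iff[OF w])
qed

text \<open>Rescaling turns a separator of margin \<open>\<gamma>\<close> into a feasible pair of
  norm \<open>1 / \<gamma>\<close> and back, so maximising the margin is minimising the norm. The
  last conclusion makes the choice by \<open>SOME\<close> harmless.\<close>

lemma is_max_margin_if_svm_solution:
  assumes lab: "snd ` set S \<subseteq> {-1, 1}" and ne: "pos_part (set S) \<noteq> {}" "neg_part (set S) \<noteq> {}"
    and sol: "svm_solution d (set S) w b"
  shows "0 < L2_set w {..<d}" "is_max_margin d S w b"
    "\<And>w' b'. separates_sample d S w' b' \<Longrightarrow> sample_margin d S w' b' \<le> ereal (1 / L2_set w {..<d})"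
    "ereal (1 / L2_set w {..<d}) \<le> sample_margin d S w b"
    "\<And>w' b'. is_max_margin d S w' b' \<Longrightarrow> linear_classifier d w' b' = linear_classifier d w b"
proof -
  have f: "hard_margin_feasible d (set S) w b" using sol by (simp add: svm_solution_def)
  note sep = margin_if_hard_margin_feasible(1)[OF f lab]
  show w: "0 < L2_set w {..<d}" by (rule separates_sample_L2_pos[OF sep ne])
  note mar = margin_if_hard_margin_feasible(2)[OF f lab w]
  show "ereal (1 / L2_set w {..<d}) \<le> sample_margin d S w b" by (rule mar)
  have norm: "inner_prod d (\<lambda>j. 1 / (\<gamma> * L2_set w' {..<d}) * w' j) (\<lambda>j. 1 / (\<gamma> * L2_set w' {..<d}) * w' j) = (1 / \<gamma>)\<^sup>2"
    if "0 < L2_set w' {..<d}" for \<gamma> w'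
    unfolding inner_prod_scale_left inner_prod_scale_right using that
    by (simp add: inner_prod_self_eq field_simps power2_eq_square)
  show le: "sample_margin d S w' b' \<le> ereal (1 / L2_set w {..<d})" if s: "separates_sample d S w' b'" for w' b'
  proof (rule ccontr)
    assume "\<not> ?thesis"
    \<comment> \<open>\<open>sample_margin\<close> is an \<open>ereal\<close>; the rescaling needs a
      real number, chosen strictly in between.\<close>
    then obtain \<gamma> where \<gamma>: "ereal (1 / L2_set w {..<d}) < ereal \<gamma>" "ereal \<gamma> < sample_margin d S w' b'"
      using ereal_dense2 by (metis not_le)
    then have \<gamma>': "1 / L2_set w {..<d} < \<gamma>" by simp
    then have "0 < \<gamma>" using w by (meson divide_pos_pos less_trans zero_less_one)
    have w': "0 < L2_set w' {..<d}" by (rule separates_sample_L2_pos[OF s ne])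
    have "inner_prod d w w \<le> (1 / \<gamma>)\<^sup>2"
      using hard_margin_feasible_if_margin[OF s w' \<open>0 < \<gamma>\<close> less_imp_le[OF \<gamma>(2)] lab] sol
      unfolding svm_solution_def norm[OF w', symmetric] by blast
    then have "L2_set w {..<d} \<le> 1 / \<gamma>"
      using \<open>0 < \<gamma>\<close> by (simp add: inner_prod_self_eq power2_le_iff_abs_le)
    then show False using \<gamma>' \<open>0 < \<gamma>\<close> w by (simp add: field_simps)
  qed
  show "is_max_margin d S w b"
    unfolding is_max_margin_def using sep le mar by (blast intro: order_trans)
  show "linear_classifier d w' b' = linear_classifier d w b" if m: "is_max_margin d S w' b'" for w' b'
  proof -
    have s: "separates_sample d S w' b'" using m by (simp add: is_max_margin_def)
    have w': "0 < L2_set w' {..<d}" by (rule separates_sample_L2_pos[OF s ne])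
    define \<gamma> where "\<gamma> = 1 / L2_set w {..<d}"
    have \<gamma>: "0 < \<gamma>" using w by (simp add: \<gamma>_def)
    have "ereal \<gamma> \<le> sample_margin d S w' b'"
      using m sep mar unfolding is_max_margin_def \<gamma>_def by (blast intro: order_trans)
    note f' = hard_margin_feasible_if_margin[OF s w' \<gamma> this lab]
    have "inner_prod d (\<lambda>j. 1 / (\<gamma> * L2_set w' {..<d}) * w' j) (\<lambda>j. 1 / (\<gamma> * L2_set w' {..<d}) * w' j) \<le> inner_prod d w w"
      unfolding norm[OF w'] by (simp add: \<gamma>_def inner_prod_self_eq)
    from svm_solution_unique[OF finite_set lab ne sol f' this]
    show ?thesis using \<gamma> w' by (intro linear_classifier_scale[symmetric, of "1 / (\<gamma> * L2_set w' {..<d})"]) auto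
  qed
qed

lemma max_margin_eq_svm_solution:
  assumes "snd ` set S \<subseteq> {-1, 1}" "pos_part (set S) \<noteq> {}" "neg_part (set S) \<noteq> {}"
    and "svm_solution d (set S) w b"
  shows "max_margin d S = linear_classifier d w b"
proof -
  note * = is_max_margin_if_svm_solution[OF assms]
  obtain w' b' where wb: "(SOME (w, b). is_max_margin d S w b) = (w', b')" by (cases "SOME (w, b). is_max_margin d S w b")
  have "case (SOME (w, b). is_max_margin d S w b) of (w, b) \<Rightarrow> is_max_margin d S w b"
    by (rule someI[of _ "(w, b)"]) (use *(2) in simp)
  then have "is_max_margin d S w' b'" by (simp add: wb)
  from *(5)[OF this] show ?thesis by (simp add: max_margin_def wb)
qed

text \<open>With a single label, the empty decision boundary of a constant classifier has infinite margin,
  so every maximizer has an empty decision boundary as well.\<close>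

lemma max_margin_single_label:
  assumes "S \<noteq> []" "snd ` set S \<subseteq> {y}" "y = 1 \<or> y = -1"
  shows "max_margin d S x = y"
proof -
  let ?b = "- real_of_int y"
  have "separates_sample d S (\<lambda>_. 0) ?b"
    using assms(2,3) by (auto simp: separates_sample_def linear_classifier_def inner_prod_def)
  moreover have "decision_boundary d (\<lambda>_. 0) ?b = {}"
    using assms(3) by (auto simp: decision_boundary_def inner_prod_def)
  then have inf: "sample_margin d S (\<lambda>_. 0) ?b = \<infinity>"
    by (simp add: sample_margin_def l2_setdist_def flip: top_ereal_def)
  ultimately have ex: "is_max_margin d S (\<lambda>_. 0) ?b"
    by (simp add: is_max_margin_def)
  obtain w' b' where wb: "(SOME (w, b). is_max_margin d S w b) = (w', b')" by (cases "SOME (w, b). is_max_margin d S w b")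
  have "case (SOME (w, b). is_max_margin d S w b) of (w, b) \<Rightarrow> is_max_margin d S w b"
    by (rule someI[of _ "(\<lambda>_. 0, ?b)"]) (use ex in simp)
  then have m: "is_max_margin d S w' b'" by (simp add: wb)
  obtain x0 where x0: "(x0, y) \<in> set S" using assms(1,2) by (cases S) fastforce+
  have "\<infinity> \<le> sample_margin d S w' b'"
    using m ex inf unfolding is_max_margin_def by metis
  then have "l2_setdist d x0 (decision_boundary d w' b') = \<infinity>"
    using x0 unfolding sample_margin_def le_INF_iff by force
  then have "\<not> 0 < L2_set w' {..<d}" by (auto simp: l2_setdist_decision_boundary)
  then have "linear_classifier d w' b' x = linear_classifier d w' b' x0"
    by (simp add: linear_classifier_def inner_prod_eq_0_if_L2_set_eq_0)
  also have "\<dots> = y" using m x0 by (auto simp: is_max_margin_def separates_sample_def)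
  finally show ?thesis by (simp add: max_margin_def wb)
qed

section \<open>Leave-one-out mistakes\<close>

lemma hard_margin_feasible_mono: "hard_margin_feasible d Z w b \<Longrightarrow> Z' \<subseteq> Z \<Longrightarrow> hard_margin_feasible d Z' w b"
  by (auto simp: hard_margin_feasible_def)

lemma svm_solution_exists:
  assumes "finite Z" "snd ` Z \<subseteq> {-1, 1}" "pos_part Z \<noteq> {}" "neg_part Z \<noteq> {}" "hard_margin_feasible d Z w0 b0"
  shows "\<exists>w b. svm_solution d Z w b"
  by (rule svm_solution_exists_unique[OF assms]) blast

lemma single_label_if_part_empty:
  assumes "snd ` Z \<subseteq> {-1, 1}" "pos_part Z = {} \<or> neg_part Z = {}" "z \<in> Z"
  shows "snd ` Z \<subseteq> {snd z}"
proof -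
  have "snd z' = snd z" if z': "z' \<in> Z" for z'
  proof -
    have "snd z' = 1 \<or> snd z' = -1" "snd z = 1 \<or> snd z = -1" using assms(1,3) z' by blast+
    moreover have "\<not> (snd z = 1 \<and> snd z' = -1)" "\<not> (snd z = -1 \<and> snd z' = 1)"
      using assms(2,3) z' by blast+
    ultimately show ?thesis by auto
  qed
  then show ?thesis by blast
qed

text \<open>Consistency with the data is what rules out mistakes on points that occur again in the
  remaining sample.\<close>

lemma max_margin_separable:
  assumes lab: "snd ` set S \<subseteq> {-1, 1}" and f: "hard_margin_feasible d (set S) w0 b0"
  shows "(x, y) \<in> set S \<Longrightarrow> max_margin d S x = y"
    and "pos_part (set S) \<noteq> {} \<Longrightarrow> neg_part (set S) \<noteq> {} \<Longrightarrow> svm_solution d (set S) w b \<Longrightarrow>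
      max_margin d S = linear_classifier d w b"
proof -
  show sol: "max_margin d S = linear_classifier d w b"
    if "pos_part (set S) \<noteq> {}" "neg_part (set S) \<noteq> {}" "svm_solution d (set S) w b" for w b
    by (rule max_margin_eq_svm_solution[OF lab that])
  assume z: "(x, y) \<in> set S"
  then have "snd (x, y) \<in> {-1, 1}" using lab by blast
  then have y: "y = 1 \<or> y = -1" by auto
  show "max_margin d S x = y"
  proof (cases "pos_part (set S) = {} \<or> neg_part (set S) = {}")
    case True
    have "snd ` set S \<subseteq> {y}"
      by (rule single_label_if_part_empty[OF lab True z, unfolded snd_conv])
    moreover have "S \<noteq> []" using z by auto
    ultimately show ?thesis using y by (intro max_margin_single_label)
  next
    case False
    then obtain w b where wb: "svm_solution d (set S) w b"
      using svm_solution_exists[OF finite_set lab _ _ f] by blast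
    then have "separates_sample d S w b"
      using margin_if_hard_margin_feasible(1) lab by (auto simp: svm_solution_def)
    then show ?thesis using sol[OF _ _ wb] False z by (auto simp: separates_sample_def)
  qed
qed

text \<open>Applies the weight bound to the class of \<open>p\<close>; for a negative
  \<open>p\<close> the two hulls exchange their roles, which negates the normal vector.\<close>

lemma misclassified_weight:
  assumes fin: "finite Z" and lab: "snd ` Z \<subseteq> {-1, 1}"
    and near: "nearest_weights d fst (pos_part Z) (neg_part Z) l m"
    and feas: "hard_margin_feasible d Z w0 b0"
    and R: "\<And>z z'. z \<in> Z \<Longrightarrow> z' \<in> Z \<Longrightarrow> l2_dist d (fst z) (fst z') \<le> R"
    and ne: "pos_part Z \<noteq> {}" "neg_part Z \<noteq> {}"
    and p: "p \<in> Z" and S: "set S = Z - {p}" and wrong: "max_margin d S (fst p) \<noteq> snd p"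
  shows "(l2_dist d (wsum (pos_part Z) l fst) (wsum (neg_part Z) m fst))\<^sup>2 \<le> 4 * R\<^sup>2 * (if snd p = 1 then l p else m p)"
    (is "?V \<le> _")
proof -
  let ?P = "pos_part Z" and ?N = "neg_part Z" and ?Z = "Z - {p}"
  have cw: "convex_weights ?P l" "convex_weights ?N m" using near by (auto simp: nearest_weights_def)
  have V: "?V = inner_prod d (\<lambda>j. wsum ?P l fst j - wsum ?N m fst j) (\<lambda>j. wsum ?P l fst j - wsum ?N m fst j)"
    by (rule l2_dist_power2)
  have V_pos: "0 < ?V"
    unfolding V by (rule svm_duality(1)[OF fin lab near feas refl refl refl refl refl])
  have "l2_dist d (wsum ?P l fst) (wsum ?N m fst) \<le> R"
    by (rule l2_dist_wsum_le[OF cw(2)], subst l2_dist_commute, rule l2_dist_wsum_le[OF cw(1)]) (auto intro: R)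
  then have VR: "?V \<le> R\<^sup>2" by (simp add: power_mono)
  then have VR': "?V \<le> 4 * R\<^sup>2" using zero_le_power2[of R] by linarith
  have fin': "finite ?P" "finite ?N" "finite ?Z" using fin by auto
  have lab': "snd ` ?Z \<subseteq> {-1, 1}" using lab by auto
  have feas': "hard_margin_feasible d ?Z w0 b0" using feas by (rule hard_margin_feasible_mono) auto
  have R': "l2_dist d (fst i) (fst k) \<le> R" if "i \<in> ?P \<union> ?N" "k \<in> ?P \<union> ?N" for i k
    by (rule R) (use that in auto)
  have pos: "0 < l2_dist d (wsum ?P l fst) (wsum ?N m fst)"
    using V_pos l2_dist_nonneg[of d "wsum ?P l fst" "wsum ?N m fst"] by (auto simp: less_le)
  have loo: "max_margin d S = linear_classifier d w' b'"
    if "pos_part ?Z \<noteq> {}" "neg_part ?Z \<noteq> {}" "svm_solution d ?Z w' b'" for w' b'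
    using max_margin_separable(2)[of S d] lab' feas' that unfolding S by blast
  from p lab have "snd p = 1 \<or> snd p = -1" by auto
  then show ?thesis
  proof
    assume y: "snd p = 1"
    then have parts: "pos_part ?Z = ?P - {p}" "neg_part ?Z = ?N" by auto
    show ?thesis
    \<comment> \<open>If \<open>p\<close> is alone in its class there is no reduced nearest pair,
      but then its weight is \<open>1\<close> and \<open>?V \<le> 4 * R\<^sup>2\<close>
      suffices.\<close>
    proof (cases "?P - {p} = {}")
      case True
      then have "?P = {p}" using y p by blast
      then have "l p = 1" using cw(1) by (simp add: convex_weights_def)
      then show ?thesis using VR' y by simp
    next
      case False
      obtain l' m' where near': "nearest_weights d fst (?P - {p}) ?N l' m'"
        by (rule nearest_weights_exist[of "?P - {p}" ?N d fst]) (use fin' False ne in \<open>blast+\<close>)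
      define v' where "v' = (\<lambda>j. wsum (?P - {p}) l' fst j - wsum ?N m' fst j)"
      note dual = svm_duality[OF fin'(3) lab' near'[folded parts] feas' refl refl v'_def[folded parts] refl refl,
        unfolded parts]
      have "inner_prod d (\<lambda>j. 2 / inner_prod d v' v' * v' j) (fst p) <
          (inner_prod d v' (wsum (?P - {p}) l' fst) + inner_prod d v' (wsum ?N m' fst)) / inner_prod d v' v'"
        using wrong y unfolding loo[unfolded parts, OF False ne(2) dual(2)]
        by (simp add: linear_classifier_def split: if_splits)
      then have "2 * inner_prod d v' (fst p) \<le>
          inner_prod d v' (wsum (?P - {p}) l' fst) + inner_prod d v' (wsum ?N m' fst)"
        using dual(1) unfolding inner_prod_scale_left by (simp add: field_simps)
      then have "?V \<le> 4 * R\<^sup>2 * l p"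
        using p y unfolding v'_def
        by (intro leave_one_out_weight[OF near fin'(1) _ near' R' _ pos]) auto
      then show ?thesis using y by simp
    qed
  next
    assume y: "snd p = -1"
    then have parts: "pos_part ?Z = ?P" "neg_part ?Z = ?N - {p}" by auto
    show ?thesis
    proof (cases "?N - {p} = {}")
      case True
      then have "?N = {p}" using y p by blast
      then have "m p = 1" using cw(2) by (simp add: convex_weights_def)
      then show ?thesis using VR' y by simp
    next
      case False
      obtain l' m' where near': "nearest_weights d fst ?P (?N - {p}) l' m'"
        by (rule nearest_weights_exist[of ?P "?N - {p}" d fst]) (use fin' False ne in \<open>blast+\<close>)
      define v' where "v' = (\<lambda>j. wsum ?P l' fst j - wsum (?N - {p}) m' fst j)"
      note dual = svm_duality[OF fin'(3) lab' near'[folded parts] feas' refl refl v'_def[folded parts] refl refl,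
        unfolded parts]
      have neg: "inner_prod d (\<lambda>j. wsum (?N - {p}) m' fst j - wsum ?P l' fst j) c = - inner_prod d v' c" for c
        by (simp add: v'_def inner_prod_left)
      \<comment> \<open>Boundary points are labelled \<open>1\<close>, so a mistake on a negative
        point gives only a non-strict inequality; the weight bound allows for it.\<close>
      have "(inner_prod d v' (wsum ?P l' fst) + inner_prod d v' (wsum (?N - {p}) m' fst)) / inner_prod d v' v'
          \<le> inner_prod d (\<lambda>j. 2 / inner_prod d v' v' * v' j) (fst p)"
        using wrong y unfolding loo[unfolded parts, OF ne(1) False dual(2)]
        by (simp add: linear_classifier_def split: if_splits)
      then have "inner_prod d v' (wsum ?P l' fst) + inner_prod d v' (wsum (?N - {p}) m' fst) \<le> 2 * inner_prod d v' (fst p)"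
        using dual(1) unfolding inner_prod_scale_left unfolding times_divide_eq_left divide_le_cancel by simp
      then have "(l2_dist d (wsum ?N m fst) (wsum ?P l fst))\<^sup>2 \<le> 4 * R\<^sup>2 * m p"
      proof (intro leave_one_out_weight[OF nearest_weights_commute[OF near] fin'(2) _ nearest_weights_commute[OF near']])
        show "l2_dist d (fst i) (fst k) \<le> R" if "i \<in> ?N \<union> ?P" "k \<in> ?N \<union> ?P" for i k
          by (rule R') (use that in auto)
        show "0 < l2_dist d (wsum ?N m fst) (wsum ?P l fst)"
          using pos by (subst l2_dist_commute)
      qed (use p y neg in simp_all)
      then show ?thesis using y by (subst l2_dist_commute) simp
    qed
  qed
qed

lemma leave_one_out_mistakes_set:
  assumes fin: "finite Z" and lab: "snd ` Z \<subseteq> {-1, 1}"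
    and feas: "hard_margin_feasible d Z w0 b0" and \<gamma>: "0 < \<gamma>" "\<gamma> * L2_set w0 {..<d} \<le> 1"
    and R: "\<And>z z'. z \<in> Z \<Longrightarrow> z' \<in> Z \<Longrightarrow> l2_dist d (fst z) (fst z') \<le> R"
    and S: "\<And>p. p \<in> E \<Longrightarrow> set (S p) = Z - {p}" "\<And>p. p \<in> E \<Longrightarrow> S p \<noteq> []"
    and E: "E \<subseteq> Z" "\<And>p. p \<in> E \<Longrightarrow> max_margin d (S p) (fst p) \<noteq> snd p"
  shows "real (card E) * \<gamma>\<^sup>2 \<le> 2 * R\<^sup>2"
proof (cases "pos_part Z = {} \<or> neg_part Z = {}")
  case True
  have "E = {}"
  proof (rule ccontr)
    assume "E \<noteq> {}"
    then obtain p where p: "p \<in> E" by auto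
    then have y: "snd p = 1 \<or> snd p = -1" "p \<in> Z" using lab E by auto
    have "snd ` Z \<subseteq> {snd p}" by (rule single_label_if_part_empty[OF lab True y(2)])
    then have "snd ` set (S p) \<subseteq> {snd p}" using S(1)[OF p] by auto
    then have "max_margin d (S p) (fst p) = snd p"
      by (intro max_margin_single_label S(2)[OF p] y)
    then show False using E(2)[OF p] by simp
  qed
  then show ?thesis by simp
next
  case False
  let ?P = "pos_part Z" and ?N = "neg_part Z"
  have "finite ?P" "finite ?N" "?P \<noteq> {}" "?N \<noteq> {}" using fin False by auto
  then obtain l m where near: "nearest_weights d fst ?P ?N l m"
    by (rule nearest_weights_exist)
  then have cw: "convex_weights ?P l" "convex_weights ?N m" by (auto simp: nearest_weights_def)
  define v where "v = (\<lambda>j. wsum ?P l fst j - wsum ?N m fst j)"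
  define V where "V = inner_prod d v v"
  note dual = svm_duality[OF fin lab near feas refl refl refl refl refl, folded v_def]
  \<comment> \<open>The optimal squared norm is \<open>4 / V\<close>, and \<open>w0\<close> has norm
    at most \<open>1 / \<gamma>\<close>. Hence the hulls are at least \<open>2 * \<gamma>\<close>
    apart, one \<open>\<gamma>\<close> for each side of the hyperplane.\<close>
  have "4 / V \<le> inner_prod d w0 w0"
    using dual(2) feas dual(6) unfolding svm_solution_def V_def by metis
  moreover have "\<gamma>\<^sup>2 * inner_prod d w0 w0 \<le> 1"
  proof -
    have "(\<gamma> * L2_set w0 {..<d})\<^sup>2 \<le> 1\<^sup>2" using \<gamma> by (intro power_mono) auto
    then show ?thesis by (simp add: power_mult_distrib inner_prod_self_eq)
  qed
  ultimately have "\<gamma>\<^sup>2 * (4 / V) \<le> 1"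
    using \<gamma>(1) by (meson mult_left_mono order_trans zero_le_power2)
  then have V4: "4 * \<gamma>\<^sup>2 \<le> V" using dual(1) unfolding V_def[symmetric] by (simp add: field_simps)
  define wt where "wt = (\<lambda>p::(nat \<Rightarrow> real) \<times> int. if snd p = 1 then l p else m p)"
  have wt: "V \<le> 4 * R\<^sup>2 * wt p" if "p \<in> E" for p
    unfolding V_def v_def wt_def l2_dist_power2[symmetric]
    using that E(1) False
    by (intro misclassified_weight[OF fin lab near feas R _ _ _ S(1)[OF that] E(2)[OF that]]) auto
  have Z: "Z = ?P \<union> ?N" using lab by auto
  have "real (card E) * V = (\<Sum>p\<in>E. V)" by simp
  also have "\<dots> \<le> (\<Sum>p\<in>E. 4 * R\<^sup>2 * wt p)" by (intro sum_mono wt)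
  also have "\<dots> = 4 * R\<^sup>2 * sum wt E" by (simp add: sum_distrib_left)
  also have "sum wt E \<le> sum wt Z"
    using cw Z by (intro sum_mono2 fin E) (auto simp: wt_def convex_weights_def)
  also have "sum wt Z = sum wt ?P + sum wt ?N"
    by (subst Z, subst sum.union_disjoint) (use fin in auto)
  also have "sum wt ?P = 1" using cw(1) by (simp add: wt_def convex_weights_def)
  also have "sum wt ?N = sum m ?N" by (rule sum.cong) (auto simp: wt_def)
  also have "sum m ?N = 1" using cw(2) by (simp add: convex_weights_def)
  finally have "real (card E) * V \<le> 8 * R\<^sup>2" by (simp add: mult_left_mono)
  moreover have "real (card E) * (4 * \<gamma>\<^sup>2) \<le> real (card E) * V" by (intro mult_left_mono V4) simp
  ultimately show ?thesis by simp
qed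

text \<open>Passes from samples with repetitions to sets: if another copy of the left-out point
  remains in the sample, the point is classified correctly, so \<open>T\<close> is injective on the
  mistakes.\<close>

lemma leave_one_out_mistakes:
  fixes T :: "nat \<Rightarrow> (nat \<Rightarrow> real) \<times> int"
  assumes n: "0 < n" and lab: "\<And>i. i \<le> n \<Longrightarrow> snd (T i) \<in> {-1, 1}"
    and feas: "hard_margin_feasible d (T ` {..n}) w0 b0" and \<gamma>: "0 < \<gamma>" "\<gamma> * L2_set w0 {..<d} \<le> 1"
    and R: "\<And>i k. i \<le> n \<Longrightarrow> k \<le> n \<Longrightarrow> l2_dist d (fst (T i)) (fst (T k)) \<le> R"
    and S: "\<And>p. p \<le> n \<Longrightarrow> set (S p) = T ` ({..n} - {p})"
  shows "real (card {p. p \<le> n \<and> max_margin d (S p) (fst (T p)) \<noteq> snd (T p)}) * \<gamma>\<^sup>2 \<le> 2 * R\<^sup>2"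
proof -
  define E where "E = {p. p \<le> n \<and> max_margin d (S p) (fst (T p)) \<noteq> snd (T p)}"
  have uniq: "T p \<noteq> T q" if "p \<in> E" "q \<le> n" "q \<noteq> p" for p q
  proof
    assume eq: "T p = T q"
    have p: "p \<le> n" using that by (simp add: E_def)
    have "(fst (T p), snd (T p)) \<in> set (S p)" using S[OF p] that eq by auto
    moreover have "snd ` set (S p) \<subseteq> {-1, 1}" unfolding S[OF p] image_image using lab by blast
    moreover have "hard_margin_feasible d (set (S p)) w0 b0"
      using feas S[OF p] by (rule_tac hard_margin_feasible_mono) auto
    ultimately have "max_margin d (S p) (fst (T p)) = snd (T p)"
      by (intro max_margin_separable(1))
    then show False using that by (simp add: E_def)
  qed
  then have inj: "inj_on T E" unfolding inj_on_def E_def by blast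
  define idx where "idx = the_inv_into E T"
  have idx: "idx (T p) = p" if "p \<in> E" for p unfolding idx_def by (rule the_inv_into_f_f[OF inj that])
  have "real (card (T ` E)) * \<gamma>\<^sup>2 \<le> 2 * R\<^sup>2"
  proof (rule leave_one_out_mistakes_set[where Z = "T ` {..n}" and S = "\<lambda>z. S (idx z)"])
    show "set (S (idx z)) = T ` {..n} - {z}" if z: "z \<in> T ` E" for z
    proof -
      from z obtain p where p: "p \<in> E" "z = T p" by auto
      then have "p \<le> n" by (simp add: E_def)
      from S[OF this] uniq[OF p(1)] show ?thesis unfolding p(2) idx[OF p(1)] by auto
    qed
    show "S (idx z) \<noteq> []" if z: "z \<in> T ` E" for z
    proof -
      from z obtain p where p: "p \<in> E" "z = T p" by auto
      then have "p \<le> n" by (simp add: E_def)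
      \<comment> \<open>\<open>0 < n\<close> leaves at least one point; on the empty sample the
        value of \<open>max_margin\<close> is arbitrary.\<close>
      moreover have "{..n} - {p} \<noteq> {}"
        using n by (metis Diff_eq_empty_iff atMost_iff le0 order_refl singletonD subsetD less_irrefl)
      ultimately have "set (S p) \<noteq> {}" using S by simp
      then show ?thesis unfolding p(2) idx[OF p(1)] by auto
    qed
    show "max_margin d (S (idx z)) (fst z) \<noteq> snd z" if z: "z \<in> T ` E" for z
      using z by (auto simp: idx) (simp add: E_def)
    show "T ` E \<subseteq> T ` {..n}" by (auto simp: E_def)
    show "snd ` T ` {..n} \<subseteq> {-1, 1}" using lab unfolding image_image by blast
  qed (use feas \<gamma> R in auto)
  then show ?thesis by (simp add: card_image inj flip: E_def)
qed

section \<open>Measurability of the hard margin classifier\<close>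

lemma space_labelled: "space (labelled d) = extensional {..<d} \<times> {-1, 1}"
  by (simp add: labelled_def space_pair_measure space_Rvec)

lemma measurable_coordinate: "j < d \<Longrightarrow> (\<lambda>z. fst z j) \<in> borel_measurable (labelled d)"
proof -
  assume "j < d"
  then have "(\<lambda>x. x j) \<in> borel_measurable (Rvec d)"
    unfolding Rvec_def by (intro measurable_component_singleton) simp
  then show ?thesis unfolding labelled_def by measurable
qed

lemma measurable_label [measurable]: "(\<lambda>z. snd z) \<in> labelled d \<rightarrow>\<^sub>M count_space UNIV"
proof -
  have "snd \<in> labelled d \<rightarrow>\<^sub>M count_space {-1, 1::int}" unfolding labelled_def by measurable
  then show ?thesis by (rule measurable_compose) simp
qed

lemma measurable_inner_prod [measurable (raw)]:
  assumes "\<And>j. j < d \<Longrightarrow> (\<lambda>z. f z j) \<in> borel_measurable M" "\<And>j. j < d \<Longrightarrow> (\<lambda>z. g z j) \<in> borel_measurable M"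
  shows "(\<lambda>z. inner_prod d (f z) (g z)) \<in> borel_measurable M"
  unfolding inner_prod_def using assms by (intro borel_measurable_sum borel_measurable_times) auto

lemma measurable_inner_prod_point [measurable]:
  "(\<lambda>z. inner_prod d w (fst z)) \<in> borel_measurable (labelled d)"
  by (rule measurable_inner_prod) (simp_all add: measurable_coordinate)

lemma measurable_l2_dist_point [measurable]:
  "(\<lambda>z. l2_dist d x (fst z)) \<in> borel_measurable (labelled d)"
  unfolding l2_dist_def L2_set_eq_sqrt_inner_prod
  by (rule measurable_compose[OF _ borel_measurable_sqrt], rule measurable_inner_prod;
      intro borel_measurable_diff borel_measurable_const measurable_coordinate; simp)

section \<open>Rational approximation and the support\<close>

abbreviation "rational_points d \<equiv> (\<Pi>\<^sub>E j\<in>{..<d::nat}. (\<rat>::real set))"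

lemma countable_rational_points: "countable (rational_points d)"
  by (intro countable_PiE) (simp_all add: countable_rat)

lemma rational_points_dense:
  assumes "0 < e"
  obtains c where "c \<in> rational_points d" "l2_dist d x c < e"
proof -
  define a where "a = e / (real d + 1)"
  have a: "0 < a" "real d * a < e" using assms by (auto simp: a_def field_simps)
  have "\<exists>q. q \<in> \<rat> \<and> \<bar>x j - q\<bar> < a" for j
  proof -
    have "x j - a < x j + a" using a by simp
    then obtain q where "q \<in> \<rat>" "x j - a < q" "q < x j + a"
      using Rats_dense_in_real by blast
    then show ?thesis by (intro exI[of _ q]) (auto simp: abs_less_iff)
  qed
  then have "\<exists>q. \<forall>j. q j \<in> \<rat> \<and> \<bar>x j - q j\<bar> < a" by (intro choice allI)
  then obtain q where q: "\<And>j. q j \<in> \<rat>" "\<And>j. \<bar>x j - q j\<bar> < a" by blast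
  define c where "c = (\<lambda>j\<in>{..<d}. q j)"
  have "l2_dist d x c \<le> (\<Sum>j<d. \<bar>x j - c j\<bar>)" unfolding l2_dist_def by (rule L2_set_le_sum_abs)
  also have "\<dots> \<le> (\<Sum>j<d. a)"
    using q(2) by (intro sum_mono) (auto simp: c_def less_imp_le)
  also have "\<dots> < e" using a by simp
  finally have "l2_dist d x c < e" .
  moreover have "c \<in> rational_points d" using q(1) by (auto simp: c_def)
  ultimately show ?thesis using that by blast
qed

lemma distribution_space: "distribution d D \<Longrightarrow> space D = space (labelled d)"
  by (auto simp: distribution_def dest: sets_eq_imp_space_eq)

text \<open>Points outside the support of their label are covered by countably many null balls with
  rational centers and radii.\<close>

lemma AE_in_support_part:
  assumes D: "distribution d D"
  shows "AE z in D. fst z \<in> support_part d D (snd z)"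
proof -
  interpret prob_space D using D by (simp add: distribution_def)
  have sets[measurable_cong]: "sets D = sets (labelled d)" using D by (simp add: distribution_def)
  have space: "space D = space (labelled d)" by (rule distribution_space[OF D])
  let ?B = "\<lambda>(c, \<delta>, y). {z \<in> space D. l2_dist d c (fst z) < \<delta> \<and> snd z = y}"
  have B: "?B t \<in> sets D" for t by (cases t) simp
  have count: "countable (rational_points d \<times> (\<rat>::real set) \<times> {-1, 1::int})"
    by (intro countable_SIGMA countable_rational_points countable_rat) auto
  have "AE z in D. \<forall>t\<in>rational_points d \<times> \<rat> \<times> {-1, 1}. measure D (?B t) = 0 \<longrightarrow> z \<notin> ?B t"
  proof (subst AE_ball_countable[OF count], rule ballI)
    fix t
    show "AE z in D. measure D (?B t) = 0 \<longrightarrow> z \<notin> ?B t"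
    proof (cases "measure D (?B t) = 0")
      case True
      then have "?B t \<in> null_sets D" using B by (simp add: null_sets_def emeasure_eq_measure)
      then show ?thesis by (auto dest: AE_not_in)
    qed simp
  qed
  then show ?thesis
  proof (rule AE_mp, intro AE_I2 impI)
    fix z assume z: "z \<in> space D"
      and *: "\<forall>t\<in>rational_points d \<times> \<rat> \<times> {-1, 1}. measure D (?B t) = 0 \<longrightarrow> z \<notin> ?B t"
    have y: "snd z \<in> {-1, 1}" "fst z \<in> space (Rvec d)"
      using z unfolding space space_labelled space_Rvec by (simp_all only: mem_Times_iff)
    show "fst z \<in> support_part d D (snd z)"
    proof (rule ccontr)
      assume "\<not> ?thesis"
      then obtain e where e: "e > 0" "\<not> 0 < measure D {(x', y') \<in> space D. l2_dist d (fst z) x' < e \<and> y' = snd z}"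
        using y(2) unfolding support_part_def by blast
      have eq: "{(x', y') \<in> space D. l2_dist d (fst z) x' < e \<and> y' = snd z} = ?B (fst z, e, snd z)" by auto
      have 0: "measure D (?B (fst z, e, snd z)) = 0"
        using e(2) measure_nonneg[of D "?B (fst z, e, snd z)"] unfolding eq by linarith
      obtain c where c: "c \<in> rational_points d" "l2_dist d (fst z) c < e / 3"
        using rational_points_dense[of "e / 3" d "fst z"] e(1) by auto
      \<comment> \<open>With a radius in this range the rational ball contains \<open>fst z\<close>
        and, by the triangle inequality, stays inside the null ball of radius
        \<open>e\<close>.\<close>
      have "e / 3 < 2 * e / 3" using e(1) by simp
      then obtain \<delta> where \<delta>: "\<delta> \<in> \<rat>" "e / 3 < \<delta>" "\<delta> < 2 * e / 3" using Rats_dense_in_real by blast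
      have "?B (c, \<delta>, snd z) \<subseteq> ?B (fst z, e, snd z)"
      proof clarsimp
        fix a assume "l2_dist d c a < \<delta>"
        then show "l2_dist d (fst z) a < e"
          using l2_dist_triangle[of d "fst z" a c] c(2) \<delta>(3) by linarith
      qed
      then have "measure D (?B (c, \<delta>, snd z)) \<le> 0" using finite_measure_mono[OF _ B, of _ "(fst z, e, snd z)"] unfolding 0 by blast
      then have "measure D (?B (c, \<delta>, snd z)) = 0" using measure_nonneg[of D "?B (c, \<delta>, snd z)"] by linarith
      then have "z \<notin> ?B (c, \<delta>, snd z)" using *[rule_format, of "(c, \<delta>, snd z)"] c(1) \<delta>(1) y(1) by simp
      moreover have "z \<in> ?B (c, \<delta>, snd z)" using z c(2) \<delta>(2) by (simp add: l2_dist_commute[of d c "fst z"])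
      ultimately show False by simp
    qed
  qed
qed

lemma L2_set_triangle_diff: "L2_set a {..<d} \<le> L2_set b {..<d} + L2_set (\<lambda>j. a j - b j) {..<d}"
  using L2_set_triangle_ineq[of b "\<lambda>j. a j - b j" "{..<d}"] by simp

text \<open>Constraints may be tight, so rounding \<open>w\<close> and \<open>b\<close> directly
  could violate them. Scaling both by \<open>1 + \<eta>\<close> first creates slack
  \<open>\<eta>\<close> in every constraint, which pays for the rounding.\<close>

lemma hard_margin_feasible_rational:
  assumes fin: "finite Z" and lab: "snd ` Z \<subseteq> {-1, 1}" and feas: "hard_margin_feasible d Z w b" and e: "0 < e"
  obtains w' b' where "w' \<in> rational_points d" "b' \<in> \<rat>" "hard_margin_feasible d Z w' b'"
    "L2_set (\<lambda>j. w' j - w j) {..<d} \<le> e" "\<bar>b' - b\<bar> \<le> e"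
proof -
  define M where "M = (\<Sum>z\<in>Z. L2_set (fst z) {..<d}) + 1"
  have M: "L2_set (fst z) {..<d} + 1 \<le> M" if "z \<in> Z" for z
    unfolding M_def using member_le_sum[of z Z "\<lambda>z. L2_set (fst z) {..<d}"] that fin by simp
  have M1: "1 \<le> M" unfolding M_def by (simp add: sum_nonneg)
  define s where "s = L2_set w {..<d} + \<bar>b\<bar> + 1"
  have s: "L2_set w {..<d} \<le> s" "\<bar>b\<bar> \<le> s" "1 \<le> s" by (simp_all add: s_def)
  \<comment> \<open>Keeps the change caused by scaling within \<open>e / 2\<close>, for
    \<open>w\<close> as well as for \<open>b\<close>.\<close>
  define \<eta> where "\<eta> = e / (2 * s)"
  have \<eta>: "0 < \<eta>" "\<eta> * s = e / 2" using e s by (simp_all add: \<eta>_def)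
  \<comment> \<open>Rounding by \<open>\<delta>\<close> changes the constraint at \<open>x\<close>
    by at most \<open>\<delta> * (L2_set x {..<d} + 1)\<close>, which is at most
    \<open>\<delta> * M\<close> and so within the slack.\<close>
  define \<delta> where "\<delta> = min (e / 2) (\<eta> / M)"
  have \<delta>: "0 < \<delta>" "\<delta> \<le> e / 2" "\<delta> * M \<le> \<eta>"
  proof -
    show "0 < \<delta>" using e \<eta> M1 by (simp add: \<delta>_def)
    show "\<delta> \<le> e / 2" unfolding \<delta>_def by (rule min.cobounded1)
    have "\<delta> * M \<le> (\<eta> / M) * M" using M1 by (intro mult_right_mono) (auto simp: \<delta>_def)
    then show "\<delta> * M \<le> \<eta>" using M1 by simp
  qed
  obtain w' where w': "w' \<in> rational_points d" "l2_dist d (\<lambda>j. w j + \<eta> * w j) w' < \<delta>"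
    using rational_points_dense[OF \<delta>(1)] by blast
  have "b + \<eta> * b - \<delta> < b + \<eta> * b + \<delta>" using \<delta>(1) by simp
  then obtain b' where b': "b' \<in> \<rat>" "b + \<eta> * b - \<delta> < b'" "b' < b + \<eta> * b + \<delta>"
    using Rats_dense_in_real by blast
  show ?thesis
  proof (rule that[OF w'(1) b'(1)])
    show "hard_margin_feasible d Z w' b'"
      unfolding hard_margin_feasible_def
    proof clarify
      fix x y assume z: "(x, y) \<in> Z"
      have "snd (x, y) \<in> {-1, 1}" using lab z by blast
      then have y: "y = 1 \<or> y = -1" by auto
      have 1: "1 \<le> real_of_int y * (inner_prod d w x - b)" using feas z by (auto simp: hard_margin_feasible_def)
      have "\<bar>inner_prod d (\<lambda>j. (w j + \<eta> * w j) - w' j) x\<bar> \<le> l2_dist d (\<lambda>j. w j + \<eta> * w j) w' * L2_set x {..<d}"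
        unfolding l2_dist_def by (rule abs_inner_prod_le)
      also have "\<dots> \<le> \<delta> * L2_set x {..<d}" using w'(2) by (intro mult_right_mono) auto
      finally have 2: "\<bar>inner_prod d w x + \<eta> * inner_prod d w x - inner_prod d w' x\<bar> \<le> \<delta> * L2_set x {..<d}"
        by (simp add: inner_prod_left)
      have 3: "\<bar>b' - (b + \<eta> * b)\<bar> \<le> \<delta>" using b' by (simp add: abs_le_iff)
      have "\<delta> * L2_set x {..<d} + \<delta> \<le> \<delta> * M"
        using M[OF z] \<delta>(1) mult_left_mono[of "L2_set x {..<d} + 1" M \<delta>] by (simp add: algebra_simps)
      with \<delta>(3) have 4: "\<delta> * L2_set x {..<d} + \<delta> \<le> \<eta>" by simp
      from y show "1 \<le> real_of_int y * (inner_prod d w' x - b')"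
      proof
        assume [simp]: "y = 1"
        have "\<eta> * 1 \<le> \<eta> * (inner_prod d w x - b)" using 1 \<eta>(1) by (intro mult_left_mono) auto
        then show ?thesis using 1 2 3 4 by (simp add: algebra_simps abs_le_iff)
      next
        assume [simp]: "y = -1"
        have "\<eta> * 1 \<le> \<eta> * (b - inner_prod d w x)" using 1 \<eta>(1) by (intro mult_left_mono) auto
        then show ?thesis using 1 2 3 4 by (simp add: algebra_simps abs_le_iff)
      qed
    qed
    have "L2_set (\<lambda>j. w' j - w j) {..<d} \<le> L2_set (\<lambda>j. \<eta> * w j) {..<d} + L2_set (\<lambda>j. w' j - w j - \<eta> * w j) {..<d}"
      by (rule L2_set_triangle_diff)
    also have "L2_set (\<lambda>j. w' j - w j - \<eta> * w j) {..<d} = l2_dist d w' (\<lambda>j. w j + \<eta> * w j)"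
      unfolding l2_dist_def by (simp add: algebra_simps)
    also have "\<dots> \<le> e / 2" using w'(2) \<delta>(2) by (subst l2_dist_commute) simp
    also have "L2_set (\<lambda>j. \<eta> * w j) {..<d} = \<eta> * L2_set w {..<d}"
      using \<eta>(1) by (simp add: L2_set_right_distrib)
    also have "\<eta> * L2_set w {..<d} \<le> e / 2" using \<eta> mult_left_mono[OF s(1) less_imp_le[OF \<eta>(1)]] by linarith
    finally show "L2_set (\<lambda>j. w' j - w j) {..<d} \<le> e" by simp
    have "\<bar>\<eta> * b\<bar> \<le> e / 2" using \<eta> mult_left_mono[OF s(2) less_imp_le[OF \<eta>(1)]] by (simp only: abs_mult abs_of_pos)
    then show "\<bar>b' - b\<bar> \<le> e" using b' \<delta>(2) by linarith
  qed
qed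

text \<open>The prediction of the hard margin classifier, expressed through countable quantifiers only:
  this makes its joint measurability in the sample and the point evident.\<close>

definition svm_predicts_pos :: "nat \<Rightarrow> nat \<Rightarrow> (nat \<Rightarrow> (nat \<Rightarrow> real) \<times> int) \<Rightarrow> (nat \<Rightarrow> real) \<Rightarrow> bool" where
  "svm_predicts_pos d n S x \<longleftrightarrow> (\<forall>k::nat. \<exists>w\<in>rational_points d. \<exists>b\<in>\<rat>.
     hard_margin_feasible d (S ` {..<n}) w b \<and>
     (\<forall>w'\<in>rational_points d. \<forall>b'\<in>\<rat>. hard_margin_feasible d (S ` {..<n}) w' b' \<longrightarrow>
        inner_prod d w w \<le> inner_prod d w' w' + 1 / real (Suc k)) \<and>
     - (1 / real (Suc k)) \<le> inner_prod d w x - b)"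

lemma nonneg_if_ge_sequence:
  fixes a K :: real
  assumes "\<And>k::nat. - (K * sqrt (1 / real (Suc k))) \<le> a"
  shows "0 \<le> a"
proof -
  have "(\<lambda>k. - (K * sqrt (1 / real (Suc k)))) \<longlonglongrightarrow> - (K * sqrt 0)"
    using LIMSEQ_inverse_real_of_nat by (intro tendsto_intros) (simp add: inverse_eq_divide)
  from LIMSEQ_le_const2[OF this, of a] assms show ?thesis by simp
qed

text \<open>By stability the near-optimal pairs converge to \<open>(w, b)\<close> at rate
  \<open>sqrt (1 / real (Suc k))\<close>, and predicting \<open>1\<close> is a closed condition,
  which survives the limit. Conversely, rational feasible pairs approximate the optimum.\<close>

lemma svm_predicts_pos_iff:
  assumes lab: "snd ` S ` {..<n} \<subseteq> {-1, 1}"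
    and ne: "pos_part (S ` {..<n}) \<noteq> {}" "neg_part (S ` {..<n}) \<noteq> {}"
    and sol: "svm_solution d (S ` {..<n}) w b"
  shows "svm_predicts_pos d n S x \<longleftrightarrow> b \<le> inner_prod d w x"
proof -
  let ?Z = "S ` {..<n}"
  have fin: "finite ?Z" by simp
  have f: "hard_margin_feasible d ?Z w b" and opt: "\<And>w' b'. hard_margin_feasible d ?Z w' b' \<Longrightarrow> inner_prod d w w \<le> inner_prod d w' w'"
    using sol by (auto simp: svm_solution_def)
  obtain w0 b0 C where w0: "svm_solution d ?Z w0 b0" and "0 < inner_prod d w0 w0"
    and c1: "\<And>w' b'. hard_margin_feasible d ?Z w' b' \<Longrightarrow>
       inner_prod d (\<lambda>j. w' j - w0 j) (\<lambda>j. w' j - w0 j) \<le> inner_prod d w' w' - inner_prod d w0 w0"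
    and c2: "\<And>w' b'. hard_margin_feasible d ?Z w' b' \<Longrightarrow> \<bar>b' - b0\<bar> \<le> C * L2_set (\<lambda>j. w' j - w0 j) {..<d}"
    by (rule svm_solution_exists_unique[OF fin lab ne f]) (rule that)
  have "inner_prod d w0 w0 \<le> inner_prod d w w" using w0 f by (auto simp: svm_solution_def)
  from svm_solution_unique[OF fin lab ne sol _ this] w0
  have eq: "\<forall>j<d. w0 j = w j" "b0 = b" by (auto simp: svm_solution_def)
  have ipx: "inner_prod d w0 x = inner_prod d w x" for x by (rule inner_prod_cong) (use eq in auto)
  have norm_upper: "inner_prod d w' w' \<le> inner_prod d w w + e * (2 * L2_set w {..<d} + 1)"
    if "L2_set (\<lambda>j. w' j - w j) {..<d} \<le> e" "0 \<le> e" "e \<le> 1" for w' e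
  proof -
    have "L2_set w' {..<d} \<le> L2_set w {..<d} + e" using L2_set_triangle_diff[of w' d w] that by simp
    then have "(L2_set w' {..<d})\<^sup>2 \<le> (L2_set w {..<d} + e)\<^sup>2" by (intro power_mono) auto
    also have "\<dots> \<le> (L2_set w {..<d})\<^sup>2 + e * (2 * L2_set w {..<d} + 1)"
      using mult_left_mono[of e 1 e] that by (simp add: power2_eq_square algebra_simps)
    finally show ?thesis by (simp add: inner_prod_self_eq)
  qed
  let ?c = "2 * L2_set w {..<d} + 1"
  have c_pos: "0 < ?c" by (rule add_nonneg_pos) auto
  show ?thesis
  proof
    assume pred: "svm_predicts_pos d n S x"
    have bound: "- ((1 + L2_set x {..<d} + \<bar>C\<bar>) * sqrt (1 / real (Suc k))) \<le> inner_prod d w x - b" for k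
    proof -
      let ?q = "1 / real (Suc k)"
      obtain w' b' where w': "hard_margin_feasible d ?Z w' b'"
        and near: "\<And>v c. v \<in> rational_points d \<Longrightarrow> c \<in> \<rat> \<Longrightarrow> hard_margin_feasible d ?Z v c \<Longrightarrow> inner_prod d w' w' \<le> inner_prod d v v + ?q"
        and x: "- ?q \<le> inner_prod d w' x - b'"
        using pred[unfolded svm_predicts_pos_def, rule_format, of k] by blast
      \<comment> \<open>Comparison with rational pairs alone suffices, since rational feasible pairs
        come arbitrarily close to \<open>(w, b)\<close>.\<close>
      have "inner_prod d w' w' \<le> inner_prod d w w + ?q"
      proof (rule field_le_epsilon)
        fix e :: real assume e: "0 < e"
        let ?e = "min 1 (e / ?c)"
        have "0 < ?e" using e c_pos by simp
        then obtain v c where v: "v \<in> rational_points d" "c \<in> \<rat>" "hard_margin_feasible d ?Z v c"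
          "L2_set (\<lambda>j. v j - w j) {..<d} \<le> ?e" "\<bar>c - b\<bar> \<le> ?e"
          by (rule hard_margin_feasible_rational[OF fin lab f])
        have "inner_prod d w' w' \<le> inner_prod d v v + ?q" by (rule near[OF v(1-3)])
        also have "inner_prod d v v \<le> inner_prod d w w + ?e * ?c"
          using v(4) \<open>0 < ?e\<close> by (intro norm_upper) auto
        also have "?e * ?c \<le> (e / ?c) * ?c" using c_pos by (intro mult_right_mono) auto
        also have "\<dots> = e" using c_pos by simp
        finally show "inner_prod d w' w' \<le> inner_prod d w w + ?q + e" by simp
      qed
      then have "inner_prod d (\<lambda>j. w' j - w0 j) (\<lambda>j. w' j - w0 j) \<le> ?q"
        using c1[OF w'] \<open>inner_prod d w0 w0 \<le> inner_prod d w w\<close> opt[of w0 b0] w0 by (simp add: svm_solution_def)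
      then have L: "L2_set (\<lambda>j. w' j - w0 j) {..<d} \<le> sqrt ?q"
        unfolding L2_set_eq_sqrt_inner_prod by (rule real_sqrt_le_mono)
      have "\<bar>b' - b0\<bar> \<le> \<bar>C\<bar> * L2_set (\<lambda>j. w' j - w0 j) {..<d}"
        using c2[OF w'] mult_right_mono[OF abs_ge_self[of C] L2_set_nonneg] by (rule order_trans)
      also have "\<dots> \<le> \<bar>C\<bar> * sqrt ?q" using L by (intro mult_left_mono) auto
      finally have b: "\<bar>b' - b0\<bar> \<le> \<bar>C\<bar> * sqrt ?q" .
      have "\<bar>inner_prod d (\<lambda>j. w' j - w0 j) x\<bar> \<le> L2_set (\<lambda>j. w' j - w0 j) {..<d} * L2_set x {..<d}"
        by (rule abs_inner_prod_le)
      also have "\<dots> \<le> sqrt ?q * L2_set x {..<d}" using L by (intro mult_right_mono) auto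
      finally have i: "\<bar>inner_prod d w' x - inner_prod d w0 x\<bar> \<le> sqrt ?q * L2_set x {..<d}"
        by (simp add: inner_prod_left)
      have "?q\<^sup>2 \<le> ?q" using mult_right_mono[of ?q 1 ?q] by (simp add: power2_eq_square)
      then have "?q \<le> sqrt ?q" by (rule real_le_rsqrt)
      then show ?thesis using x i b ipx[of x] eq(2) by (simp add: algebra_simps abs_le_iff)
    qed
    have "0 \<le> inner_prod d w x - b"
      by (rule nonneg_if_ge_sequence[OF bound])
    then show "b \<le> inner_prod d w x" by simp
  next
    assume b: "b \<le> inner_prod d w x"
    show "svm_predicts_pos d n S x"
      unfolding svm_predicts_pos_def
    proof
      fix k
      let ?q = "1 / real (Suc k)"
      \<comment> \<open>One radius \<open>e\<close> has to serve both the norm and the value at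
        \<open>x\<close>, so \<open>K\<close> dominates both Lipschitz factors.\<close>
      define K where "K = ?c + L2_set x {..<d} + 1"
      have K: "?c \<le> K" "L2_set x {..<d} + 1 \<le> K" "1 \<le> K" using c_pos by (auto simp: K_def)
      define e where "e = ?q / K"
      have q: "0 < ?q" "?q \<le> 1" by auto
      have e: "0 < e" "e * K = ?q" using q K by (auto simp: e_def)
      then have "e \<le> 1" using mult_left_mono[OF K(3), of e] q by linarith
      note e = e(1) this e(2)
      obtain v c where v: "v \<in> rational_points d" "c \<in> \<rat>" "hard_margin_feasible d ?Z v c"
         "L2_set (\<lambda>j. v j - w j) {..<d} \<le> e" "\<bar>c - b\<bar> \<le> e"
        by (rule hard_margin_feasible_rational[OF fin lab f e(1)])
      have "inner_prod d v v \<le> inner_prod d w w + ?q"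
        using norm_upper[OF v(4)] e mult_left_mono[OF K(1), of e] by simp
      then have "inner_prod d v v \<le> inner_prod d w' w' + ?q" if "hard_margin_feasible d ?Z w' b'" for w' b'
        using opt[OF that] by simp
      moreover have "\<bar>inner_prod d (\<lambda>j. v j - w j) x\<bar> \<le> e * L2_set x {..<d}"
        using abs_inner_prod_le[of d "\<lambda>j. v j - w j" x] mult_right_mono[OF v(4), of "L2_set x {..<d}"] by simp
      then have "\<bar>inner_prod d v x - inner_prod d w x\<bar> + e \<le> e * (L2_set x {..<d} + 1)"
        by (simp add: inner_prod_left algebra_simps)
      then have "\<bar>inner_prod d v x - inner_prod d w x\<bar> + e \<le> ?q"
        using e mult_left_mono[OF K(2), of e] by simp
      then have "- ?q \<le> inner_prod d v x - c" using v(5) b by linarith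
      ultimately show "\<exists>w\<in>rational_points d. \<exists>b\<in>\<rat>. hard_margin_feasible d ?Z w b \<and>
         (\<forall>w'\<in>rational_points d. \<forall>b'\<in>\<rat>. hard_margin_feasible d ?Z w' b' \<longrightarrow> inner_prod d w w \<le> inner_prod d w' w' + ?q) \<and>
         - ?q \<le> inner_prod d w x - b"
        using v(1-3) by blast
    qed
  qed
qed

section \<open>Expected loss of the max margin algorithm\<close>

lemma pred_countable_Ball:
  "countable X \<Longrightarrow> (\<And>i. i \<in> X \<Longrightarrow> Measurable.pred M (\<lambda>x. P x i)) \<Longrightarrow> Measurable.pred M (\<lambda>x. \<forall>i\<in>X. P x i)"
  unfolding pred_def by (rule sets.sets_Collect_countable_All') simp_all

lemma pred_countable_Bex:
  "countable X \<Longrightarrow> (\<And>i. i \<in> X \<Longrightarrow> Measurable.pred M (\<lambda>x. P x i)) \<Longrightarrow> Measurable.pred M (\<lambda>x. \<exists>i\<in>X. P x i)"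
  unfolding pred_def by (rule sets.sets_Collect_countable_Ex') simp_all

text \<open>The completion tolerates changes on null sets. This handles both the non-constructive
  \<open>max_margin\<close> and learners without any measurability.\<close>

lemma measurable_completion_AE:
  assumes g: "g \<in> completion M \<rightarrow>\<^sub>M N" and ae: "AE x in M. f x = g x" and sp: "f \<in> space M \<rightarrow> space N"
  shows "f \<in> completion M \<rightarrow>\<^sub>M N"
proof (rule measurableI)
  fix A assume "A \<in> sets N"
  show "f -` A \<inter> space (completion M) \<in> sets (completion M)"
  proof (rule completion.in_sets_AE)
    show "g -` A \<inter> space (completion M) \<in> sets (completion M)"
      by (rule measurable_sets[OF g \<open>A \<in> sets N\<close>])
    show "AE x in completion M. x \<in> g -` A \<inter> space (completion M) \<longleftrightarrow> x \<in> f -` A \<inter> space (completion M)"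
      using AE_completion[OF ae] by eventually_elim simp
  qed auto
qed (use sp in auto)

text \<open>A measurable substitute for a mistake of \<open>max_margin\<close>. With a single label
  in the sample the prediction is that label, read off from \<open>S 0\<close>. The substitute is
  faithful on separable samples, hence for almost every sample.\<close>

definition svm_mistake :: "nat \<Rightarrow> nat \<Rightarrow> (nat \<Rightarrow> (nat \<Rightarrow> real) \<times> int) \<Rightarrow> (nat \<Rightarrow> real) \<times> int \<Rightarrow> bool" where
  "svm_mistake d n S z \<longleftrightarrow>
     (if (\<exists>i\<in>{..<n}. snd (S i) = 1) \<and> (\<exists>i\<in>{..<n}. snd (S i) = -1)
      then svm_predicts_pos d n S (fst z) \<noteq> (snd z = 1) else snd z \<noteq> snd (S 0))"

lemma svm_mistake_cong:
  assumes "0 < n" "\<And>i. i < n \<Longrightarrow> S i = S' i"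
  shows "svm_mistake d n S z = svm_mistake d n S' z"
proof -
  have 1: "S ` {..<n} = S' ` {..<n}" using assms(2) by (intro image_cong) auto
  have 2: "(\<exists>i\<in>{..<n}. snd (S i) = y) = (\<exists>i\<in>{..<n}. snd (S' i) = y)" for y
    using assms(2) by (intro bex_cong) auto
  have 3: "S 0 = S' 0" using assms by simp
  show ?thesis unfolding svm_mistake_def svm_predicts_pos_def 1 2 3 ..
qed

lemma set_sample_list: "set (sample_list n S) = S ` {..<n}"
  by (auto simp: sample_list_def)

lemma svm_mistake_iff:
  assumes n: "0 < n" and lab: "\<And>i. i < n \<Longrightarrow> snd (S i) \<in> {-1, 1}" "snd z \<in> {-1, 1}"
    and feas: "hard_margin_feasible d (S ` {..<n}) w0 b0"
  shows "svm_mistake d n S z \<longleftrightarrow> max_margin d (sample_list n S) (fst z) \<noteq> snd z"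
proof -
  have lab': "snd ` S ` {..<n} \<subseteq> {-1, 1}" unfolding image_image using lab(1) by blast
  show ?thesis
  proof (cases "(\<exists>i\<in>{..<n}. snd (S i) = 1) \<and> (\<exists>i\<in>{..<n}. snd (S i) = -1)")
    case True
    then have ne: "pos_part (S ` {..<n}) \<noteq> {}" "neg_part (S ` {..<n}) \<noteq> {}" by blast+
    obtain w b where wb: "svm_solution d (S ` {..<n}) w b"
      using svm_solution_exists[OF _ lab' ne feas] by auto
    have mm: "max_margin d (sample_list n S) = linear_classifier d w b"
      using max_margin_eq_svm_solution[of "sample_list n S", unfolded set_sample_list, OF lab' ne wb] .
    have "svm_mistake d n S z \<longleftrightarrow> (b \<le> inner_prod d w (fst z)) \<noteq> (snd z = 1)"
      unfolding svm_mistake_def svm_predicts_pos_iff[OF lab' ne wb] using True by simp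
    moreover have "snd z = 1 \<or> snd z = -1" using lab(2) by auto
    ultimately show ?thesis unfolding mm by (auto simp: linear_classifier_def)
  next
    case False
    then have parts: "pos_part (S ` {..<n}) = {} \<or> neg_part (S ` {..<n}) = {}" by blast
    have "S 0 \<in> S ` {..<n}" using n by simp
    from single_label_if_part_empty[OF lab' parts this]
    have "max_margin d (sample_list n S) (fst z) = snd (S 0)"
      using n lab(1)[OF n] by (intro max_margin_single_label) (unfold set_sample_list, auto simp: sample_list_def)
    then show ?thesis using False unfolding svm_mistake_def by auto
  qed
qed

lemma pred_hard_margin_feasible:
  fixes n :: nat
  assumes [measurable]: "\<And>i. i < n \<Longrightarrow> (\<lambda>\<omega>. S \<omega> i) \<in> M \<rightarrow>\<^sub>M labelled d"
  shows "Measurable.pred M (\<lambda>\<omega>. hard_margin_feasible d (S \<omega> ` {..<n}) w b)"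
proof -
  have "Measurable.pred M (\<lambda>\<omega>. 1 \<le> real_of_int (snd (S \<omega> i)) * (inner_prod d w (fst (S \<omega> i)) - b))" if "i < n" for i
  proof -
    have [measurable]: "Measurable.pred (labelled d) (\<lambda>z. 1 \<le> real_of_int (snd z) * (inner_prod d w (fst z) - b))"
    proof -
      have [measurable]: "(\<lambda>z. real_of_int (snd z)) \<in> borel_measurable (labelled d)"
        by (rule measurable_compose[OF measurable_label]) simp
      show ?thesis by measurable
    qed
    show ?thesis using assms[OF that] by measurable
  qed
  then have "Measurable.pred M (\<lambda>\<omega>. \<forall>i\<in>{..<n}. 1 \<le> real_of_int (snd (S \<omega> i)) * (inner_prod d w (fst (S \<omega> i)) - b))"
    by (intro pred_countable_Ball) auto
  then show ?thesis unfolding hard_margin_feasible_def by (simp add: case_prod_unfold)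
qed

lemma pred_svm_mistake:
  assumes n: "0 < n" and S[measurable]: "\<And>i. i < n \<Longrightarrow> (\<lambda>\<omega>. S \<omega> i) \<in> M \<rightarrow>\<^sub>M labelled d"
    and z[measurable]: "z \<in> M \<rightarrow>\<^sub>M labelled d"
  shows "Measurable.pred M (\<lambda>\<omega>. svm_mistake d n (S \<omega>) (z \<omega>))"
proof -
  note feas[measurable] = pred_hard_margin_feasible[OF S]
  have pos[measurable]: "Measurable.pred M (\<lambda>\<omega>. svm_predicts_pos d n (S \<omega>) (fst (z \<omega>)))"
    unfolding svm_predicts_pos_def
  proof (intro pred_intros_countable pred_countable_Bex pred_intros_logic pred_countable_Ball
      countable_rational_points countable_rat feas)
    fix k w b
    show "Measurable.pred M (\<lambda>\<omega>. - (1 / real (Suc k)) \<le> inner_prod d w (fst (z \<omega>)) - b)"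
      by measurable
  qed auto
  have lab: "Measurable.pred M (\<lambda>\<omega>. \<exists>i\<in>{..<n}. snd (S \<omega> i) = y)" for y
  proof (intro pred_countable_Bex)
    fix i assume "i \<in> {..<n}"
    then have [measurable]: "(\<lambda>\<omega>. S \<omega> i) \<in> M \<rightarrow>\<^sub>M labelled d" using S by simp
    show "Measurable.pred M (\<lambda>\<omega>. snd (S \<omega> i) = y)" by measurable
  qed auto
  have [measurable]: "(\<lambda>\<omega>. S \<omega> 0) \<in> M \<rightarrow>\<^sub>M labelled d" using S n by simp
  note lab[measurable]
  have neq: "Measurable.pred M (\<lambda>\<omega>. snd (z \<omega>) \<noteq> snd (S \<omega> 0))" by measurable
  have pred: "Measurable.pred M (\<lambda>\<omega>. svm_predicts_pos d n (S \<omega>) (fst (z \<omega>)) \<noteq> (snd (z \<omega>) = 1))" by measurable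
  have "Measurable.pred M (\<lambda>\<omega>.
      ((\<exists>i\<in>{..<n}. snd (S \<omega> i) = 1) \<and> (\<exists>i\<in>{..<n}. snd (S \<omega> i) = -1) \<longrightarrow> svm_predicts_pos d n (S \<omega>) (fst (z \<omega>)) \<noteq> (snd (z \<omega>) = 1)) \<and>
      (\<not> ((\<exists>i\<in>{..<n}. snd (S \<omega> i) = 1) \<and> (\<exists>i\<in>{..<n}. snd (S \<omega> i) = -1)) \<longrightarrow> snd (z \<omega>) \<noteq> snd (S \<omega> 0)))"
    by (intro pred_intros_logic(3)[OF pred_intros_logic(4) pred_intros_logic(4)]
      pred_intros_logic(2)[OF pred_intros_logic(3)] pred_intros_logic(3)[OF lab lab] lab pred neq)
  then show ?thesis unfolding svm_mistake_def if_bool_eq_conj .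
qed

text \<open>A separator attaining the margin is rescaled to a feasible pair; \<open>X\<close> is the
  support, whose diameter the aspect ratio controls.\<close>

lemma sep_class_margin:
  assumes D: "D \<in> sep_class d p r \<rho>"
  obtains \<gamma> w b X where "0 < \<gamma>" "\<gamma> * L2_set w {..<d} \<le> 1"
    "AE z in D. hard_margin_feasible d {z} w b \<and> snd z \<in> {-1, 1} \<and> fst z \<in> X"
    "\<And>x x'. x \<in> X \<Longrightarrow> x' \<in> X \<Longrightarrow> l2_dist d x x' \<le> \<rho> * \<gamma>"
proof -
  have dist: "distribution d D" using D by (simp add: sep_class_def)
  interpret prob_space D using dist by (simp add: distribution_def)
  have sets[measurable_cong]: "sets D = sets (labelled d)" using dist by (simp add: distribution_def)
  have space: "space D = space (labelled d)" by (rule distribution_space[OF dist])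
  define X where "X = support_part d D 1 \<union> support_part d D (-1)"
  from D obtain \<gamma> where \<gamma>: "0 < \<gamma>" "is_margin d D \<gamma>" "l2_diam d X / ereal \<gamma> \<le> ereal \<rho>"
    by (auto simp: sep_class_def aspect_ratio_le_def X_def)
  from \<gamma>(2) obtain w b where wb: "std_loss (linear_classifier d w b) D = 0"
      "\<And>x. x \<in> X \<Longrightarrow> ereal \<gamma> \<le> l2_setdist d x (decision_boundary d w b)"
    unfolding is_margin_def separates_with_margin_def X_def by blast
  have lab: "AE z in D. snd z \<in> {-1, 1}"
    by (rule AE_I2) (auto simp: space space_labelled)
  have inX: "AE z in D. fst z \<in> X"
    using AE_in_support_part[OF dist] lab by eventually_elim (auto simp: X_def)
  \<comment> \<open>If \<open>w\<close> vanished, the boundary would be the whole space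
    (\<open>b = 0\<close>), at distance \<open>0\<close> from the support, or empty
    (\<open>b \<noteq> 0\<close>), and then every larger margin would be attained too, so there
    would be no largest one.\<close>
  have w_pos: "0 < L2_set w {..<d}"
  proof (rule ccontr)
    assume w0: "\<not> ?thesis"
    have ip: "inner_prod d w x = 0" for x by (rule inner_prod_eq_0_if_L2_set_eq_0[OF w0])
    show False
    proof (cases "b = 0")
      case True
      have "\<exists>x. x \<in> X"
      proof (rule ccontr)
        assume "\<not> ?thesis"
        then show False using inX by simp
      qed
      then obtain x where x: "x \<in> X" by blast
      then have "x \<in> decision_boundary d w b"
        using True by (auto simp: X_def support_part_def decision_boundary_def ip)
      then have "l2_setdist d x (decision_boundary d w b) \<le> ereal (l2_dist d x x)"
        unfolding l2_setdist_def by (rule INF_lower)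
      moreover have "l2_dist d x x = 0" by (simp add: l2_dist_def L2_set_def)
      ultimately have "ereal \<gamma> \<le> 0" using wb(2)[OF x] by (metis order_trans zero_ereal_def)
      then show False using \<gamma>(1) by simp
    next
      case False
      then have "decision_boundary d w b = {}" by (auto simp: decision_boundary_def ip)
      then have "l2_setdist d x (decision_boundary d w b) = \<infinity>" for x
        by (simp add: l2_setdist_def flip: top_ereal_def)
      then have "separates_with_margin d D (\<gamma> + 1)"
        unfolding separates_with_margin_def using wb(1) by (intro exI[of _ w] exI[of _ b]) simp
      then show False using \<gamma>(2) by (force simp: is_margin_def)
    qed
  qed
  have [measurable]: "Measurable.pred (labelled d) (\<lambda>z. linear_classifier d w b (fst z) = snd z)"
    unfolding linear_classifier_def by measurable
  have eq: "{(x, y) \<in> space D. linear_classifier d w b x \<noteq> y} = {z \<in> space D. \<not> linear_classifier d w b (fst z) = snd z}"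
    by auto
  have "{z \<in> space D. \<not> linear_classifier d w b (fst z) = snd z} \<in> sets D" by measurable
  moreover from this have "measure D {z \<in> space D. \<not> linear_classifier d w b (fst z) = snd z} = 0"
    using wb(1) unfolding std_loss_def eq by simp
  ultimately have ae: "AE z in D. linear_classifier d w b (fst z) = snd z"
    by (intro AE_I[OF subset_refl]) (auto simp: emeasure_eq_measure)
  define c where "c = 1 / (\<gamma> * L2_set w {..<d})"
  have c: "0 < c" using w_pos \<gamma>(1) by (simp add: c_def)
  show ?thesis
  proof (rule that[of \<gamma> "\<lambda>j. c * w j" "c * b" X])
    show "0 < \<gamma>" by (rule \<gamma>(1))
    have "L2_set (\<lambda>j. c * w j) {..<d} = c * L2_set w {..<d}" using c by (simp add: L2_set_right_distrib)
    then show "\<gamma> * L2_set (\<lambda>j. c * w j) {..<d} \<le> 1" using w_pos \<gamma>(1) by (simp add: c_def)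
    show "AE z in D. hard_margin_feasible d {z} (\<lambda>j. c * w j) (c * b) \<and> snd z \<in> {-1, 1} \<and> fst z \<in> X"
      using ae lab inX
    proof eventually_elim
      fix z assume z: "linear_classifier d w b (fst z) = snd z" "snd z \<in> {-1, 1}" "fst z \<in> X"
      have "separates_sample d [z] w b" using z(1) by (simp add: separates_sample_def case_prod_unfold)
      moreover have "ereal \<gamma> \<le> sample_margin d [z] w b"
        using wb(2)[OF z(3)] by (simp add: sample_margin_def case_prod_unfold)
      ultimately show "hard_margin_feasible d {z} (\<lambda>j. c * w j) (c * b) \<and> snd z \<in> {-1, 1} \<and> fst z \<in> X"
        using hard_margin_feasible_if_margin[of d "[z]" w b \<gamma>] w_pos \<gamma>(1) z unfolding c_def by simp
    qed
    show "l2_dist d x x' \<le> \<rho> * \<gamma>" if "x \<in> X" "x' \<in> X" for x x'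
    proof -
      have "ereal (l2_dist d x x') \<le> l2_diam d X"
        unfolding l2_diam_def using that by (intro SUP_upper2[of x] SUP_upper2[of x']) auto
      also have "\<dots> \<le> ereal \<gamma> * ereal \<rho>"
        using \<gamma>(1,3) by (simp add: ereal_divide_le_pos)
      finally show ?thesis by (simp add: mult.commute)
    qed
  qed
qed

text \<open>Exchangeability: permuting coordinates preserves the product measure, so each of the
  \<open>n + 1\<close> points behaves like a fresh draw for the classifier trained on the others.
  The transposition of \<open>p\<close> and \<open>n\<close> moves point \<open>p\<close> out of the
  first \<open>n\<close> positions, the only ones that \<open>Q\<close> inspects.\<close>

lemma leave_one_out_nn_integral:
  fixes Q :: "(nat \<Rightarrow> 'a) \<Rightarrow> 'a \<Rightarrow> bool"
  assumes "prob_space D"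
    and Q: "\<And>f z. (\<And>i. i < n \<Longrightarrow> (\<lambda>T. f T i) \<in> (\<Pi>\<^sub>M i\<in>{..n}. D) \<rightarrow>\<^sub>M D) \<Longrightarrow> z \<in> (\<Pi>\<^sub>M i\<in>{..n}. D) \<rightarrow>\<^sub>M D \<Longrightarrow>
         Measurable.pred (\<Pi>\<^sub>M i\<in>{..n}. D) (\<lambda>T. Q (f T) (z T))"
    and Q': "\<And>S. S \<in> space (\<Pi>\<^sub>M i\<in>{..<n}. D) \<Longrightarrow> Measurable.pred D (Q S)"
    and Q_cong: "\<And>S S' z. (\<And>i. i < n \<Longrightarrow> S i = S' i) \<Longrightarrow> Q S z = Q S' z"
    and count: "AE T in (\<Pi>\<^sub>M i\<in>{..n}. D). real (card {p. p \<le> n \<and> Q (T \<circ> Transposition.transpose p n) (T p)}) \<le> B"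
  shows "of_nat (Suc n) * (\<integral>\<^sup>+ S. emeasure D {z \<in> space D. Q S z} \<partial>(\<Pi>\<^sub>M i\<in>{..<n}. D)) \<le> ennreal B"
proof -
  interpret D: prob_space D by fact
  interpret product_prob_space "\<lambda>_. D" "{..n}" by unfold_locales
  let ?M = "\<Pi>\<^sub>M i\<in>{..n}. D"
  have one: "emeasure ?M (space ?M) = 1"
    by (intro prob_space.emeasure_space_1 prob_space_PiM assms(1))
  let ?I = "\<integral>\<^sup>+ S. emeasure D {z \<in> space D. Q S z} \<partial>(\<Pi>\<^sub>M i\<in>{..<n}. D)"
  have meas: "(\<lambda>T. if Q (T \<circ> Transposition.transpose p n) (T p) then 1 else 0 :: ennreal) \<in> borel_measurable ?M" if "p \<le> n" for p
  proof -
    have "Transposition.transpose p n i \<le> n" if "i < n" for i using that \<open>p \<le> n\<close> by (simp add: Transposition.transpose_def)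
    then have "Measurable.pred ?M (\<lambda>T. Q (T \<circ> Transposition.transpose p n) (T p))"
      using that unfolding comp_def by (intro Q measurable_component_singleton) simp_all
    then show ?thesis by (intro measurable_If) auto
  qed
  have eq: "(\<integral>\<^sup>+ T. (if Q (T \<circ> Transposition.transpose p n) (T p) then 1 else 0) \<partial>?M) = ?I" if p: "p \<le> n" for p
  proof -
    let ?t = "\<lambda>T. \<lambda>i\<in>{..n}. T (Transposition.transpose p n i)"
    have tr: "Transposition.transpose p n i \<le> n" if "i \<le> n" for i using that p by (simp add: Transposition.transpose_def)
    have distr: "distr ?M ?M ?t = ?M"
    proof (rule distr_PiM_reindex)
      show "inj_on (Transposition.transpose p n) {..n}"
        by (rule inj_on_subset[OF Transposition.inj_transpose subset_UNIV])
      show "Transposition.transpose p n \<in> {..n} \<rightarrow> {..n}" using tr by blast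
    qed (rule assms(1))
    have t: "?t \<in> ?M \<rightarrow>\<^sub>M ?M"
      by (intro measurable_restrict measurable_component_singleton) (use tr in blast)
    have "(\<integral>\<^sup>+ T. (if Q T (T n) then 1 else 0) \<partial>?M) = (\<integral>\<^sup>+ T. (if Q T (T n) then 1 else 0) \<partial>distr ?M ?M ?t)"
      by (simp add: distr)
    also have "\<dots> = (\<integral>\<^sup>+ T. (if Q (?t T) (?t T n) then 1 else 0) \<partial>?M)"
      using meas[of n] by (subst nn_integral_distr[OF t]) (simp_all add: comp_def)
    also have "\<dots> = (\<integral>\<^sup>+ T. (if Q (T \<circ> Transposition.transpose p n) (T p) then 1 else 0) \<partial>?M)"
    proof (rule nn_integral_cong)
      fix T
      have "Q (?t T) (?t T n) = Q (T \<circ> Transposition.transpose p n) (?t T n)" by (rule Q_cong) simp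
      then show "(if Q (?t T) (?t T n) then 1 else 0 :: ennreal) = (if Q (T \<circ> Transposition.transpose p n) (T p) then 1 else 0)"
        by simp
    qed
    also have "(\<integral>\<^sup>+ T. (if Q T (T n) then 1 else 0) \<partial>?M) =
        (\<integral>\<^sup>+ T. (if Q T (T n) then 1 else 0) \<partial>(\<Pi>\<^sub>M i\<in>insert n {..<n}. D))"
      by (rule arg_cong[where f = "\<lambda>I. \<integral>\<^sup>+ T. (if Q T (T n) then 1 else 0) \<partial>(\<Pi>\<^sub>M i\<in>I. D)"]) auto
    also have "\<dots> = (\<integral>\<^sup>+ S. (\<integral>\<^sup>+ z. (if Q (S(n := z)) ((S(n := z)) n) then 1 else 0) \<partial>D) \<partial>(\<Pi>\<^sub>M i\<in>{..<n}. D))"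
    proof (rule product_nn_integral_insert)
      have "insert n {..<n} = {..n}" by auto
      then show "(\<lambda>T. if Q T (T n) then 1 else 0 :: ennreal) \<in> borel_measurable (\<Pi>\<^sub>M i\<in>insert n {..<n}. D)"
        using meas[of n] by (simp add: comp_def)
    qed auto
    also have "\<dots> = ?I"
    proof (rule nn_integral_cong)
      fix S assume S: "S \<in> space (\<Pi>\<^sub>M i\<in>{..<n}. D)"
      have "Q (S(n := z)) ((S(n := z)) n) = Q S z" for z
        unfolding fun_upd_same by (rule Q_cong) simp
      then have "(\<integral>\<^sup>+ z. (if Q (S(n := z)) ((S(n := z)) n) then 1 else 0) \<partial>D) =
          (\<integral>\<^sup>+ z. indicator {z \<in> space D. Q S z} z \<partial>D)"
        by (intro nn_integral_cong) (auto simp: indicator_def)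
      also have "\<dots> = emeasure D {z \<in> space D. Q S z}"
        using Q'[OF S] by (intro nn_integral_indicator) (simp add: pred_def)
      finally show "(\<integral>\<^sup>+ z. (if Q (S(n := z)) ((S(n := z)) n) then 1 else 0) \<partial>D) = emeasure D {z \<in> space D. Q S z}" .
    qed
    finally show ?thesis by (simp add: comp_def)
  qed
  have "of_nat (Suc n) * ?I = (\<Sum>p\<le>n. ?I)" by simp
  also have "\<dots> = (\<Sum>p\<le>n. \<integral>\<^sup>+ T. (if Q (T \<circ> Transposition.transpose p n) (T p) then 1 else 0) \<partial>?M)"
    by (intro sum.cong) (simp_all add: eq)
  also have "\<dots> = (\<integral>\<^sup>+ T. (\<Sum>p\<le>n. if Q (T \<circ> Transposition.transpose p n) (T p) then 1 else 0) \<partial>?M)"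
    by (rule nn_integral_sum[symmetric]) (simp add: meas)
  also have "\<dots> \<le> (\<integral>\<^sup>+ T. ennreal B \<partial>?M)"
  proof (rule nn_integral_mono_AE, use count in eventually_elim)
    fix T assume le: "real (card {p. p \<le> n \<and> Q (T \<circ> Transposition.transpose p n) (T p)}) \<le> B"
    have "(\<Sum>p\<le>n. if Q (T \<circ> Transposition.transpose p n) (T p) then 1 else 0 :: ennreal) = of_nat (card {p. p \<le> n \<and> Q (T \<circ> Transposition.transpose p n) (T p)})"
      by (subst sum.If_cases) (auto intro!: arg_cong[where f = card])
    also have "\<dots> = ennreal (real (card {p. p \<le> n \<and> Q (T \<circ> Transposition.transpose p n) (T p)}))"
      by (simp add: ennreal_of_nat_eq_real_of_nat)
    also have "\<dots> \<le> ennreal B" using le by (rule ennreal_leI)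
    finally show "(\<Sum>p\<le>n. if Q (T \<circ> Transposition.transpose p n) (T p) then 1 else 0) \<le> ennreal B" .
  qed
  also have "\<dots> = ennreal B" by (simp add: one)
  finally show ?thesis .
qed

lemma max_margin_expected_loss:
  assumes D: "D \<in> sep_class d p r \<rho>" and n: "0 < n" and \<rho>: "0 < \<rho>"
  shows "integrable (iid_samples n D) (\<lambda>S. std_loss (max_margin d (sample_list n S)) D)"
    and "(\<integral>S. std_loss (max_margin d (sample_list n S)) D \<partial>iid_samples n D) \<le> 2 * \<rho>\<^sup>2 / real n"
proof -
  obtain \<gamma> w b X where \<gamma>: "0 < \<gamma>" "\<gamma> * L2_set w {..<d} \<le> 1"
    and good: "AE z in D. hard_margin_feasible d {z} w b \<and> snd z \<in> {-1, 1} \<and> fst z \<in> X"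
    and X: "\<And>x x'. x \<in> X \<Longrightarrow> x' \<in> X \<Longrightarrow> l2_dist d x x' \<le> \<rho> * \<gamma>"
    using sep_class_margin[OF D] by blast
  have dist: "distribution d D" using D by (simp add: sep_class_def)
  interpret D: prob_space D using dist by (simp add: distribution_def)
  have sets[measurable_cong]: "sets D = sets (labelled d)" using dist by (simp add: distribution_def)
  have space: "space D = space (labelled d)" by (rule distribution_space[OF dist])
  have to_L: "f \<in> M \<rightarrow>\<^sub>M D \<longleftrightarrow> f \<in> M \<rightarrow>\<^sub>M labelled d" for f and M :: "'z measure"
    by (rule arg_cong[where f = "\<lambda>A. f \<in> A"], rule measurable_cong_sets) (simp_all add: sets)
  let ?M = "\<Pi>\<^sub>M i\<in>{..<n}. D"
  interpret M: prob_space ?M by (rule prob_space_PiM) (rule D.prob_space_axioms)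
  \<comment> \<open>The loss in terms of the measurable \<open>svm_mistake\<close>; it equals the
    true loss for almost every sample.\<close>
  define h where "h = (\<lambda>S. measure D {z \<in> space D. svm_mistake d n S z})"
  have good_PiM: "AE T in (\<Pi>\<^sub>M i\<in>I. D). \<forall>i\<in>I. hard_margin_feasible d {T i} w b \<and> snd (T i) \<in> {-1, 1} \<and> fst (T i) \<in> X"
    if "finite I" for I :: "nat set"
    by (intro AE_finite_allI that AE_PiM_component[where P = "\<lambda>z. hard_margin_feasible d {z} w b \<and> snd z \<in> {-1, 1} \<and> fst z \<in> X"])
      (use good D.prob_space_axioms in simp_all)
  have feas: "hard_margin_feasible d (T ` I) w b" if "\<forall>i\<in>I. hard_margin_feasible d {T i} w b" for T :: "nat \<Rightarrow> (nat \<Rightarrow> real) \<times> int" and I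
    using that by (auto simp: hard_margin_feasible_def)
  have comp: "(\<lambda>\<omega>. f \<omega> i) \<in> M' \<rightarrow>\<^sub>M labelled d" if "f \<in> M' \<rightarrow>\<^sub>M ?M" "i < n" for f i and M' :: "'z measure"
    by (rule measurable_compose[OF that(1)]) (simp add: that(2) flip: to_L)
  have mistake_D: "Measurable.pred D (svm_mistake d n S)" if "S \<in> space ?M" for S
  proof (rule pred_svm_mistake[OF n])
    show "(\<lambda>\<omega>. S i) \<in> D \<rightarrow>\<^sub>M labelled d" if "i < n" for i
      using \<open>S \<in> space ?M\<close> that by (intro measurable_const) (auto simp: space_PiM space simp flip: space)
    show "(\<lambda>\<omega>. \<omega>) \<in> D \<rightarrow>\<^sub>M labelled d" by (simp flip: to_L)
  qed
  have h: "h \<in> borel_measurable ?M"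
  proof -
    have "Measurable.pred (?M \<Otimes>\<^sub>M D) (\<lambda>\<omega>. svm_mistake d n (fst \<omega>) (snd \<omega>))"
    proof (rule pred_svm_mistake[OF n])
      show "(\<lambda>\<omega>. fst \<omega> i) \<in> ?M \<Otimes>\<^sub>M D \<rightarrow>\<^sub>M labelled d" if "i < n" for i
        by (rule comp[OF measurable_fst that])
      show "snd \<in> ?M \<Otimes>\<^sub>M D \<rightarrow>\<^sub>M labelled d" unfolding to_L[symmetric] by (rule measurable_snd)
    qed
    then have "{x \<in> space (?M \<Otimes>\<^sub>M D). snd x \<in> {z \<in> space D. svm_mistake d n (fst x) z}} \<in> sets (?M \<Otimes>\<^sub>M D)"
      unfolding pred_def by (rule back_subst[of "\<lambda>A. A \<in> sets (?M \<Otimes>\<^sub>M D)"]) (auto simp: space_pair_measure)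
    then have "(\<lambda>S. emeasure D {z \<in> space D. svm_mistake d n S z}) \<in> borel_measurable ?M"
      by (intro D.measurable_emeasure) auto
    then show ?thesis unfolding h_def measure_def by measurable
  qed
  have loss: "AE S in ?M. std_loss (max_margin d (sample_list n S)) D = h S"
    using good_PiM[OF finite_lessThan] AE_space
  proof (eventually_elim, goal_cases)
    case (1 S)
    then have good: "\<And>i. i < n \<Longrightarrow> snd (S i) \<in> {-1, 1}" "hard_margin_feasible d (S ` {..<n}) w b"
      by (auto intro!: feas)
    have "{(x, y) \<in> space D. max_margin d (sample_list n S) x \<noteq> y} = {z \<in> space D. svm_mistake d n S z}"
    proof -
      have "svm_mistake d n S z \<longleftrightarrow> max_margin d (sample_list n S) (fst z) \<noteq> snd z" if "z \<in> space D" for z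
        using that by (intro svm_mistake_iff[OF n good(1) _ good(2)]) (auto simp: space space_labelled)
      then show ?thesis by auto
    qed
    moreover have "{z \<in> space D. svm_mistake d n S z} \<in> sets D" using mistake_D[of S] 1 by (simp add: pred_def)
    ultimately show ?case by (simp add: std_loss_def h_def)
  qed
  have count: "AE T in (\<Pi>\<^sub>M i\<in>{..n}. D). real (card {p. p \<le> n \<and> svm_mistake d n (T \<circ> Transposition.transpose p n) (T p)}) \<le> 2 * \<rho>\<^sup>2"
    using good_PiM[of "{..n}", OF finite_atMost]
  proof eventually_elim
    fix T :: "nat \<Rightarrow> (nat \<Rightarrow> real) \<times> int"
    assume T: "\<forall>i\<in>{..n}. hard_margin_feasible d {T i} w b \<and> snd (T i) \<in> {-1, 1} \<and> fst (T i) \<in> X"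
    let ?t = "\<lambda>p. T \<circ> Transposition.transpose p n"
    have im: "?t p ` {..<n} = T ` ({..n} - {p})" if "p \<le> n" for p
    proof -
      have "Transposition.transpose p n ` {..<n} = {..n} - {p}"
      proof (intro set_eqI iffI)
        fix k assume "k \<in> {..n} - {p}"
        then show "k \<in> Transposition.transpose p n ` {..<n}"
          using that by (intro image_eqI[of _ _ "Transposition.transpose p n k"]) (auto simp: Transposition.transpose_def)
      qed (use that in \<open>auto simp: Transposition.transpose_def split: if_splits\<close>)
      then show ?thesis by (simp only: image_comp[symmetric])
    qed
    have fT: "hard_margin_feasible d (T ` {..n}) w b" by (rule feas) (use T in blast)
    have "svm_mistake d n (?t p) (T p) \<longleftrightarrow> max_margin d (sample_list n (?t p)) (fst (T p)) \<noteq> snd (T p)" if "p \<le> n" for p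
    proof (rule svm_mistake_iff[OF n])
      show "snd (?t p i) \<in> {-1, 1}" if "i < n" for i
        using T that \<open>p \<le> n\<close> by (auto simp: Transposition.transpose_def)
      show "snd (T p) \<in> {-1, 1}" using T that by blast
      show "hard_margin_feasible d (?t p ` {..<n}) w b"
        unfolding im[OF that] by (rule hard_margin_feasible_mono[OF fT]) auto
    qed
    then have eq: "{p. p \<le> n \<and> svm_mistake d n (?t p) (T p)} = {p. p \<le> n \<and> max_margin d (sample_list n (?t p)) (fst (T p)) \<noteq> snd (T p)}"
      by auto
    \<comment> \<open>With \<open>R = \<rho> * \<gamma>\<close> the margin cancels, which leaves the
      dimension-free bound \<open>2 * \<rho>\<^sup>2\<close>.\<close>
    have "real (card {p. p \<le> n \<and> svm_mistake d n (?t p) (T p)}) * \<gamma>\<^sup>2 \<le> 2 * (\<rho> * \<gamma>)\<^sup>2"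
      unfolding eq
    proof (rule leave_one_out_mistakes[OF n _ fT \<gamma>])
      show "snd (T i) \<in> {-1, 1}" if "i \<le> n" for i using T that by blast
      show "l2_dist d (fst (T i)) (fst (T k)) \<le> \<rho> * \<gamma>" if "i \<le> n" "k \<le> n" for i k
        by (rule X) (use T that in auto)
      show "set (sample_list n (?t p)) = T ` ({..n} - {p})" if "p \<le> n" for p
        unfolding set_sample_list by (rule im[OF that])
    qed
    then show "real (card {p. p \<le> n \<and> svm_mistake d n (?t p) (T p)}) \<le> 2 * \<rho>\<^sup>2"
      using \<gamma>(1) by (simp add: power_mult_distrib)
  qed
  have loo: "of_nat (Suc n) * (\<integral>\<^sup>+ S. emeasure D {z \<in> space D. svm_mistake d n S z} \<partial>?M) \<le> ennreal (2 * \<rho>\<^sup>2)"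
  proof (rule leave_one_out_nn_integral[OF D.prob_space_axioms _ mistake_D _ count])
    show "Measurable.pred (\<Pi>\<^sub>M i\<in>{..n}. D) (\<lambda>T. svm_mistake d n (f T) (z T))"
      if "\<And>i. i < n \<Longrightarrow> (\<lambda>T. f T i) \<in> (\<Pi>\<^sub>M i\<in>{..n}. D) \<rightarrow>\<^sub>M D" "z \<in> (\<Pi>\<^sub>M i\<in>{..n}. D) \<rightarrow>\<^sub>M D" for f z
      using that unfolding to_L by (rule pred_svm_mistake[OF n])
    show "svm_mistake d n S z = svm_mistake d n S' z" if "\<And>i. i < n \<Longrightarrow> S i = S' i" for S S' z
      by (rule svm_mistake_cong[OF n that])
  qed
  have h_int: "integrable ?M h"
    by (rule M.integrable_const_bound[OF _ h, of 1]) (simp add: h_def)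
  have "(\<integral>\<^sup>+ S. emeasure D {z \<in> space D. svm_mistake d n S z} \<partial>?M) = (\<integral>\<^sup>+ S. ennreal (h S) \<partial>?M)"
    by (simp add: h_def D.emeasure_eq_measure)
  also have "\<dots> = ennreal (\<integral>S. h S \<partial>?M)"
    by (rule nn_integral_eq_integral[OF h_int]) (simp add: h_def)
  finally have "ennreal (real (Suc n) * (\<integral>S. h S \<partial>?M)) \<le> ennreal (2 * \<rho>\<^sup>2)"
    using loo by (simp add: ennreal_mult' ennreal_of_nat_eq_real_of_nat del: of_nat_Suc)
  then have bound: "real (Suc n) * (\<integral>S. h S \<partial>?M) \<le> 2 * \<rho>\<^sup>2"
    by (subst (asm) ennreal_le_iff) simp_all
  have h_nonneg: "0 \<le> (\<integral>S. h S \<partial>?M)" by (rule integral_nonneg_AE) (simp add: h_def)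
  have hC: "h \<in> borel_measurable (iid_samples n D)"
    unfolding iid_samples_def by (rule measurable_completion[OF h])
  have lossC: "AE S in iid_samples n D. std_loss (max_margin d (sample_list n S)) D = h S"
    unfolding iid_samples_def by (rule AE_completion[OF loss])
  have lC: "(\<lambda>S. std_loss (max_margin d (sample_list n S)) D) \<in> borel_measurable (iid_samples n D)"
    using hC loss unfolding iid_samples_def by (rule measurable_completion_AE) simp
  show "integrable (iid_samples n D) (\<lambda>S. std_loss (max_margin d (sample_list n S)) D)"
    using integrable_cong_AE[OF lC hC lossC] h_int
    by (simp add: iid_samples_def integrable_completion[OF h])
  have "(\<integral>S. std_loss (max_margin d (sample_list n S)) D \<partial>iid_samples n D) = (\<integral>S. h S \<partial>?M)"
    using integral_cong_AE[OF lC hC lossC] by (simp add: iid_samples_def integral_completion[OF h])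
  \<comment> \<open>The argument yields the denominator \<open>n + 1\<close>; dropping one
    nonnegative term replaces it by \<open>n\<close>.\<close>
  moreover have "real n * (\<integral>S. h S \<partial>?M) \<le> 2 * \<rho>\<^sup>2"
    using bound h_nonneg by (simp add: algebra_simps)
  ultimately show "(\<integral>S. std_loss (max_margin d (sample_list n S)) D \<partial>iid_samples n D) \<le> 2 * \<rho>\<^sup>2 / real n"
    using n by (simp add: field_simps)
qed

section \<open>Finitely supported distributions\<close>

text \<open>Atoms are given by indices, so coinciding points merely add their weights and no
  injectivity has to be shown.\<close>

definition finite_dist :: "nat \<Rightarrow> nat \<Rightarrow> (nat \<Rightarrow> real) \<Rightarrow> (nat \<Rightarrow> (nat \<Rightarrow> real) \<times> int) \<Rightarrow> ((nat \<Rightarrow> real) \<times> int) measure" where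
  "finite_dist d K \<omega> \<phi> = distr (point_measure {..<K} (\<lambda>k. ennreal (\<omega> k))) (labelled d) \<phi>"

lemma singleton_labelled: "z \<in> space (labelled d) \<Longrightarrow> {z} \<in> sets (labelled d)"
proof -
  assume z: "z \<in> space (labelled d)"
  then have "fst z \<in> extensional {..<d}" by (auto simp: space_labelled)
  then have "{fst z} = PiE {..<d} (\<lambda>j. {fst z j})" by (simp add: PiE_singleton)
  moreover have "PiE {..<d} (\<lambda>j. {fst z j}) \<in> sets (Rvec d)"
    unfolding Rvec_def by (intro sets_PiM_I_finite) auto
  ultimately have "{fst z} \<times> {snd z} \<in> sets (labelled d)"
    unfolding labelled_def using z by (intro pair_measureI) (auto simp: space_labelled)
  then show ?thesis by (cases z) simp
qed

locale finite_distribution =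
  fixes d K :: nat and \<omega> :: "nat \<Rightarrow> real" and \<phi> :: "nat \<Rightarrow> (nat \<Rightarrow> real) \<times> int"
  assumes pos: "\<And>k. k < K \<Longrightarrow> 0 < \<omega> k" and sum_1: "(\<Sum>k<K. \<omega> k) = 1"
    and in_space: "\<And>k. k < K \<Longrightarrow> \<phi> k \<in> space (labelled d)"
begin

abbreviation "D \<equiv> finite_dist d K \<omega> \<phi>"

lemma sets_D [simp, measurable_cong]: "sets D = sets (labelled d)"
  by (simp add: finite_dist_def)

lemma space_D [simp]: "space D = space (labelled d)"
  by (simp add: finite_dist_def)

lemma emeasure_D:
  assumes "X \<in> sets (labelled d)"
  shows "emeasure D X = ennreal (\<Sum>k | k < K \<and> \<phi> k \<in> X. \<omega> k)"
proof -
  have "emeasure D X = emeasure (point_measure {..<K} (\<lambda>k. ennreal (\<omega> k))) (\<phi> -` X \<inter> {..<K})"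
    unfolding finite_dist_def using assms in_space
    by (subst emeasure_distr) (auto simp: space_point_measure)
  also have "\<dots> = (\<Sum>k\<in>\<phi> -` X \<inter> {..<K}. ennreal (\<omega> k))"
    by (rule emeasure_point_measure_finite) auto
  also have "\<phi> -` X \<inter> {..<K} = {k. k < K \<and> \<phi> k \<in> X}" by auto
  also have "(\<Sum>k | k < K \<and> \<phi> k \<in> X. ennreal (\<omega> k)) = ennreal (\<Sum>k | k < K \<and> \<phi> k \<in> X. \<omega> k)"
    using pos by (intro sum_ennreal) (auto simp: less_imp_le)
  finally show ?thesis .
qed

sublocale prob_space D
proof
  have "{k. k < K \<and> \<phi> k \<in> space (labelled d)} = {..<K}" using in_space by auto
  then show "emeasure D (space D) = 1" by (simp add: emeasure_D sum_1)
qed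

lemma distribution_D: "distribution d D"
  by (simp add: distribution_def prob_space_axioms)

lemma sum_nonneg_part: "0 \<le> (\<Sum>k | k < K \<and> P k. \<omega> k)"
  using pos by (intro sum_nonneg) (auto simp: less_imp_le)

lemma measure_D: "X \<in> sets (labelled d) \<Longrightarrow> measure D X = (\<Sum>k | k < K \<and> \<phi> k \<in> X. \<omega> k)"
  by (simp add: measure_def emeasure_D sum_nonneg_part)

lemma atoms_in_sets: "A \<subseteq> \<phi> ` {..<K} \<Longrightarrow> A \<in> sets (labelled d)"
proof -
  assume A: "A \<subseteq> \<phi> ` {..<K}"
  have "(\<Union>z\<in>A. {z}) \<in> sets (labelled d)"
    using A in_space finite_subset[OF A] by (intro sets.finite_UN singleton_labelled) auto
  then show ?thesis by simp
qed

lemma AE_atoms: "AE z in D. z \<in> \<phi> ` {..<K}"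
proof -
  have "prob (\<phi> ` {..<K}) = 1"
    by (subst measure_D[OF atoms_in_sets[OF subset_refl]])
      (simp add: sum_1[symmetric], intro sum.cong, auto)
  then show ?thesis by (intro AE_prob_1)
qed

text \<open>All mass sits on finitely many measurable atoms, so every set differs from a measurable
  one by a null set. This covers the error sets of arbitrary classifiers.\<close>

lemma measure_completion_D:
  assumes X: "X \<subseteq> space (labelled d)"
  shows "measure (completion D) X = (\<Sum>k | k < K \<and> \<phi> k \<in> X. \<omega> k)"
proof -
  let ?X = "X \<inter> \<phi> ` {..<K}"
  have X': "?X \<in> sets D" using atoms_in_sets[of ?X] by simp
  have ae: "AE z in completion D. z \<in> ?X \<longleftrightarrow> z \<in> X"
    using AE_completion[OF AE_atoms] by eventually_elim auto
  have "X \<in> sets (completion D)"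
    by (rule completion.in_sets_AE[OF ae]) (use X X' in auto)
  then have "measure (completion D) X = measure (completion D) ?X"
    using ae X' by (intro measure_eq_AE) auto
  also have "\<dots> = (\<Sum>k | k < K \<and> \<phi> k \<in> ?X. \<omega> k)"
    using X' by (simp add: measure_D del: Int_iff)
  also have "\<dots> = (\<Sum>k | k < K \<and> \<phi> k \<in> X. \<omega> k)" by (rule sum.cong) auto
  finally show ?thesis .
qed

lemma sum_part_eq_0_iff: "(\<Sum>k | k < K \<and> P k. \<omega> k) = 0 \<longleftrightarrow> (\<forall>k<K. \<not> P k)"
proof
  assume 0: "(\<Sum>k | k < K \<and> P k. \<omega> k) = 0"
  have "\<forall>k\<in>{k. k < K \<and> P k}. \<omega> k = 0"
    using 0 pos by (subst (asm) sum_nonneg_eq_0_iff) (auto simp: less_imp_le)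
  then show "\<forall>k<K. \<not> P k" using pos by fastforce
next
  assume "\<forall>k<K. \<not> P k"
  then have "{k. k < K \<and> P k} = {}" by auto
  then show "(\<Sum>k | k < K \<and> P k. \<omega> k) = 0" by (simp only: sum.empty)
qed

lemma robust_loss_D:
  "robust_loss d p r f D = (\<Sum>k | k < K \<and> (\<exists>x'\<in>lp_cball d p (fst (\<phi> k)) r. f x' \<noteq> snd (\<phi> k)). \<omega> k)"
proof -
  have "robust_loss d p r f D =
      (\<Sum>k | k < K \<and> \<phi> k \<in> {(x, y) \<in> space D. \<exists>x'\<in>lp_cball d p x r. f x' \<noteq> y}. \<omega> k)"
    unfolding robust_loss_def by (rule measure_completion_D) auto
  also have "\<dots> = (\<Sum>k | k < K \<and> (\<exists>x'\<in>lp_cball d p (fst (\<phi> k)) r. f x' \<noteq> snd (\<phi> k)). \<omega> k)"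
    by (rule sum.cong) (use in_space in \<open>auto simp: case_prod_unfold\<close>)
  finally show ?thesis .
qed

lemma std_loss_D_eq_0_iff: "std_loss f D = 0 \<longleftrightarrow> (\<forall>k<K. f (fst (\<phi> k)) = snd (\<phi> k))"
proof -
  have "std_loss f D = (\<Sum>k | k < K \<and> \<phi> k \<in> {(x, y) \<in> space D. f x \<noteq> y}. \<omega> k)"
    unfolding std_loss_def by (rule measure_completion_D) auto
  also have "\<dots> = (\<Sum>k | k < K \<and> f (fst (\<phi> k)) \<noteq> snd (\<phi> k). \<omega> k)"
    by (rule sum.cong) (use in_space in \<open>auto simp: case_prod_unfold\<close>)
  finally show ?thesis by (simp add: sum_part_eq_0_iff)
qed

lemma l2_dist_eq_0:
  assumes "x \<in> space (Rvec d)" "x' \<in> space (Rvec d)" "l2_dist d x x' = 0"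
  shows "x = x'"
proof (rule extensionalityI)
  show "x \<in> extensional {..<d}" "x' \<in> extensional {..<d}" using assms by (auto simp: space_Rvec)
  show "x j = x' j" if "j \<in> {..<d}" for j
    using assms(3) that by (auto simp: l2_dist_def L2_set_eq_0_iff)
qed

lemma support_part_D: "support_part d D y = {x. (x, y) \<in> \<phi> ` {..<K}}"
proof (intro set_eqI iffI)
  fix x assume x: "x \<in> support_part d D y"
  then have xs: "x \<in> space (Rvec d)" by (simp add: support_part_def)
  let ?B = "\<lambda>e. {(x', y') \<in> space D. l2_dist d x x' < e \<and> y' = y}"
  have B: "measure D (?B e) = (\<Sum>k | k < K \<and> \<phi> k \<in> ?B e. \<omega> k)" for e
  proof (rule measure_D)
    have "?B e = {z \<in> space (labelled d). l2_dist d x (fst z) < e \<and> snd z = y}" by auto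
    also have "\<dots> \<in> sets (labelled d)" by measurable
    finally show "?B e \<in> sets (labelled d)" .
  qed
  show "x \<in> {x. (x, y) \<in> \<phi> ` {..<K}}"
  proof (rule ccontr)
    assume n: "x \<notin> {x. (x, y) \<in> \<phi> ` {..<K}}"
    \<comment> \<open>The minimum of \<open>?E\<close> is a radius at which the ball around
      \<open>x\<close> contains no atom labelled \<open>y\<close>; the element \<open>1\<close>
      keeps the set nonempty.\<close>
    let ?E = "insert 1 ((\<lambda>k. l2_dist d x (fst (\<phi> k))) ` {k. k < K \<and> snd (\<phi> k) = y})"
    have E: "finite ?E" "?E \<noteq> {}" by auto
    have "0 < l2_dist d x (fst (\<phi> k))" if "k < K" "snd (\<phi> k) = y" for k
    proof -
      have "fst (\<phi> k) \<in> space (Rvec d)" using in_space[OF that(1)] by (auto simp: space_labelled space_Rvec)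
      moreover have "x \<noteq> fst (\<phi> k)" using n that by (auto intro!: image_eqI[of _ _ k])
      ultimately have "l2_dist d x (fst (\<phi> k)) \<noteq> 0" using l2_dist_eq_0[OF xs] by blast
      then show ?thesis using l2_dist_nonneg[of d x "fst (\<phi> k)"] by linarith
    qed
    then have "0 < Min ?E" using E by (subst Min_gr_iff) auto
    then have "0 < measure D (?B (Min ?E))"
      using x unfolding support_part_def by blast
    moreover have "\<phi> k \<notin> ?B (Min ?E)" if "k < K" for k
    proof
      assume "\<phi> k \<in> ?B (Min ?E)"
      then have y: "snd (\<phi> k) = y" "l2_dist d x (fst (\<phi> k)) < Min ?E" by (auto simp: case_prod_unfold)
      then have "Min ?E \<le> l2_dist d x (fst (\<phi> k))" using E(1) that by (intro Min_le) auto
      then show False using y by simp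
    qed
    then have "measure D (?B (Min ?E)) = 0" unfolding B sum_part_eq_0_iff by blast
    ultimately show False by simp
  qed
next
  fix x assume "x \<in> {x. (x, y) \<in> \<phi> ` {..<K}}"
  then obtain k where k: "k < K" "\<phi> k = (x, y)" by auto
  have sp: "(x, y) \<in> space D" using in_space[OF k(1)] k(2) by simp
  show "x \<in> support_part d D y"
    unfolding support_part_def
  proof (intro CollectI conjI allI impI)
    show "x \<in> space (Rvec d)" using sp by (auto simp: space_labelled space_Rvec)
    fix e :: real assume e: "0 < e"
    have eq: "{(x', y') \<in> space D. l2_dist d x x' < e \<and> y' = y} = {z \<in> space D. l2_dist d x (fst z) < e \<and> snd z = y}" by auto
    have ev: "{z \<in> space D. l2_dist d x (fst z) < e \<and> snd z = y} \<in> events" by measurable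
    have sub: "{(x, y)} \<subseteq> {z \<in> space D. l2_dist d x (fst z) < e \<and> snd z = y}"
      using sp e by (auto simp: l2_dist_def L2_set_def)
    have "prob {(x, y)} \<le> prob {(x', y') \<in> space D. l2_dist d x x' < e \<and> y' = y}"
      unfolding eq by (rule finite_measure_mono[OF sub ev])
    moreover have "prob {(x, y)} \<noteq> 0"
      using sp k by (subst measure_D) (auto simp: singleton_labelled sum_part_eq_0_iff)
    then have "0 < prob {(x, y)}" using measure_nonneg[of D "{(x, y)}"] by linarith
    ultimately show "0 < prob {(x', y') \<in> space D. l2_dist d x x' < e \<and> y' = y}" by linarith
  qed
qed

text \<open>For finite support the margin of \<open>D\<close> is the sample margin of the list of
  its atoms. The optimum of the quadratic program therefore attains it, and the feasible
  \<open>w0\<close> bounds it below by \<open>\<gamma>0\<close>.\<close>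

lemma sep_class_D:
  assumes robust: "\<And>k x'. k < K \<Longrightarrow> x' \<in> lp_cball d p (fst (\<phi> k)) r \<Longrightarrow> linear_classifier d w b x' = snd (\<phi> k)"
    and labels: "\<exists>k<K. snd (\<phi> k) = 1" "\<exists>k<K. snd (\<phi> k) = -1"
    and feas: "hard_margin_feasible d (\<phi> ` {..<K}) w0 b0"
    and \<gamma>0: "0 < \<gamma>0" "\<gamma>0 * L2_set w0 {..<d} \<le> 1"
    and near: "\<And>k. k < K \<Longrightarrow> L2_set (fst (\<phi> k)) {..<d} \<le> 10 * \<gamma>0" and \<rho>: "20 < \<rho>"
  shows "D \<in> sep_class d p r \<rho>"
proof -
  have "robust_loss d p r (linear_classifier d w b) D = 0"
    unfolding robust_loss_D sum_part_eq_0_iff using robust by blast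
  then have sep: "r_separated d p r D" unfolding r_separated_def by blast
  let ?L = "map \<phi> [0..<K]"
  have L: "set ?L = \<phi> ` {..<K}" by auto
  have "snd (\<phi> k) \<in> {-1, 1}" if "k < K" for k
    using in_space[OF that] by (simp add: space_labelled mem_Times_iff)
  then have lab: "snd ` set ?L \<subseteq> {-1, 1}" unfolding L image_image by blast
  have ne: "pos_part (set ?L) \<noteq> {}" "neg_part (set ?L) \<noteq> {}" using labels unfolding L by blast+
  obtain v c where vc: "svm_solution d (set ?L) v c"
    using svm_solution_exists[OF finite_set lab ne feas[folded L]] by blast
  note opt = is_max_margin_if_svm_solution[OF lab ne vc]
  define \<gamma> where "\<gamma> = 1 / L2_set v {..<d}"
  have support: "support_part d D 1 \<union> support_part d D (-1) = fst ` \<phi> ` {..<K}" (is "?S = _")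
  proof -
    have "{x. (x, 1) \<in> T} \<union> {x. (x, -1) \<in> T} = fst ` T" if "snd ` T \<subseteq> {-1, 1}" for T :: "((nat \<Rightarrow> real) \<times> int) set"
    proof (intro set_eqI iffI)
      fix x assume "x \<in> fst ` T"
      then obtain z where z: "z \<in> T" "x = fst z" by blast
      then have "snd z = 1 \<or> snd z = -1" using that by blast
      then show "x \<in> {x. (x, 1) \<in> T} \<union> {x. (x, -1) \<in> T}" using z by (cases z) auto
    next
      fix x assume "x \<in> {x. (x, 1) \<in> T} \<union> {x. (x, -1) \<in> T}"
      then obtain y where "(x, y) \<in> T" by blast
      then show "x \<in> fst ` T" by (rule image_eqI[rotated]) simp
    qed
    from this[OF lab[unfolded L]] show ?thesis unfolding support_part_D .
  qed
  have swm: "separates_with_margin d D g \<longleftrightarrow> (\<exists>w b. separates_sample d ?L w b \<and> ereal g \<le> sample_margin d ?L w b)" for g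
    unfolding separates_with_margin_def support std_loss_D_eq_0_iff separates_sample_def sample_margin_def L le_INF_iff
    by (simp add: case_prod_unfold, simp add: Ball_def)
  have "is_margin d D \<gamma>"
    unfolding is_margin_def swm
  proof (intro conjI allI impI)
    show "\<exists>w b. separates_sample d ?L w b \<and> ereal \<gamma> \<le> sample_margin d ?L w b"
      using opt(2,4) unfolding is_max_margin_def \<gamma>_def by blast
    fix g assume "\<exists>w b. separates_sample d ?L w b \<and> ereal g \<le> sample_margin d ?L w b"
    then have "ereal g \<le> ereal \<gamma>" using opt(3) unfolding \<gamma>_def by (blast intro: order_trans)
    then show "g \<le> \<gamma>" by simp
  qed
  moreover have "\<gamma>0 \<le> \<gamma>"
  proof -
    have "inner_prod d v v \<le> inner_prod d w0 w0" using vc feas unfolding svm_solution_def L by blast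
    then have "L2_set v {..<d} \<le> L2_set w0 {..<d}" unfolding L2_set_eq_sqrt_inner_prod by simp
    then have "\<gamma>0 * L2_set v {..<d} \<le> 1" using \<gamma>0 by (meson mult_left_mono less_imp_le order_trans)
    then show ?thesis using opt(1) by (simp add: \<gamma>_def field_simps)
  qed
  moreover have "l2_diam d ?S / ereal \<gamma> \<le> ereal \<rho>"
  proof -
    have "l2_diam d ?S \<le> ereal (20 * \<gamma>0)"
      unfolding l2_diam_def support
    proof (intro SUP_least)
      fix x x' assume "x \<in> fst ` \<phi> ` {..<K}" "x' \<in> fst ` \<phi> ` {..<K}"
      then have "L2_set x {..<d} \<le> 10 * \<gamma>0" "L2_set x' {..<d} \<le> 10 * \<gamma>0" using near by auto
      moreover have "l2_dist d x x' \<le> L2_set x {..<d} + L2_set (\<lambda>j. - x' j) {..<d}"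
        using L2_set_triangle_ineq[of x "\<lambda>j. - x' j" "{..<d}"] by (simp add: l2_dist_def)
      moreover have "L2_set (\<lambda>j. - x' j) {..<d} = L2_set x' {..<d}" by (simp add: L2_set_def)
      ultimately show "ereal (l2_dist d x x') \<le> ereal (20 * \<gamma>0)" by simp
    qed
    also have "\<dots> \<le> ereal \<gamma> * ereal \<rho>"
      using \<rho> \<gamma>0(1) \<open>\<gamma>0 \<le> \<gamma>\<close> mult_mono[of 20 \<rho> \<gamma>0 \<gamma>] by (simp add: mult.commute)
    finally show ?thesis using \<gamma>0(1) \<open>\<gamma>0 \<le> \<gamma>\<close> by (simp add: ereal_divide_le_pos)
  qed
  ultimately have "aspect_ratio_le d D \<rho>"
    unfolding aspect_ratio_le_def using \<gamma>0(1) by (intro exI[of _ \<gamma>]) auto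
  then show ?thesis unfolding sep_class_def using sep distribution_D by simp
qed

text \<open>The integrand is arbitrary because learners are: almost surely it agrees with a finite
  combination of indicators of singletons. Summing over index sequences instead of samples gives
  weights that do not depend on where the atoms lie.\<close>

lemma integral_iid_samples:
  fixes g :: "(nat \<Rightarrow> (nat \<Rightarrow> real) \<times> int) \<Rightarrow> real"
  shows "(\<integral>S. g S \<partial>iid_samples n D) =
    (\<Sum>J\<in>PiE {..<n} (\<lambda>_. {..<K}). (\<Prod>i<n. \<omega> (J i)) * g (\<lambda>i\<in>{..<n}. \<phi> (J i)))"
proof -
  let ?Q = "\<Pi>\<^sub>M i\<in>{..<n}. D" and ?T = "\<phi> ` {..<K}"
  let ?F = "PiE {..<n} (\<lambda>_. ?T)"
  interpret Q: finite_product_prob_space "\<lambda>_. D" "{..<n}" by unfold_locales auto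
  have F: "finite ?F" by (intro finite_PiE) auto
  have sing: "{s} = PiE {..<n} (\<lambda>i. {s i})" if "s \<in> ?F" for s
    using that by (intro PiE_singleton[symmetric]) (auto simp: PiE_def)
  have sing_sets: "{s i} \<in> sets D" if "s \<in> ?F" "i < n" for s i
    using atoms_in_sets[of "{s i}"] that by (auto simp: PiE_def Pi_def)
  have sets: "{s} \<in> sets ?Q" if "s \<in> ?F" for s
    unfolding sing[OF that] using sing_sets[OF that] by (intro sets_PiM_I_finite) auto
  have meas: "measure ?Q {s} = (\<Prod>i<n. measure D {s i})" if "s \<in> ?F" for s
    unfolding sing[OF that] using sing_sets[OF that] by (intro Q.finite_measure_PiM_emb) auto
  define g' where "g' = (\<lambda>S. \<Sum>s\<in>?F. g s * indicator {s} S)"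
  have g': "g' \<in> borel_measurable ?Q"
    unfolding g'_def using sets by (intro borel_measurable_sum borel_measurable_times borel_measurable_const borel_measurable_indicator)
  have "AE S in ?Q. \<forall>i\<in>{..<n}. S i \<in> ?T"
    by (intro AE_finite_allI AE_PiM_component[where P = "\<lambda>z. z \<in> ?T"]) (simp_all add: prob_space_axioms AE_atoms del: image_iff)
  then have ae: "AE S in ?Q. g S = g' S"
    using AE_space
  proof (eventually_elim, goal_cases)
    case (1 S)
    then have "S \<in> ?F" by (auto simp: space_PiM PiE_def)
    have "g' S = (\<Sum>s\<in>?F. if s = S then g s else 0)"
      unfolding g'_def by (rule sum.cong) (auto simp: indicator_def)
    also have "\<dots> = g S" using F \<open>S \<in> ?F\<close> by (simp only: sum.delta' sum.delta if_True)
    finally show ?case by simp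
  qed
  have "(\<integral>S. g S \<partial>iid_samples n D) = (\<integral>S. g' S \<partial>iid_samples n D)"
    unfolding iid_samples_def
    by (intro integral_cong_AE measurable_completion_AE[OF _ ae] measurable_completion[OF g'] AE_completion[OF ae]) auto
  also have "\<dots> = (\<integral>S. g' S \<partial>?Q)"
    unfolding iid_samples_def by (rule integral_completion[OF g'])
  also have "\<dots> = (\<Sum>s\<in>?F. g s * measure ?Q {s})"
    unfolding g'_def using sets
    by (subst Bochner_Integration.integral_sum) (auto simp: Q.emeasure_eq_measure)
  \<comment> \<open>Each possible sample collects all index sequences that produce it.\<close>
  also have "\<dots> = (\<Sum>s\<in>?F. \<Sum>J\<in>{J \<in> PiE {..<n} (\<lambda>_. {..<K}). (\<lambda>i\<in>{..<n}. \<phi> (J i)) = s}. (\<Prod>i<n. \<omega> (J i)) * g (\<lambda>i\<in>{..<n}. \<phi> (J i)))"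
  proof (rule sum.cong[OF refl])
    fix s assume s: "s \<in> ?F"
    have "measure ?Q {s} = (\<Prod>i<n. \<Sum>k | k < K \<and> \<phi> k \<in> {s i}. \<omega> k)"
      unfolding meas[OF s] using sing_sets[OF s] by (intro prod.cong measure_D) auto
    also have "\<dots> = (\<Sum>J\<in>PiE {..<n} (\<lambda>i. {k. k < K \<and> \<phi> k \<in> {s i}}). \<Prod>i<n. \<omega> (J i))"
      by (rule prod_sum_PiE) auto
    also have "PiE {..<n} (\<lambda>i. {k. k < K \<and> \<phi> k \<in> {s i}}) = {J \<in> PiE {..<n} (\<lambda>_. {..<K}). (\<lambda>i\<in>{..<n}. \<phi> (J i)) = s}"
      (is "?A = ?B")
    proof (intro set_eqI iffI)
      fix J assume J: "J \<in> ?A"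
      have J': "J i < K" "\<phi> (J i) = s i" if "i < n" for i
        using PiE_mem[OF J, of i] that by auto
      have "(\<lambda>i\<in>{..<n}. \<phi> (J i)) = s"
      proof (rule extensionalityI)
        show "s \<in> extensional {..<n}" using s by (simp add: PiE_def)
      qed (simp_all add: J')
      moreover have "J \<in> PiE {..<n} (\<lambda>_. {..<K})"
        using J J' by (simp add: PiE_iff)
      ultimately show "J \<in> ?B" by blast
    next
      fix J assume J: "J \<in> ?B"
      then have J': "J \<in> PiE {..<n} (\<lambda>_. {..<K})" "(\<lambda>i\<in>{..<n}. \<phi> (J i)) = s" by blast+
      have "\<phi> (J i) = s i" if "i < n" for i using that unfolding J'(2)[symmetric] by simp
      then show "J \<in> ?A" using J'(1) by (simp add: PiE_iff)
    qed
    finally have eq: "measure ?Q {s} = (\<Sum>J\<in>?B. \<Prod>i<n. \<omega> (J i))" .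
    have "g s * measure ?Q {s} = (\<Sum>J\<in>?B. (\<Prod>i<n. \<omega> (J i)) * g s)"
      unfolding eq sum_distrib_left by (rule sum.cong[OF refl mult.commute])
    also have "\<dots> = (\<Sum>J\<in>?B. (\<Prod>i<n. \<omega> (J i)) * g (\<lambda>i\<in>{..<n}. \<phi> (J i)))"
      by (rule sum.cong) auto
    finally show "g s * measure ?Q {s} = (\<Sum>J\<in>?B. (\<Prod>i<n. \<omega> (J i)) * g (\<lambda>i\<in>{..<n}. \<phi> (J i)))" .
  qed
  also have "\<dots> = (\<Sum>J\<in>PiE {..<n} (\<lambda>_. {..<K}). (\<Prod>i<n. \<omega> (J i)) * g (\<lambda>i\<in>{..<n}. \<phi> (J i)))"
    by (rule sum.group[OF _ F]) (auto intro: finite_PiE)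
  finally show ?thesis .
qed

end

section \<open>Hidden bits\<close>

definition label_of :: "nat set \<Rightarrow> nat \<Rightarrow> int" where
  "label_of B i = (if i \<in> B then 1 else -1)"

lemma label_of_cases: "label_of B i = 1 \<or> label_of B i = -1"
  by (simp add: label_of_def)

definition flip :: "nat \<Rightarrow> nat set \<Rightarrow> nat set" where
  "flip i B = (if i \<in> B then B - {i} else insert i B)"

lemma flip_flip [simp]: "flip i (flip i B) = B"
  by (auto simp: flip_def)

lemma label_of_flip: "label_of (flip i B) k = (if k = i then - label_of B k else label_of B k)"
  by (cases "i \<in> B"; cases "k = i"; simp add: flip_def label_of_def)

text \<open>Flipping one bit is an involution on the subsets of \<open>{..<d}\<close>.\<close>

lemma sum_Pow_flip:
  assumes "i < d"
  shows "(\<Sum>B\<in>Pow {..<d}. h (flip i B)) = (\<Sum>B\<in>Pow {..<d}. h B)"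
proof (rule sum.reindex_bij_betw)
  have "flip i B \<in> Pow {..<d}" if "B \<in> Pow {..<d}" for B
    using that assms by (auto simp: flip_def split: if_splits)
  then show "bij_betw (flip i) (Pow {..<d}) (Pow {..<d})"
    by (intro bij_betwI[where g = "flip i"]) auto
qed

text \<open>Atom \<open>i < d\<close> carries the hidden bit \<open>i \<in> B\<close>; the atoms \<open>d\<close> and \<open>d + 1\<close> make sure that both
  labels occur and carry the remaining mass.\<close>

definition hidden_weight :: "nat \<Rightarrow> real \<Rightarrow> nat \<Rightarrow> real" where
  "hidden_weight d q k = (if k < d then q else (1 - real d * q) / 2)"

definition hidden_point ::
    "nat \<Rightarrow> (nat \<Rightarrow> int \<Rightarrow> nat \<Rightarrow> real) \<Rightarrow> (int \<Rightarrow> nat \<Rightarrow> real) \<Rightarrow> nat set \<Rightarrow> nat \<Rightarrow> (nat \<Rightarrow> real) \<times> int" where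
  "hidden_point d X a B k =
     (if k < d then (X k (label_of B k), label_of B k) else if k = d then (a 1, 1) else (a (-1), -1))"

text \<open>Since \<open>q\<close> is at most \<open>1 / (2 * n)\<close>, an atom stays unseen with
  probability at least \<open>1 / 2\<close>; since it is at most \<open>1 / (2 * d)\<close>, mass
  remains for the two extra atoms. The factor \<open>1 / 8\<close> arises from the total hidden mass
  \<open>min 1 (d / n) / 2\<close>, the probability \<open>1 / 2\<close> of being unseen and the
  error rate \<open>1 / 2\<close> on an unseen bit.\<close>

lemma hidden_bits_lower_bound:
  assumes A: "A \<in> learning_algorithms d" and n: "0 < n" and d: "0 < d"
    and X: "\<And>i s. i < d \<Longrightarrow> s \<in> {-1, 1} \<Longrightarrow> X i s \<in> space (Rvec d)"
    and a: "\<And>s. s \<in> {-1, 1} \<Longrightarrow> a s \<in> space (Rvec d)"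
    and zs: "\<And>i. i < d \<Longrightarrow> zs i \<in> space (Rvec d)"
    and z: "\<And>i s. i < d \<Longrightarrow> s \<in> {-1, 1} \<Longrightarrow> zs i \<in> lp_cball d p (X i s) r"
  defines "q \<equiv> 1 / (2 * real (max n d))"
  shows "\<exists>B. 1 / 8 * min 1 (real d / real n) \<le>
      (\<integral>S. robust_loss d p r (A (sample_list n S)) (finite_dist d (d + 2) (hidden_weight d q) (hidden_point d X a B))
        \<partial>iid_samples n (finite_dist d (d + 2) (hidden_weight d q) (hidden_point d X a B)))"
proof -
  let ?w = "hidden_weight d q" and ?\<phi> = "hidden_point d X a" and ?K = "d + 2"
  let ?D = "\<lambda>B. finite_dist d ?K ?w (?\<phi> B)"
  let ?m = "real (max n d)"
  have m: "0 < ?m" "real n \<le> ?m" "real d \<le> ?m" using d by auto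
  have q: "0 < q" "real d * q \<le> 1 / 2" "real n * q \<le> 1 / 2" "q \<le> 1"
    using m d unfolding q_def by (auto simp: field_simps max_def)
  have w_pos: "0 < ?w k" for k using q by (auto simp: hidden_weight_def)
  have w_sum: "(\<Sum>k<?K. ?w k) = 1"
    by (simp add: hidden_weight_def numeral_2_eq_2 field_simps)
  have fd: "finite_distribution d ?K ?w (?\<phi> B)" for B
  proof
    show "?\<phi> B k \<in> space (labelled d)" for k
      using X a label_of_cases[of B k] by (auto simp: hidden_point_def space_labelled space_Rvec)
  qed (use w_pos w_sum in auto)
  \<comment> \<open>The index sequences and their weights are the same for all \<open>B\<close>;
    only the points depend on \<open>B\<close>. This permits averaging over \<open>B\<close> for a
    fixed sequence.\<close>
  define PJ where "PJ = (\<lambda>J. \<Prod>i<n. ?w (J i))"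
  let ?JJ = "PiE {..<n} (\<lambda>_. {..<?K})"
  define S where "S = (\<lambda>B J. sample_list n (\<lambda>i\<in>{..<n}. ?\<phi> B (J i)))"
  define E where "E = (\<lambda>B. \<Sum>J\<in>?JJ. PJ J * robust_loss d p r (A (S B J)) (?D B))"
  have E: "(\<integral>S. robust_loss d p r (A (sample_list n S)) (?D B) \<partial>iid_samples n (?D B)) = E B" for B
    unfolding E_def PJ_def S_def by (rule finite_distribution.integral_iid_samples[OF fd])
  have PJ_nonneg: "0 \<le> PJ J" for J unfolding PJ_def using w_pos by (intro prod_nonneg) (simp add: less_imp_le)
  define c where "c = (\<lambda>B J i. if A (S B J) (zs i) \<noteq> label_of B i then 1 else 0 :: real)"
  have label_in: "A (S B J) (zs i) \<in> {-1, 1}" if "J \<in> ?JJ" "i < d" for B J i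
  proof -
    have "?\<phi> B k \<in> space (labelled d)" if "k < ?K" for k using finite_distribution.in_space[OF fd that] .
    then have "S B J \<in> lists (space (labelled d))"
      using \<open>J \<in> ?JJ\<close> by (auto simp: S_def sample_list_def PiE_def Pi_def)
    then show ?thesis using A zs[OF that(2)] unfolding learning_algorithms_def by blast
  qed
  have loss: "(\<Sum>i<d. q * c B J i) \<le> robust_loss d p r (A (S B J)) (?D B)" for B J
  proof -
    let ?f = "A (S B J)"
    let ?Err = "{k. k < ?K \<and> (\<exists>x'\<in>lp_cball d p (fst (?\<phi> B k)) r. ?f x' \<noteq> snd (?\<phi> B k))}"
    have "(\<Sum>i<d. q * c B J i) = (\<Sum>i<d. if ?f (zs i) \<noteq> label_of B i then ?w i else 0)"
      by (rule sum.cong) (simp_all add: c_def hidden_weight_def)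
    also have "\<dots> = (\<Sum>i | i \<in> {..<d} \<and> ?f (zs i) \<noteq> label_of B i. ?w i)"
      by (rule sum.inter_filter[symmetric]) simp
    also have "\<dots> \<le> (\<Sum>k\<in>?Err. ?w k)"
    proof (rule sum_mono2)
      show "{i. i \<in> {..<d} \<and> ?f (zs i) \<noteq> label_of B i} \<subseteq> ?Err"
      proof (rule subsetI)
        fix i assume "i \<in> {i. i \<in> {..<d} \<and> ?f (zs i) \<noteq> label_of B i}"
        then have i: "i < d" and wrong: "?f (zs i) \<noteq> label_of B i" by simp_all
        have "label_of B i \<in> {-1, 1}" using label_of_cases[of B i] by auto
        from z[OF i this] have "\<exists>x'\<in>lp_cball d p (X i (label_of B i)) r. ?f x' \<noteq> label_of B i"
          using wrong by blast
        then show "i \<in> ?Err"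
          using i by (simp add: hidden_point_def)
      qed
    qed (use w_pos in \<open>auto simp: less_imp_le\<close>)
    also have "\<dots> = robust_loss d p r ?f (?D B)"
      by (rule finite_distribution.robust_loss_D[OF fd, symmetric])
    finally show ?thesis .
  qed
  let ?P = "Pow {..<d}"
  text \<open>The learner cannot see bit \<open>i\<close> when atom \<open>i\<close> is not in the sample, so exactly one of \<open>B\<close> and
    \<open>flip i B\<close> is misclassified at \<open>zs i\<close>.\<close>
  have half: "2 ^ d / 2 \<le> (\<Sum>B\<in>?P. c B J i)" if J: "J \<in> ?JJ" and i: "i < d" "i \<notin> J ` {..<n}" for J i
  proof -
    have "1 \<le> c B J i + c (flip i B) J i" for B
    proof -
      have "?\<phi> (flip i B) (J k) = ?\<phi> B (J k)" if "k < n" for k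
      proof -
        have "J k \<noteq> i" using i(2) that by blast
        then show ?thesis by (simp add: hidden_point_def label_of_flip)
      qed
      then have "S (flip i B) J = S B J" by (simp add: S_def sample_list_def)
      moreover have "label_of (flip i B) i \<noteq> label_of B i" using label_of_cases[of B i] by (auto simp: label_of_flip)
      ultimately show ?thesis by (auto simp: c_def)
    qed
    then have "(\<Sum>B\<in>?P. 1) \<le> (\<Sum>B\<in>?P. c B J i + c (flip i B) J i)" by (intro sum_mono)
    also have "\<dots> = 2 * (\<Sum>B\<in>?P. c B J i)"
      using sum_Pow_flip[OF i(1), of "\<lambda>B. c B J i"] by (simp add: sum.distrib)
    finally show ?thesis by (simp add: card_Pow)
  qed
  have unseen: "1 / 2 \<le> (\<Sum>J | J \<in> ?JJ \<and> i \<notin> J ` {..<n}. PJ J)" if i: "i < d" for i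
  proof -
    have "{J. J \<in> ?JJ \<and> i \<notin> J ` {..<n}} = PiE {..<n} (\<lambda>_. {..<?K} - {i})"
      by (auto simp: PiE_def Pi_def)
    then have "(\<Sum>J | J \<in> ?JJ \<and> i \<notin> J ` {..<n}. PJ J) = (\<Prod>k<n. \<Sum>j\<in>{..<?K} - {i}. ?w j)"
      unfolding PJ_def by (subst prod_sum_PiE) auto
    also have "(\<Sum>j\<in>{..<?K} - {i}. ?w j) = 1 - q"
      using w_sum i by (simp add: sum_diff1 hidden_weight_def)
    also have "(\<Prod>k<n. 1 - q) = (1 + (- q)) ^ n" by simp
    also have "\<dots> \<ge> 1 + real n * (- q)" using q by (intro Bernoulli_inequality) simp
    finally show ?thesis using q by simp
  qed
  have "2 ^ d * (1 / 8 * min 1 (real d / real n)) = 2 ^ d * (q * real d / 4)"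
    using m n d by (auto simp: q_def min_def max_def field_simps)
  also have "\<dots> = (\<Sum>i<d. q * (2 ^ d / 2 * (1 / 2)))" by simp
  also have "\<dots> \<le> (\<Sum>i<d. q * (2 ^ d / 2 * (\<Sum>J | J \<in> ?JJ \<and> i \<notin> J ` {..<n}. PJ J)))"
    using unseen q by (intro sum_mono mult_left_mono) auto
  also have "\<dots> = (\<Sum>i<d. \<Sum>J | J \<in> ?JJ \<and> i \<notin> J ` {..<n}. q * (PJ J * (2 ^ d / 2)))"
    by (simp add: sum_distrib_left mult_ac)
  also have "\<dots> \<le> (\<Sum>i<d. \<Sum>J | J \<in> ?JJ \<and> i \<notin> J ` {..<n}. q * (PJ J * (\<Sum>B\<in>?P. c B J i)))"
    using half q PJ_nonneg by (intro sum_mono mult_left_mono) auto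
  also have "\<dots> \<le> (\<Sum>i<d. \<Sum>J\<in>?JJ. q * (PJ J * (\<Sum>B\<in>?P. c B J i)))"
    using q PJ_nonneg by (intro sum_mono sum_mono2 finite_PiE mult_nonneg_nonneg sum_nonneg) (auto simp: c_def)
  also have "\<dots> = (\<Sum>i<d. \<Sum>J\<in>?JJ. \<Sum>B\<in>?P. PJ J * (q * c B J i))"
    by (simp add: sum_distrib_left mult_ac)
  also have "\<dots> = (\<Sum>J\<in>?JJ. \<Sum>B\<in>?P. \<Sum>i<d. PJ J * (q * c B J i))"
    by (subst sum.swap) (intro sum.cong refl sum.swap)
  also have "\<dots> = (\<Sum>B\<in>?P. \<Sum>J\<in>?JJ. PJ J * (\<Sum>i<d. q * c B J i))"
    by (subst sum.swap) (simp add: sum_distrib_left)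
  also have "\<dots> \<le> (\<Sum>B\<in>?P. E B)"
    unfolding E_def using PJ_nonneg loss by (intro sum_mono mult_left_mono) auto
  finally have avg: "2 ^ d * (1 / 8 * min 1 (real d / real n)) \<le> (\<Sum>B\<in>?P. E B)" .
  have "\<exists>B\<in>?P. 1 / 8 * min 1 (real d / real n) \<le> E B"
  proof (rule ccontr)
    assume "\<not> ?thesis"
    then have "(\<Sum>B\<in>?P. E B) < (\<Sum>B\<in>?P. 1 / 8 * min 1 (real d / real n))"
      by (intro sum_strict_mono) (auto simp: not_le)
    then show False using avg by (simp add: card_Pow)
  qed
  then show ?thesis unfolding E by blast
qed

section \<open>Sign designs\<close>

text \<open>The geometric input of the lower bound: \<open>X i s\<close> is the point of pair
  \<open>i\<close> with label \<open>s\<close>, \<open>zs i\<close> lies in both balls of the pair,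
  and \<open>a\<close> supplies the two extra points. One hyperplane separates all
  \<open>2 * d + 2\<close> points with Euclidean margin \<open>\<gamma>\<close>, which controls the
  aspect ratio; the robust separator may depend on the pattern \<open>B\<close>.\<close>

definition sign_design ::
    "nat \<Rightarrow> ereal \<Rightarrow> real \<Rightarrow> (nat \<Rightarrow> int \<Rightarrow> nat \<Rightarrow> real) \<Rightarrow> (int \<Rightarrow> nat \<Rightarrow> real) \<Rightarrow> (nat \<Rightarrow> nat \<Rightarrow> real) \<Rightarrow> real \<Rightarrow> bool" where
  "sign_design d p r X a zs \<gamma> \<longleftrightarrow> 0 < \<gamma> \<and>
     (\<forall>i<d. zs i \<in> space (Rvec d)) \<and>
     (\<forall>i<d. \<forall>s\<in>{-1, 1}. X i s \<in> space (Rvec d) \<and> zs i \<in> lp_cball d p (X i s) r \<and> L2_set (X i s) {..<d} \<le> 10 * \<gamma>) \<and>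
     (\<forall>s\<in>{-1, 1}. a s \<in> space (Rvec d) \<and> L2_set (a s) {..<d} \<le> 10 * \<gamma>) \<and>
     (\<exists>w b. \<gamma> * L2_set w {..<d} \<le> 1 \<and>
        (\<forall>i<d. \<forall>s\<in>{-1, 1}. 1 \<le> real_of_int s * (inner_prod d w (X i s) - b)) \<and>
        (\<forall>s\<in>{-1, 1}. 1 \<le> real_of_int s * (inner_prod d w (a s) - b))) \<and>
     (\<forall>B. \<exists>w b. (\<forall>i<d. \<forall>x'\<in>lp_cball d p (X i (label_of B i)) r. 0 < real_of_int (label_of B i) * (inner_prod d w x' - b)) \<and>
        (\<forall>s\<in>{-1, 1}. \<forall>x'\<in>lp_cball d p (a s) r. 0 < real_of_int s * (inner_prod d w x' - b)))"

lemma linear_classifier_eq_if_pos: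
  "y \<in> {-1, 1} \<Longrightarrow> 0 < real_of_int y * (inner_prod d w x - b) \<Longrightarrow> linear_classifier d w b x = y"
  by (auto simp: linear_classifier_def)

lemma sign_design_sep_class:
  assumes des: "sign_design d p r X a zs \<gamma>" and \<rho>: "20 < \<rho>" and w: "\<And>k. k < d + 2 \<Longrightarrow> 0 < \<omega> k" "(\<Sum>k<d + 2. \<omega> k) = 1"
  shows "finite_dist d (d + 2) \<omega> (hidden_point d X a B) \<in> sep_class d p r \<rho>"
proof -
  let ?\<phi> = "hidden_point d X a B"
  have lab: "label_of B i \<in> {-1, 1}" for i using label_of_cases[of B i] by auto
  from des have X: "\<And>i s. i < d \<Longrightarrow> s \<in> {-1, 1} \<Longrightarrow> X i s \<in> space (Rvec d) \<and> L2_set (X i s) {..<d} \<le> 10 * \<gamma>"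
    and a: "\<And>s. s \<in> {-1, 1} \<Longrightarrow> a s \<in> space (Rvec d) \<and> L2_set (a s) {..<d} \<le> 10 * \<gamma>"
    and \<gamma>: "0 < \<gamma>"
    unfolding sign_design_def by blast+
  from des obtain w0 b0 where w0: "\<gamma> * L2_set w0 {..<d} \<le> 1"
     "\<And>i s. i < d \<Longrightarrow> s \<in> {-1, 1} \<Longrightarrow> 1 \<le> real_of_int s * (inner_prod d w0 (X i s) - b0)"
     "\<And>s. s \<in> {-1, 1} \<Longrightarrow> 1 \<le> real_of_int s * (inner_prod d w0 (a s) - b0)"
    unfolding sign_design_def by blast
  from des have "\<exists>w b. (\<forall>i<d. \<forall>x'\<in>lp_cball d p (X i (label_of B i)) r. 0 < real_of_int (label_of B i) * (inner_prod d w x' - b)) \<and>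
        (\<forall>s\<in>{-1, 1}. \<forall>x'\<in>lp_cball d p (a s) r. 0 < real_of_int s * (inner_prod d w x' - b))"
    unfolding sign_design_def by blast
  then obtain w b where wb:
     "\<And>i x'. i < d \<Longrightarrow> x' \<in> lp_cball d p (X i (label_of B i)) r \<Longrightarrow> 0 < real_of_int (label_of B i) * (inner_prod d w x' - b)"
     "\<And>s x'. s \<in> {-1, 1} \<Longrightarrow> x' \<in> lp_cball d p (a s) r \<Longrightarrow> 0 < real_of_int s * (inner_prod d w x' - b)"
    by blast
  have snd_in: "snd (?\<phi> k) \<in> {-1, 1}" for k using lab by (simp add: hidden_point_def)
  \<comment> \<open>Case distinction over the three kinds of atoms, for any property of point and
    label.\<close>
  have all: "Q (fst (?\<phi> k)) (snd (?\<phi> k))"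
    if "\<And>i. i < d \<Longrightarrow> Q (X i (label_of B i)) (label_of B i)" "Q (a 1) 1" "Q (a (-1)) (-1)" for Q k
    using that by (simp add: hidden_point_def)
  interpret finite_distribution d "d + 2" \<omega> ?\<phi>
  proof
    have "fst (?\<phi> k) \<in> space (Rvec d)" for k
      by (rule all) (use X a lab in auto)
    then show "?\<phi> k \<in> space (labelled d)" for k
      using snd_in[of k] by (simp add: space_labelled space_Rvec mem_Times_iff)
  qed (use w in auto)
  show ?thesis
  proof (rule sep_class_D[OF _ _ _ _ \<gamma> w0(1) _ \<rho>])
    fix k x' assume "x' \<in> lp_cball d p (fst (?\<phi> k)) r"
    moreover have "\<forall>x'\<in>lp_cball d p (fst (?\<phi> k)) r. 0 < real_of_int (snd (?\<phi> k)) * (inner_prod d w x' - b)"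
      by (rule all) (use wb(1) wb(2)[of 1] wb(2)[of "-1"] in auto)
    ultimately show "linear_classifier d w b x' = snd (?\<phi> k)"
      using snd_in by (intro linear_classifier_eq_if_pos) auto
  next
    show "\<exists>k<d + 2. snd (?\<phi> k) = 1" by (intro exI[of _ d]) (simp add: hidden_point_def)
    show "\<exists>k<d + 2. snd (?\<phi> k) = -1" by (intro exI[of _ "d + 1"]) (simp add: hidden_point_def)
    have "1 \<le> real_of_int (snd (?\<phi> k)) * (inner_prod d w0 (fst (?\<phi> k)) - b0)" for k
      by (rule all) (use w0(2) w0(3)[of 1] w0(3)[of "-1"] lab in auto)
    then show "hard_margin_feasible d (?\<phi> ` {..<d + 2}) w0 b0"
      unfolding hard_margin_feasible_def by (metis (no_types, lifting) case_prod_unfold image_iff)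
    show "L2_set (fst (?\<phi> k)) {..<d} \<le> 10 * \<gamma>" for k
      by (rule all) (use X a lab in auto)
  qed
qed

lemma lower_bound_from_design:
  assumes des: "sign_design d p r X a zs \<gamma>" and A: "A \<in> learning_algorithms d"
    and n: "0 < n" and d: "0 < d" and \<rho>: "20 < \<rho>"
  shows "\<exists>D\<in>sep_class d p r \<rho>.
     1 / 8 * min 1 (real d / real n) \<le> (\<integral>S. robust_loss d p r (A (sample_list n S)) D \<partial>iid_samples n D)"
proof -
  define q where "q = 1 / (2 * real (max n d))"
  have "\<exists>B. 1 / 8 * min 1 (real d / real n) \<le>
      (\<integral>S. robust_loss d p r (A (sample_list n S)) (finite_dist d (d + 2) (hidden_weight d q) (hidden_point d X a B))
        \<partial>iid_samples n (finite_dist d (d + 2) (hidden_weight d q) (hidden_point d X a B)))"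
    unfolding q_def using des unfolding sign_design_def
    by (intro hidden_bits_lower_bound[OF A n d, where zs = zs]) blast+
  then obtain B where B: "1 / 8 * min 1 (real d / real n) \<le>
      (\<integral>S. robust_loss d p r (A (sample_list n S)) (finite_dist d (d + 2) (hidden_weight d q) (hidden_point d X a B))
        \<partial>iid_samples n (finite_dist d (d + 2) (hidden_weight d q) (hidden_point d X a B)))" ..
  have q: "0 < q" "real d * q < 1"
    using d by (auto simp: q_def field_simps max_def)
  have "finite_dist d (d + 2) (hidden_weight d q) (hidden_point d X a B) \<in> sep_class d p r \<rho>"
    using q by (intro sign_design_sep_class[OF des \<rho>]) (auto simp: hidden_weight_def numeral_2_eq_2 field_simps)
  with B show ?thesis by blast
qed

section \<open>Norm balls and the two sign designs\<close>

lemma lp_norm_infinity_le_iff: "0 < d \<Longrightarrow> lp_norm d \<infinity> v \<le> r \<longleftrightarrow> (\<forall>j<d. \<bar>v j\<bar> \<le> r)"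
  unfolding lp_norm_def by (simp, subst Max_le_iff) auto

lemma lp_norm_finite_le_iff:
  assumes p: "0 < p" and r: "0 \<le> r"
  shows "lp_norm d (ereal p) v \<le> r \<longleftrightarrow> (\<Sum>j<d. \<bar>v j\<bar> powr p) \<le> r powr p"
proof -
  let ?s = "\<Sum>j<d. \<bar>v j\<bar> powr p"
  have s: "0 \<le> ?s" by (intro sum_nonneg) auto
  then have *: "(?s powr (1 / p)) powr p = ?s" using p by (simp add: powr_powr)
  show ?thesis
  proof
    assume "lp_norm d (ereal p) v \<le> r"
    then have "(?s powr (1 / p)) powr p \<le> r powr p"
      using p by (intro powr_mono2) (auto simp: lp_norm_def)
    then show "?s \<le> r powr p" by (simp only: *)
  next
    assume "?s \<le> r powr p"
    then have "?s powr (1 / p) \<le> (r powr p) powr (1 / p)" using s p by (intro powr_mono2) auto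
    then show "lp_norm d (ereal p) v \<le> r" using r p by (simp add: lp_norm_def powr_powr)
  qed
qed

lemma inner_prod_single: "i < d \<Longrightarrow> inner_prod d w (\<lambda>j. if j = i then c else 0) = w i * c"
  by (simp add: inner_prod_def if_distrib[of "(*) _"] cong: if_cong)

lemma L2_set_single_le:
  fixes d :: nat
  shows "L2_set (\<lambda>j. if j = i then c else 0) {..<d} \<le> \<bar>c\<bar>"
proof -
  have "L2_set (\<lambda>j. if j = i then c else 0) {..<d} \<le> (\<Sum>j<d. \<bar>if j = i then c else 0\<bar>)"
    by (rule L2_set_le_sum_abs)
  also have "\<dots> = (\<Sum>j<d. if j = i then \<bar>c\<bar> else 0)" by (rule sum.cong) auto
  also have "\<dots> \<le> \<bar>c\<bar>" by (simp add: sum.delta)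
  finally show ?thesis .
qed

text \<open>For \<open>p = \<infinity>\<close> all points are shifted in the direction \<open>(1, ..., 1)\<close>. The \<open>\<ell>\<^sub>1\<close> norm is linear near that
  direction, so the normal vector can be tilted towards every sign pattern at no cost.\<close>

lemma sign_design_infinity:
  assumes d: "0 < d" and r: "0 < r"
  shows "\<exists>X a zs \<gamma>. sign_design d \<infinity> r X a zs \<gamma>"
proof -
  define e where "e = (\<lambda>i j::nat. if j = i then r else 0)"
  define zs where "zs = (\<lambda>i. restrict (e i) {..<d})"
  \<comment> \<open>The diagonal shift has sup norm \<open>r\<close>, so both balls of the pair
    reach \<open>zs i\<close>; the offset \<open>e i\<close> lets coordinate \<open>i\<close> of the
    normal vector distinguish pair \<open>i\<close>.\<close>
  define X where "X = (\<lambda>i (s::int). \<lambda>j\<in>{..<d}. e i j + real_of_int s * r)"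
  define a where "a = (\<lambda>s::int. \<lambda>j\<in>{..<d}. 3 * real_of_int s * r)"
  \<comment> \<open>Half the Euclidean distance within a pair, attained as margin by the diagonal
    normal vector.\<close>
  define \<gamma> where "\<gamma> = r * sqrt (real d)"
  have d1: "1 \<le> real d" using d by simp
  have \<gamma>: "0 < \<gamma>" using d r by (simp add: \<gamma>_def)
  have bound: "L2_set x {..<d} \<le> 10 * \<gamma>" if "\<And>j. j < d \<Longrightarrow> \<bar>x j\<bar> \<le> 3 * r" for x
  proof -
    have "L2_set x {..<d} = L2_set (\<lambda>j. \<bar>x j\<bar>) {..<d}" by (simp add: L2_set_def)
    also have "\<dots> \<le> L2_set (\<lambda>j. 3 * r) {..<d}" using that by (intro L2_set_mono) auto
    also have "\<dots> = 3 * \<gamma>" using r by (simp add: L2_set_constant \<gamma>_def)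
    finally show ?thesis using \<gamma> by simp
  qed
  have ip_X: "inner_prod d w (X i s) = w i * r + real_of_int s * r * (\<Sum>j<d. w j)" if "i < d" for w i s
  proof -
    have "inner_prod d w (X i s) = inner_prod d w (\<lambda>j. e i j + (real_of_int s * r) * 1)"
      by (rule inner_prod_cong) (simp_all add: X_def)
    also have "\<dots> = inner_prod d w (e i) + real_of_int s * r * inner_prod d w (\<lambda>j. 1)"
      by (simp only: inner_prod_right)
    also have "inner_prod d w (e i) = w i * r" unfolding e_def by (rule inner_prod_single[OF that])
    finally show ?thesis by (simp add: inner_prod_def)
  qed
  have ip_a: "inner_prod d w (a s) = 3 * real_of_int s * r * (\<Sum>j<d. w j)" for w s
  proof -
    have "inner_prod d w (a s) = inner_prod d w (\<lambda>j. (3 * real_of_int s * r) * 1)"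
      by (rule inner_prod_cong) (simp_all add: a_def)
    also have "\<dots> = 3 * real_of_int s * r * inner_prod d w (\<lambda>j. 1)" by (simp only: inner_prod_right)
    finally show ?thesis by (simp add: inner_prod_def)
  qed
  have "sign_design d \<infinity> r X a zs \<gamma>"
    unfolding sign_design_def
  proof (intro conjI allI impI ballI)
    show "0 < \<gamma>" by (rule \<gamma>)
    show "zs i \<in> space (Rvec d)" for i by (simp add: zs_def space_Rvec)
    show "X i s \<in> space (Rvec d)" for i s by (simp add: X_def space_Rvec)
    show "a s \<in> space (Rvec d)" for s by (simp add: a_def space_Rvec)
    show "zs i \<in> lp_cball d \<infinity> (X i s) r" if "s \<in> {-1, 1}" for i s
      using that r by (auto simp: lp_cball_def lp_norm_infinity_le_iff[OF d] zs_def X_def space_Rvec)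
    show "L2_set (X i s) {..<d} \<le> 10 * \<gamma>" if "s \<in> {-1, 1}" for i s
      using that r by (intro bound) (auto simp: X_def e_def)
    show "L2_set (a s) {..<d} \<le> 10 * \<gamma>" if "s \<in> {-1, 1}" for s
      using that r by (intro bound) (auto simp: a_def)
  next
    define w where "w = (\<lambda>_::nat. 1 / (r * real d))"
    have sw: "(\<Sum>j<d. w j) = 1 / r" using d r by (simp add: w_def)
    have L2: "\<gamma> * L2_set w {..<d} \<le> 1"
    proof -
      have "\<gamma> * L2_set w {..<d} = (sqrt (real d) * sqrt (real d)) * r * (1 / (r * real d))"
        using d r by (simp add: w_def L2_set_constant \<gamma>_def)
      also have "\<dots> = 1" using d r by simp
      finally show ?thesis by simp
    qed
    show "\<exists>w b. \<gamma> * L2_set w {..<d} \<le> 1 \<and>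
        (\<forall>i<d. \<forall>s\<in>{-1, 1}. 1 \<le> real_of_int s * (inner_prod d w (X i s) - b)) \<and>
        (\<forall>s\<in>{-1, 1}. 1 \<le> real_of_int s * (inner_prod d w (a s) - b))"
    proof (intro exI[of _ w] exI[of _ "1 / real d"] conjI allI impI ballI L2)
      fix i and s :: int assume i: "i < d" and s: "s \<in> {-1, 1}"
      have "inner_prod d w (X i s) = 1 / real d + real_of_int s"
        unfolding ip_X[OF i] sw using r by (simp add: w_def)
      then show "1 \<le> real_of_int s * (inner_prod d w (X i s) - 1 / real d)" using s by auto
    next
      fix s :: int assume s: "s \<in> {-1, 1}"
      have "inner_prod d w (a s) = 3 * real_of_int s" unfolding ip_a sw using r by simp
      moreover have "0 \<le> 1 / real d" "1 / real d \<le> 1" using d1 by simp_all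
      ultimately show "1 \<le> real_of_int s * (inner_prod d w (a s) - 1 / real d)" using s by auto
    qed
  next
    fix B
    \<comment> \<open>All weights are positive, so the reach of a ball is \<open>r\<close> times
      their sum and is exactly compensated by the diagonal shift. The entry \<open>1\<close>
      contributes the common level \<open>r\<close>, and the tilt moves pair \<open>i\<close> by
      \<open>r / 4\<close> to its own side.\<close>
    define w where "w = (\<lambda>j. 1 + real_of_int (label_of B j) / 4)"
    have w: "3 / 4 \<le> w j" for j using label_of_cases[of B j] by (auto simp: w_def)
    have pert: "\<bar>inner_prod d w x' - inner_prod d w x\<bar> \<le> r * (\<Sum>j<d. w j)" if "x' \<in> lp_cball d \<infinity> x r" for x x'
    proof -
      have v: "\<bar>x' j - x j\<bar> \<le> r" if "j < d" for j
        using \<open>x' \<in> lp_cball d \<infinity> x r\<close> that by (simp add: lp_cball_def lp_norm_infinity_le_iff[OF d])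
      have "\<bar>inner_prod d w x' - inner_prod d w x\<bar> = \<bar>\<Sum>j<d. w j * (x' j - x j)\<bar>"
        by (simp add: inner_prod_def sum_subtractf right_diff_distrib)
      also have "\<dots> \<le> (\<Sum>j<d. \<bar>w j * (x' j - x j)\<bar>)" by (rule sum_abs)
      also have "\<dots> \<le> (\<Sum>j<d. w j * r)"
      proof (rule sum_mono)
        fix j assume "j \<in> {..<d}"
        then have "w j * \<bar>x' j - x j\<bar> \<le> w j * r" using v w[of j] by (intro mult_left_mono) auto
        then show "\<bar>w j * (x' j - x j)\<bar> \<le> w j * r" using w[of j] by (simp add: abs_mult)
      qed
      finally show ?thesis by (simp add: sum_distrib_left mult.commute)
    qed
    have sw: "3 / 4 \<le> (\<Sum>j<d. w j)"
    proof -
      have "3 / 4 \<le> (\<Sum>j<d. 3 / 4 :: real)" using d1 by simp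
      also have "\<dots> \<le> (\<Sum>j<d. w j)" by (intro sum_mono w)
      finally show ?thesis .
    qed
    show "\<exists>w b. (\<forall>i<d. \<forall>x'\<in>lp_cball d \<infinity> (X i (label_of B i)) r. 0 < real_of_int (label_of B i) * (inner_prod d w x' - b)) \<and>
        (\<forall>s\<in>{-1, 1}. \<forall>x'\<in>lp_cball d \<infinity> (a s) r. 0 < real_of_int s * (inner_prod d w x' - b))"
    proof (intro exI[of _ w] exI[of _ r] conjI allI impI ballI)
      fix i x' assume i: "i < d" and x': "x' \<in> lp_cball d \<infinity> (X i (label_of B i)) r"
      have "w i * r + real_of_int (label_of B i) * r * (\<Sum>j<d. w j) =
          r + real_of_int (label_of B i) * (r / 4 + r * (\<Sum>j<d. w j))"
        by (simp add: w_def algebra_simps)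
      then have "\<bar>inner_prod d w x' - (r + real_of_int (label_of B i) * (r / 4 + r * (\<Sum>j<d. w j)))\<bar> \<le> r * (\<Sum>j<d. w j)"
        using pert[OF x'] unfolding ip_X[OF i] by simp
      then show "0 < real_of_int (label_of B i) * (inner_prod d w x' - r)"
        using label_of_cases[of B i] r by (auto simp: abs_le_iff)
    next
      fix s :: int and x' assume s: "s \<in> {-1, 1}" and x': "x' \<in> lp_cball d \<infinity> (a s) r"
      define t where "t = r * (\<Sum>j<d. w j)"
      \<comment> \<open>The level \<open>3 * t\<close> minus the reach \<open>t\<close> leaves
        \<open>2 * t\<close>, at least \<open>3 * r / 2\<close> and thus beyond the threshold
        \<open>r\<close>.\<close>
      have "r * (3 / 4) \<le> t" unfolding t_def using sw r by (intro mult_left_mono) auto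
      moreover have "\<bar>inner_prod d w x' - 3 * real_of_int s * t\<bar> \<le> t"
        using pert[OF x'] unfolding ip_a t_def by (simp add: mult.assoc)
      ultimately show "0 < real_of_int s * (inner_prod d w x' - r)"
        using s r by (auto simp: abs_le_iff)
    qed
  qed
  then show ?thesis by blast
qed

text \<open>A slightly tilted functional still has almost the norm of the first coordinate: a point of the \<open>\<ell>\<^sub>p\<close> ball
  with non-negligible other coordinates has a first coordinate bounded away from \<open>r\<close>.\<close>

lemma tilted_functional_bound:
  fixes d :: nat and p r :: real
  assumes p: "1 < p" and r: "0 < r" and d: "0 < d"
  obtains \<epsilon> :: real where "0 < \<epsilon>" "\<epsilon> < 1"
    "\<And>v. (\<Sum>j<d. \<bar>v j\<bar> powr p) \<le> r powr p \<Longrightarrow> \<bar>v 0\<bar> + 2 * \<epsilon> * (\<Sum>j\<in>{1..<d}. \<bar>v j\<bar>) < r + \<epsilon> * r"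
proof -
  \<comment> \<open>If the absolute values of the coordinates from \<open>1\<close> on sum to at
    least \<open>r / 2\<close>, one of them is at least \<open>s\<close>.\<close>
  define s where "s = r / (2 * real d)"
  have d1: "1 \<le> real d" using d by simp
  have s: "0 < s" "s \<le> r" using r d1 by (auto simp: s_def field_simps intro: order_trans[of _ "r * 1"] mult_left_mono)
  \<comment> \<open>The largest first coordinate compatible with another coordinate of absolute
    value at least \<open>s\<close>; it is smaller than \<open>r\<close>.\<close>
  define t where "t = (r powr p - s powr p) powr (1 / p)"
  have sp: "0 < s powr p" "s powr p \<le> r powr p" using s p by (auto intro!: powr_mono2)
  have "t < (r powr p) powr (1 / p)"
    unfolding t_def using p sp by (intro powr_less_mono2) auto
  also have "\<dots> = r" using r p by (simp add: powr_powr)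
  finally have t: "t < r" .
  have t0: "0 \<le> t" by (simp add: t_def)
  \<comment> \<open>Small enough that the tilt contributes at most \<open>(r - t) / 2\<close>, as
    every coordinate is bounded by \<open>r\<close>.\<close>
  define \<epsilon> where "\<epsilon> = (r - t) / (4 * real d * r)"
  have \<epsilon>: "0 < \<epsilon>" using t r d by (simp add: \<epsilon>_def)
  have \<epsilon>r: "\<epsilon> * (real d * r) = (r - t) / 4" using r d by (simp add: \<epsilon>_def)
  have "\<epsilon> * r \<le> \<epsilon> * (real d * r)" using \<epsilon> r d1 by (intro mult_left_mono) auto
  then have "\<epsilon> * r \<le> r / 4" using \<epsilon>r t0 by simp
  then have \<epsilon>1: "\<epsilon> < 1" using r by simp
  show ?thesis
  proof (rule that[OF \<epsilon> \<epsilon>1])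
    fix v :: "nat \<Rightarrow> real" assume v: "(\<Sum>j<d. \<bar>v j\<bar> powr p) \<le> r powr p"
    have vj: "\<bar>v j\<bar> \<le> r" if "j < d" for j
    proof -
      have "\<bar>v j\<bar> powr p \<le> (\<Sum>j<d. \<bar>v j\<bar> powr p)" using that by (intro member_le_sum) auto
      then have le: "\<bar>v j\<bar> powr p \<le> r powr p" using v by simp
      show ?thesis
      proof (rule ccontr)
        assume "\<not> \<bar>v j\<bar> \<le> r"
        then have "r powr p < \<bar>v j\<bar> powr p" using r p by (intro powr_less_mono2) auto
        then show False using le by simp
      qed
    qed
    let ?S = "\<Sum>j\<in>{1..<d}. \<bar>v j\<bar>"
    show "\<bar>v 0\<bar> + 2 * \<epsilon> * ?S < r + \<epsilon> * r"
    proof (cases "?S < r / 2")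
      case True
      then have "\<epsilon> * (2 * ?S) < \<epsilon> * r" using \<epsilon> by (intro mult_strict_left_mono) auto
      then show ?thesis using vj[OF d] by simp
    next
      case False
      have "\<exists>j\<in>{1..<d}. s \<le> \<bar>v j\<bar>"
      proof (rule ccontr)
        assume "\<not> ?thesis"
        then have "?S \<le> (\<Sum>j\<in>{1..<d}. s)" by (intro sum_mono) (auto simp: not_le less_imp_le)
        also have "\<dots> = (real d - 1) * s" using d by (simp add: of_nat_diff)
        also have "\<dots> < real d * s" using s by (simp add: algebra_simps)
        also have "\<dots> = r / 2" using d by (simp add: s_def)
        finally show False using False by simp
      qed
      then obtain j where j: "j \<in> {1..<d}" "s \<le> \<bar>v j\<bar>" by blast
      have "\<bar>v 0\<bar> powr p + \<bar>v j\<bar> powr p = (\<Sum>i\<in>{0, j}. \<bar>v i\<bar> powr p)" using j by auto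
      also have "\<dots> \<le> (\<Sum>i<d. \<bar>v i\<bar> powr p)" using j d by (intro sum_mono2) auto
      finally have "\<bar>v 0\<bar> powr p + \<bar>v j\<bar> powr p \<le> r powr p" using v by simp
      moreover have "s powr p \<le> \<bar>v j\<bar> powr p" using j s p by (intro powr_mono2) auto
      ultimately have "\<bar>v 0\<bar> powr p \<le> r powr p - s powr p" by simp
      then have "(\<bar>v 0\<bar> powr p) powr (1 / p) \<le> t" unfolding t_def using p by (intro powr_mono2) auto
      then have v0: "\<bar>v 0\<bar> \<le> t" using p by (simp add: powr_powr)
      have "?S \<le> (\<Sum>j\<in>{1..<d}. r)" using vj by (intro sum_mono) auto
      also have "\<dots> \<le> real d * r" using r d by (simp add: of_nat_diff)
      finally have "2 * \<epsilon> * ?S \<le> 2 * (\<epsilon> * (real d * r))" using \<epsilon> mult_left_mono[of ?S "real d * r" \<epsilon>] by simp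
      then have "\<bar>v 0\<bar> + 2 * \<epsilon> * ?S \<le> t + (r - t) / 2" using v0 \<epsilon>r by linarith
      also have "\<dots> < r"
        using t unfolding diff_divide_distrib by linarith
      also have "r < r + \<epsilon> * r" using mult_pos_pos[OF \<epsilon> r] by simp
      finally show ?thesis .
    qed
  qed
qed

text \<open>Labels are separated in coordinate \<open>0\<close>, and pair \<open>i\<close> is marked
  by \<open>r\<close> in coordinate \<open>i\<close>, so that \<open>w i\<close> can tilt towards
  its label. Pair \<open>0\<close> has no further coordinate of its own and is served by the
  threshold \<open>b\<close>.\<close>

lemma sign_design_finite:
  assumes d: "0 < d" and r: "0 < r" and p: "1 < p"
  shows "\<exists>X a zs \<gamma>. sign_design d (ereal p) r X a zs \<gamma>"
proof -
  define zs where "zs = (\<lambda>i. \<lambda>j\<in>{..<d}. if j = i \<and> i \<noteq> 0 then r else 0)"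
  define X where "X = (\<lambda>i (s::int). \<lambda>j\<in>{..<d}. if j = 0 then real_of_int s * r else if j = i then r else 0)"
  define a where "a = (\<lambda>s::int. \<lambda>j\<in>{..<d}. if j = 0 then 3 * real_of_int s * r else 0)"
  obtain \<epsilon> where \<epsilon>: "0 < \<epsilon>" "\<epsilon> < 1"
    and tilt: "\<And>v. (\<Sum>j<d. \<bar>v j\<bar> powr p) \<le> r powr p \<Longrightarrow> \<bar>v 0\<bar> + 2 * \<epsilon> * (\<Sum>j\<in>{1..<d}. \<bar>v j\<bar>) < r + \<epsilon> * r"
    using tilted_functional_bound[OF p r d] by metis
  have X_eq: "inner_prod d w (X i s) = w 0 * (real_of_int s * r) + (if i = 0 then 0 else w i * r)" if i: "i < d" for w i s
  proof -
    have "inner_prod d w (X i s) = inner_prod d w (\<lambda>j. (if j = 0 then real_of_int s * r else 0) + (if j = i then if i = 0 then 0 else r else 0))"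
      by (rule inner_prod_cong) (simp_all add: X_def)
    also have "\<dots> = w 0 * (real_of_int s * r) + w i * (if i = 0 then 0 else r)"
      by (simp only: inner_prod_add_right inner_prod_single d i)
    finally show ?thesis by simp
  qed
  have a_eq: "inner_prod d w (a s) = w 0 * (3 * real_of_int s * r)" for w s
  proof -
    have "inner_prod d w (a s) = inner_prod d w (\<lambda>j. if j = 0 then 3 * real_of_int s * r else 0)"
      by (rule inner_prod_cong) (simp_all add: a_def)
    then show ?thesis by (simp only: inner_prod_single d)
  qed
  have "sign_design d (ereal p) r X a zs r"
    unfolding sign_design_def
  proof (intro conjI allI impI ballI)
    show "0 < r" by (rule r)
    show "zs i \<in> space (Rvec d)" for i by (simp add: zs_def space_Rvec)
    show "X i s \<in> space (Rvec d)" for i s by (simp add: X_def space_Rvec)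
    show "a s \<in> space (Rvec d)" for s by (simp add: a_def space_Rvec)
    show "zs i \<in> lp_cball d (ereal p) (X i s) r" if i: "i < d" and s: "s \<in> {-1, 1}" for i s
    proof -
      have "(\<Sum>j<d. \<bar>zs i j - X i s j\<bar> powr p) = (\<Sum>j<d. if j = 0 then r powr p else 0)"
        by (rule sum.cong) (use s r in \<open>auto simp: zs_def X_def\<close>)
      also have "\<dots> = r powr p" using d by simp
      finally have "lp_norm d (ereal p) (\<lambda>j. zs i j - X i s j) \<le> r"
        using p r by (subst lp_norm_finite_le_iff) auto
      then show ?thesis by (simp add: lp_cball_def zs_def space_Rvec)
    qed
    show "L2_set (X i s) {..<d} \<le> 10 * r" if "s \<in> {-1, 1}" for i s
    proof -
      have "L2_set (X i s) {..<d} = L2_set (\<lambda>j. (if j = 0 then real_of_int s * r else 0) + (if j = i then if i = 0 then 0 else r else 0)) {..<d}"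
        by (rule L2_set_cong) (simp_all add: X_def)
      also have "\<dots> \<le> \<bar>real_of_int s * r\<bar> + \<bar>if i = 0 then 0 else r\<bar>"
        by (rule order_trans[OF L2_set_triangle_ineq]) (intro add_mono L2_set_single_le)
      also have "\<dots> \<le> 10 * r" using that r by auto
      finally show ?thesis .
    qed
    show "L2_set (a s) {..<d} \<le> 10 * r" if "s \<in> {-1, 1}" for s
    proof -
      have "L2_set (a s) {..<d} = L2_set (\<lambda>j. if j = 0 then 3 * real_of_int s * r else 0) {..<d}"
        by (rule L2_set_cong) (simp_all add: a_def)
      also have "\<dots> \<le> \<bar>3 * real_of_int s * r\<bar>" by (rule L2_set_single_le)
      also have "\<dots> \<le> 10 * r" using that r by auto
      finally show ?thesis .
    qed
  next
    define w where "w = (\<lambda>j::nat. if j = 0 then 1 / r else 0)"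
    have "r * L2_set w {..<d} \<le> r * \<bar>1 / r\<bar>"
      unfolding w_def using r by (intro mult_left_mono L2_set_single_le) auto
    then have L2: "r * L2_set w {..<d} \<le> 1" using r by simp
    show "\<exists>w b. r * L2_set w {..<d} \<le> 1 \<and>
        (\<forall>i<d. \<forall>s\<in>{-1, 1}. 1 \<le> real_of_int s * (inner_prod d w (X i s) - b)) \<and>
        (\<forall>s\<in>{-1, 1}. 1 \<le> real_of_int s * (inner_prod d w (a s) - b))"
      using L2 r by (intro exI[of _ w] exI[of _ 0]) (auto simp: X_eq a_eq w_def)
  next
    fix B
    let ?s = "\<lambda>j. real_of_int (label_of B j)"
    \<comment> \<open>Subtracting \<open>?s 0\<close> cancels the effect of the threshold on the
      other pairs, so that every chosen point ends up \<open>r + \<epsilon> * r\<close> beyond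
      \<open>b\<close> on its own side. The entries are at most \<open>2 * \<epsilon>\<close> in
      absolute value, hence the factor \<open>2\<close> in the tilt bound.\<close>
    define w where "w = (\<lambda>j. if j = 0 then 1 else \<epsilon> * (?s j - ?s 0))"
    define b where "b = - (\<epsilon> * ?s 0 * r)"
    have sj: "?s j = 1 \<or> ?s j = -1" for j using label_of_cases[of B j] by auto
    have pert: "\<bar>inner_prod d w x' - inner_prod d w x\<bar> < r + \<epsilon> * r" if x': "x' \<in> lp_cball d (ereal p) x r" for x x'
    proof -
      let ?v = "\<lambda>j. x' j - x j"
      have "(\<Sum>j<d. \<bar>?v j\<bar> powr p) \<le> r powr p"
        using x' p r by (simp add: lp_cball_def lp_norm_finite_le_iff)
      note t = tilt[OF this]
      have "\<bar>inner_prod d w x' - inner_prod d w x\<bar> = \<bar>\<Sum>j<d. w j * ?v j\<bar>"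
        by (simp add: inner_prod_def sum_subtractf right_diff_distrib)
      also have "(\<Sum>j<d. w j * ?v j) = ?v 0 + (\<Sum>j\<in>{1..<d}. w j * ?v j)"
        using d by (simp add: lessThan_atLeast0 sum.atLeast_Suc_lessThan w_def)
      also have "\<bar>\<dots>\<bar> \<le> \<bar>?v 0\<bar> + (\<Sum>j\<in>{1..<d}. \<bar>w j * ?v j\<bar>)"
        by (rule order_trans[OF abs_triangle_ineq]) (intro add_left_mono sum_abs)
      also have "(\<Sum>j\<in>{1..<d}. \<bar>w j * ?v j\<bar>) \<le> (\<Sum>j\<in>{1..<d}. 2 * \<epsilon> * \<bar>?v j\<bar>)"
      proof (rule sum_mono)
        fix j assume "j \<in> {1..<d}"
        then have "\<bar>w j\<bar> \<le> 2 * \<epsilon>" using sj[of j] sj[of 0] \<epsilon> by (auto simp: w_def)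
        then show "\<bar>w j * ?v j\<bar> \<le> 2 * \<epsilon> * \<bar>?v j\<bar>" unfolding abs_mult by (intro mult_right_mono) auto
      qed
      also have "\<dots> = 2 * \<epsilon> * (\<Sum>j\<in>{1..<d}. \<bar>?v j\<bar>)" by (simp add: sum_distrib_left)
      finally show ?thesis using t by simp
    qed
    have \<epsilon>r: "0 < \<epsilon> * r" "\<epsilon> * r < r" using \<epsilon> r by auto
    show "\<exists>w b. (\<forall>i<d. \<forall>x'\<in>lp_cball d (ereal p) (X i (label_of B i)) r. 0 < ?s i * (inner_prod d w x' - b)) \<and>
        (\<forall>s\<in>{-1, 1}. \<forall>x'\<in>lp_cball d (ereal p) (a s) r. 0 < real_of_int s * (inner_prod d w x' - b))"
    proof (intro exI[of _ w] exI[of _ b] conjI allI impI ballI)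
      fix i x' assume i: "i < d" and x': "x' \<in> lp_cball d (ereal p) (X i (label_of B i)) r"
      have "inner_prod d w (X i (label_of B i)) - b = ?s i * (r + \<epsilon> * r)"
        unfolding X_eq[OF i] by (auto simp: w_def b_def algebra_simps)
      then have "\<bar>(inner_prod d w x' - b) - ?s i * (r + \<epsilon> * r)\<bar> < r + \<epsilon> * r" using pert[OF x'] by simp
      then show "0 < ?s i * (inner_prod d w x' - b)"
        using sj[of i] by (auto simp: abs_less_iff)
    next
      fix s :: int and x' assume s: "s \<in> {-1, 1}" and x': "x' \<in> lp_cball d (ereal p) (a s) r"
      have "inner_prod d w (a s) = 3 * real_of_int s * r" by (simp add: a_eq w_def)
      then have "\<bar>inner_prod d w x' - 3 * real_of_int s * r\<bar> < r + \<epsilon> * r" using pert[OF x'] by simp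
      moreover have "\<bar>b\<bar> = \<epsilon> * r" using sj[of 0] \<epsilon> r by (auto simp: b_def abs_mult)
      ultimately show "0 < real_of_int s * (inner_prod d w x' - b)"
        using s \<epsilon>r by (auto simp: abs_if split: if_splits)
    qed
  qed
  then show ?thesis by blast
qed

text \<open>A loss is at most \<open>1\<close>, so the rate \<open>d / n\<close> has to be capped
  there. Integrability accompanies the upper bound because the integral of a non-integrable function
  is \<open>0\<close>; the positive lower bound excludes that case by itself.\<close>

theorem theorem14:
  shows "(\<exists>c::real. c > 0 \<and>
      (\<forall>(p::ereal) (r::real) (\<rho>::real) (d::nat).
         1 < p \<longrightarrow> 0 < r \<longrightarrow> 20 < \<rho> \<longrightarrow> 0 < d \<longrightarrow>
         (\<forall>A \<in> learning_algorithms d. \<forall>n::nat. 0 < n \<longrightarrow>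
            (\<exists>D \<in> sep_class d p r \<rho>.
               (\<integral>S. robust_loss d p r (A (sample_list n S)) D \<partial>iid_samples n D)
                 \<ge> c * min 1 (real d / real n)))))
    \<and> (\<exists>c'::real. c' > 0 \<and>
      (\<forall>(p::ereal) (r::real) (\<rho>::real) (d::nat).
         1 < p \<longrightarrow> 0 < r \<longrightarrow> 20 < \<rho> \<longrightarrow> 0 < d \<longrightarrow>
         (\<forall>D \<in> sep_class d p r \<rho>. \<forall>n::nat. 0 < n \<longrightarrow>
            integrable (iid_samples n D) (\<lambda>S. std_loss (max_margin d (sample_list n S)) D) \<and>
            (\<integral>S. std_loss (max_margin d (sample_list n S)) D \<partial>iid_samples n D)
              \<le> c' * \<rho>\<^sup>2 / real n)))"
proof (rule conjI, goal_cases)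
  case 1
  show ?case
  proof (rule exI[of _ "1 / 8"], intro conjI allI impI ballI)
    fix p :: ereal and r \<rho> :: real and d n :: nat and A
    assume p: "1 < p" and r: "0 < r" and \<rho>: "20 < \<rho>" and d: "0 < d"
      and A: "A \<in> learning_algorithms d" and n: "0 < n"
    have "\<exists>X a zs \<gamma>. sign_design d p r X a zs \<gamma>"
    proof (cases p)
      case (real p')
      then have "1 < p'" using p by (simp add: one_ereal_def)
      then show ?thesis using sign_design_finite[OF d r] real by simp
    qed (use p sign_design_infinity[OF d r] in auto)
    then show "\<exists>D\<in>sep_class d p r \<rho>.
       1 / 8 * min 1 (real d / real n) \<le> (\<integral>S. robust_loss d p r (A (sample_list n S)) D \<partial>iid_samples n D)"
      using lower_bound_from_design[OF _ A n d \<rho>] by blast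
  qed simp
next
  case 2
  show ?case
  proof (rule exI[of _ 2], intro conjI allI impI ballI)
    fix p :: ereal and r \<rho> :: real and d n :: nat and D
    assume *: "20 < \<rho>" "D \<in> sep_class d p r \<rho>" "0 < n"
    from * show "integrable (iid_samples n D) (\<lambda>S. std_loss (max_margin d (sample_list n S)) D)"
      by (intro max_margin_expected_loss) auto
    from * show "(\<integral>S. std_loss (max_margin d (sample_list n S)) D \<partial>iid_samples n D) \<le> 2 * \<rho>\<^sup>2 / real n"
      by (intro max_margin_expected_loss) auto
  qed simp
qed

end
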